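(* For every $\delta>0$, $$\log D_M(x)\sim \log S_{M,\delta}(x)\sim \log D(x)\sim \log S(x)\qquad\text{as } x\to\infty .$$
   Context: Let $\mu$ be the M\"obius function and $M(x)=\sum_{n\le x}\mu(n)$ for real $x\ge 0$ (so $M(x)=0$ for $x<1$). Let $\Lambda$ be the von Mangoldt function ($\Lambda(n)=\log p$ if $n=p^m$ with $p$ prime and $m\ge1$, and $\Lambda(n)=0$ otherwise), $\psi(x)=\sum_{n\le x}\Lambda(n)$ and $\Delta(x)=\psi(x)-x$. $\log$ is the natural logarithm. For $x>1$ define $$D_M(x)=\frac1x\int_0^x|M(u)|\,du,\qquad S_{M,\delta}(x)=\max_{x^{1-\delta}\le u\le x}|M(u)|,$$ $$D(x)=\frac1x\int_0^x|\Delta(u)|\,du,\qquad S(x)=\max_{0\le u\le x}|\Delta(u)|\ \text{(understood as a supremum)}.$$ $f(x)\sim g(x)$ as $x\to\infty$ means $f(x)/g(x)\to1$ as $x\to\infty$. *)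

theory Defs
  imports
    "HOL-Analysis.Analysis"
    "HOL-Computational_Algebra.Squarefree"
    "HOL-Number_Theory.Prime_Powers"
begin

definition moebius :: "nat \<Rightarrow> real" where
  "moebius n = (if squarefree n then (-1) ^ card (prime_factors n) else 0)"

(* The sums over n \<le> x run over the integers 1 \<le> n \<le> x; they are empty for x < 1. *)

definition mertens :: "real \<Rightarrow> real" where
  "mertens x = (\<Sum>n\<in>{1..nat \<lfloor>x\<rfloor>}. moebius n)"

definition psi :: "real \<Rightarrow> real" where
  "psi x = (\<Sum>n\<in>{1..nat \<lfloor>x\<rfloor>}. mangoldt n)"

definition Delta :: "real \<Rightarrow> real" where
  "Delta x = psi x - x"

definition D_M :: "real \<Rightarrow> real" where
  "D_M x = (1 / x) * integral {0..x} (\<lambda>u. \<bar>mertens u\<bar>)"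

(* The supremum is a maximum: mertens takes only finitely many values on a bounded set. *)
definition S_M :: "real \<Rightarrow> real \<Rightarrow> real" where
  "S_M \<delta> x = (SUP u\<in>{x powr (1 - \<delta>)..x}. \<bar>mertens u\<bar>)"

definition D_psi :: "real \<Rightarrow> real" where
  "D_psi x = (1 / x) * integral {0..x} (\<lambda>u. \<bar>Delta u\<bar>)"

definition S_psi :: "real \<Rightarrow> real" where
  "S_psi x = (SUP u\<in>{0..x}. \<bar>Delta u\<bar>)"

end

(* All four quantities are x powr (Theta + o(1)), where Theta is the supremum of the real parts of
   the zeros of zeta. In the logarithmic variable v = ln x, the function mertens (exp v) (and likewise
   Delta (exp v)) is convolved with the kernel K(y) that sums (s - 1) (exp y / n)^s + 1 over n <= exp y;
   this kernel equals exp (s y) (s - 1) zeta(s) up to a bounded error, while Moebius inversion evaluates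
   the convolution. At a zero s = rho the kernel is bounded and the convolution has size
   exp (Re rho * L), which gives lower bounds for the L1 norm. For Re s > 1 the same identity gives the
   Laplace transforms (s - 1) / (s Z s) and - (Z' s / Z s + 1) / s, with Z s = (s - 1) zeta(s).
   To the right of Theta these are small by Borel-Caratheodory and Littlewood's convexity argument, and
   shifting the contour after Gaussian smoothing gives pointwise upper bounds with exponent Theta + o(1).
   The ratios of logarithms tend to 1 because Theta > 0: zeta has a zero near 1/2 + 14.13 i, detected by
   Euler-Maclaurin summation and the minimum modulus principle. *)
theory Submission
  imports Defs "HOL-Complex_Analysis.Complex_Analysis" "HOL-Probability.Probability" "HOL-Real_Asymp.Real_Asymp"
begin

section \<open>The function \<open>(s - 1) \<zeta>(s)\<close>\<close>

text \<open>Some obstacles shape the proof. A zero gives a lower bound only for the integral of |A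
  (exp v)| over all of [0, L], whereas \<open>D_M\<close> and \<open>S_M\<close> look near the top
  of the range. The upper bound with exponent close to \<open>Theta\<close> makes the part below (1
  - \<eta>) L of smaller order, so the mass lies in the top segment; this also uses
  \<open>Theta > 0\<close>. Since \<open>Theta\<close> need not be attained by a zero, every
  estimate loses an arbitrarily small exponent, which the logarithms forget. For
  \<open>Delta\<close>, a multiple zero kills both Z and its derivative, so evaluation at the zero
  says nothing; the identity is used on a small circle instead and divided by a power of s - \<rho>.
  Finally, the jumps of the summatory functions limit the available decay of the Laplace transforms
  to about 1 / |s|, which is not absolutely integrable on a vertical line. Hence the Gaussian, whose
  width must still be below the spacing 1 / N of the logarithms of integers near N, so that a
  smoothed value yields a pointwise one.\<close>

definition cpow :: "real \<Rightarrow> complex \<Rightarrow> complex" where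
  "cpow u w = exp (w * of_real (ln u))"

lemma cpow_1 [simp]: "cpow 1 w = 1"
  by (simp add: cpow_def)

lemma cpow_0_right [simp]: "cpow u 0 = 1"
  by (simp add: cpow_def)

lemma norm_cpow: "u > 0 \<Longrightarrow> norm (cpow u w) = u powr Re w"
  by (simp add: cpow_def powr_def)

lemma cpow_add: "cpow u (w + z) = cpow u w * cpow u z"
  by (simp add: cpow_def exp_add ring_distribs)

lemma cpow_one_right: "u > 0 \<Longrightarrow> cpow u 1 = of_real u"
  by (simp add: cpow_def exp_of_real)

lemma cpow_of_exp: "cpow (exp y) w = exp (w * of_real y)"
  by (simp add: cpow_def)

lemma cpow_has_vector_derivative:
  assumes "u > 0"
  shows "((\<lambda>u. cpow u w) has_vector_derivative w * cpow u (w - 1)) (at u within S)"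
proof -
  have 1: "((\<lambda>u. of_real (ln u) :: complex) has_vector_derivative of_real (1 / u)) (at u within S)"
    using assms by (auto intro!: has_vector_derivative_of_real derivative_eq_intros simp: has_real_derivative_iff_has_vector_derivative[symmetric] divide_inverse)
  have 2: "(exp has_field_derivative exp (w * of_real (ln u))) (at (w * of_real (ln u)))"
    by (rule DERIV_exp)
  have 3: "((\<lambda>u. w * of_real (ln u)) has_vector_derivative w * of_real (1 / u)) (at u within S)"
    by (intro has_vector_derivative_mult_right 1)
  have "((exp \<circ> (\<lambda>u. w * of_real (ln u))) has_vector_derivative (w * of_real (1 / u)) * exp (w * of_real (ln u))) (at u within S)"
    by (rule field_vector_diff_chain_within[OF 3]) (use 2 has_field_derivative_at_within in blast)
  moreover have "w * cpow u (w - 1) = (w * of_real (1 / u)) * exp (w * of_real (ln u))"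
  proof -
    have "cpow u w = cpow u (w - 1) * cpow u 1" by (simp flip: cpow_add)
    then have "cpow u (w - 1) = cpow u w / of_real u" using assms by (simp add: cpow_one_right)
    then show ?thesis by (simp add: cpow_def)
  qed
  ultimately show ?thesis by (simp add: cpow_def[abs_def] comp_def)
qed

lemma norm_cpow_diff_le:
  assumes "0 < a" "a \<le> u" "Re w \<le> 1"
  shows "norm (cpow u w - cpow a w) \<le> norm w * a powr (Re w - 1) * (u - a)"
proof -
  have "norm (cpow u w - cpow a w) \<le> norm w * a powr (Re w - 1) * norm (u - a)"
  proof (rule differentiable_bound[of "{a..u}" _ "\<lambda>x h. h *\<^sub>R (w * cpow x (w - 1))"])
    fix x assume x: "x \<in> {a..u}"
    then have "x > 0" using assms by auto
    then show "((\<lambda>x. cpow x w) has_derivative (\<lambda>h. h *\<^sub>R (w * cpow x (w - 1)))) (at x within {a..u})"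
      using cpow_has_vector_derivative[of x w "{a..u}"] by (simp add: has_vector_derivative_def)
    show "onorm (\<lambda>h. h *\<^sub>R (w * cpow x (w - 1))) \<le> norm w * a powr (Re w - 1)"
    proof (rule onorm_le)
      fix h :: real
      have "norm (cpow x (w - 1)) \<le> a powr (Re w - 1)"
        using \<open>x > 0\<close> x assms by (simp add: norm_cpow powr_mono2')
      then show "norm (h *\<^sub>R (w * cpow x (w - 1))) \<le> norm w * a powr (Re w - 1) * norm h"
        by (simp add: norm_mult mult.commute mult_left_mono mult_right_mono)
    qed
  qed (use assms in auto)
  then show ?thesis using assms by simp
qed

text \<open>This is s - 1 times the difference between n^(-s) and the integral of u^(-s) over
  [n, n + 1]. Multiplied out, it is entire in s, so s = 1 is no exception.\<close>

definition zterm :: "nat \<Rightarrow> complex \<Rightarrow> complex" where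
  "zterm n s = (s - 1) * cpow n (-s) + cpow (Suc n) (1 - s) - cpow n (1 - s)"

text \<open>Mean value inequality twice: \<open>zterm n s\<close> is the increment of q over
  [n, n + 1], and q' = (1 - s)(x^(-s) - n^(-s)) is itself an increment. The power of n gained over
  n^(- Re s) moves the region of convergence to Re s > 0.\<close>

lemma norm_zterm_le:
  assumes "n > 0" "Re s > 0"
  shows "norm (zterm n s) \<le> norm s * norm (s - 1) * real n powr (- Re s - 1)"
proof -
  define q where "q x = cpow x (1 - s) + (s - 1) * cpow n (-s) * of_real x" for x
  have "norm (q (Suc n) - q n) \<le> (norm s * norm (s - 1) * real n powr (- Re s - 1)) * norm (real (Suc n) - real n)"
  proof (rule differentiable_bound[of "{real n..Suc n}" _ "\<lambda>x h. h *\<^sub>R ((1 - s) * (cpow x (-s) - cpow n (-s)))"])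
    fix x assume x: "x \<in> {real n..Suc n}"
    then have "x > 0" using assms by auto
    have 1: "((\<lambda>x. of_real x :: complex) has_vector_derivative 1) (at x within {real n..Suc n})"
      by (rule has_vector_derivative_real_field) (auto intro!: derivative_eq_intros)
    have 2: "(q has_vector_derivative (1 - s) * cpow x (1 - s - 1) + (s - 1) * cpow n (-s) * 1) (at x within {real n..Suc n})"
      unfolding q_def by (intro has_vector_derivative_add has_vector_derivative_mult_right cpow_has_vector_derivative \<open>x > 0\<close> 1)
    then show "(q has_derivative (\<lambda>h. h *\<^sub>R ((1 - s) * (cpow x (-s) - cpow n (-s))))) (at x within {real n..Suc n})"
      by (simp add: has_vector_derivative_def algebra_simps)
    show "onorm (\<lambda>h. h *\<^sub>R ((1 - s) * (cpow x (-s) - cpow n (-s)))) \<le> norm s * norm (s - 1) * real n powr (- Re s - 1)"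
    proof (rule onorm_le)
      fix h :: real
      have "norm (cpow x (-s) - cpow n (-s)) \<le> norm (-s) * real n powr (Re (-s) - 1) * (x - n)"
        by (rule norm_cpow_diff_le) (use assms x in auto)
      also have "\<dots> \<le> norm s * real n powr (- Re s - 1) * 1"
        using x by (intro mult_mono) auto
      finally have "norm h * (norm (s - 1) * norm (cpow x (-s) - cpow n (-s))) \<le> norm h * (norm (s - 1) * (norm s * real n powr (- Re s - 1)))"
        by (intro mult_left_mono) auto
      then show "norm (h *\<^sub>R ((1 - s) * (cpow x (-s) - cpow n (-s)))) \<le> norm s * norm (s - 1) * real n powr (- Re s - 1) * norm h"
        by (simp add: norm_mult norm_minus_commute[of 1 s] mult_ac)
    qed
  qed auto
  moreover have "q (Suc n) - q n = zterm n s"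
    by (simp add: q_def zterm_def algebra_simps)
  ultimately show ?thesis by simp
qed

text \<open>\<open>Z s\<close> is the analytic continuation of \<open>(s - 1) \<zeta>(s)\<close> to the right half-plane.\<close>

definition Z :: "complex \<Rightarrow> complex" where
  "Z s = 1 + (\<Sum>n. zterm (Suc n) s)"

text \<open>A majorant by consecutive differences, so that tails of the series have closed
  bounds.\<close>

lemma powr_telescope:
  assumes "n > 1" "\<sigma> > 0"
  shows "real n powr (- \<sigma> - 1) \<le> (real (n - 1) powr (-\<sigma>) - real n powr (-\<sigma>)) / \<sigma>"
proof -
  have n: "real (n - 1) = real n - 1" using assms by simp
  have "\<exists>z>real n - 1. z < real n \<and> real n powr (-\<sigma>) - (real n - 1) powr (-\<sigma>) = (real n - (real n - 1)) * (- \<sigma> * z powr (-\<sigma> - 1))"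
    by (rule MVT2) (use assms in \<open>auto intro!: has_real_derivative_powr[THEN DERIV_cong]\<close>)
  then obtain z where z: "z > real n - 1" "z < real n" and eq: "real n powr (-\<sigma>) - (real n - 1) powr (-\<sigma>) = - \<sigma> * z powr (-\<sigma> - 1)"
    by auto
  have "real n powr (-\<sigma>-1) \<le> z powr (-\<sigma>-1)"
    using z assms by (intro powr_mono2') auto
  then have "\<sigma> * real n powr (-\<sigma>-1) \<le> \<sigma> * z powr (-\<sigma>-1)"
    using assms by (intro mult_left_mono) auto
  then have "\<sigma> * real n powr (-\<sigma>-1) \<le> real (n - 1) powr (-\<sigma>) - real n powr (-\<sigma>)"
    using eq n by simp
  then show ?thesis using assms by (simp add: pos_le_divide_eq mult.commute)
qed

lemma summable_zterm_bound: "\<sigma> > 0 \<Longrightarrow> summable (\<lambda>n. real (Suc n) powr (- \<sigma> - 1))"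
  using summable_Suc_iff[of "\<lambda>n. real n powr (-\<sigma> - 1)"] by (simp add: summable_real_powr_iff del: of_nat_Suc)

lemma summable_norm_zterm:
  assumes "Re s > 0"
  shows "summable (\<lambda>n. norm (zterm (Suc n) s))"
proof (rule summable_comparison_test')
  show "summable (\<lambda>n. norm s * norm (s - 1) * real (Suc n) powr (- Re s - 1))"
    by (intro summable_mult summable_zterm_bound assms)
  show "norm (norm (zterm (Suc n) s)) \<le> norm s * norm (s - 1) * real (Suc n) powr (- Re s - 1)" for n
    using norm_zterm_le[of "Suc n" s] assms by simp
qed

lemma summable_zterm: "Re s > 0 \<Longrightarrow> summable (\<lambda>n. zterm (Suc n) s)"
  by (rule summable_norm_cancel[OF summable_norm_zterm])

lemma sum_zterm: "(\<Sum>n<N. zterm (Suc n) s) = (s - 1) * (\<Sum>n\<in>{1..N}. cpow (real n) (-s)) + cpow (Suc N) (1 - s) - 1"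
  by (induction N) (auto simp: zterm_def algebra_simps)

text \<open>The partial sums of \<open>zterm\<close> telescope to a Dirichlet polynomial plus one
  power; the left side is therefore the tail of the series for Z, measured with
  \<open>powr_telescope\<close>.\<close>

lemma Z_partial:
  assumes "Re s > 0" "N > 0"
  shows "norm (Z s - (s - 1) * (\<Sum>n\<in>{1..N}. cpow (real n) (-s)) - cpow (Suc N) (1 - s))
           \<le> norm s * norm (s - 1) * real N powr (- Re s) / Re s"
proof -
  have "(\<Sum>n. zterm (Suc n) s) = (\<Sum>n. zterm (Suc (n + N)) s) + (\<Sum>n<N. zterm (Suc n) s)"
    by (rule suminf_split_initial_segment[OF summable_zterm[OF assms(1)]])
  then have "Z s - (s - 1) * (\<Sum>n\<in>{1..N}. cpow (real n) (-s)) - cpow (Suc N) (1 - s) = (\<Sum>n. zterm (Suc (n + N)) s)"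
    by (simp add: Z_def sum_zterm)
  also have "norm \<dots> \<le> norm s * norm (s - 1) * real N powr (- Re s) / Re s"
  proof -
    define b where "b n = norm s * norm (s - 1) * ((real (n + N) powr (-Re s) - real (Suc n + N) powr (-Re s)) / Re s)" for n
    have "(\<lambda>n. real n powr (-Re s)) \<longlonglongrightarrow> 0"
      by (rule tendsto_neg_powr[OF _ filterlim_real_sequentially]) (use assms in simp)
    then have lim: "(\<lambda>n. real (n + N) powr (-Re s)) \<longlonglongrightarrow> 0"
      by (rule LIMSEQ_ignore_initial_segment)
    have b: "b sums (norm s * norm (s - 1) * ((real (0 + N) powr (-Re s) - 0) / Re s))"
      unfolding b_def by (intro sums_mult sums_divide telescope_sums'[OF lim])
    have le: "norm (zterm (Suc (n + N)) s) \<le> b n" for n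
    proof -
      have "norm (zterm (Suc (n + N)) s) \<le> norm s * norm (s - 1) * real (Suc (n + N)) powr (- Re s - 1)"
        using norm_zterm_le[of "Suc (n + N)" s] assms by simp
      also have "\<dots> \<le> b n"
        unfolding b_def using powr_telescope[of "Suc (n + N)" "Re s"] assms
        by (intro mult_left_mono) auto
      finally show ?thesis .
    qed
    have "norm (\<Sum>n. zterm (Suc (n + N)) s) \<le> (\<Sum>n. b n)"
      by (rule norm_suminf_le[OF le sums_summable[OF b]])
    then show ?thesis using sums_unique[OF b] by simp
  qed
  finally show ?thesis .
qed

lemma holomorphic_cpow [holomorphic_intros]:
  "f holomorphic_on A \<Longrightarrow> (\<lambda>s. cpow u (f s)) holomorphic_on A"
  unfolding cpow_def by (intro holomorphic_intros)

lemma holomorphic_Z: "Z holomorphic_on {s. Re s > 0}"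
proof -
  have op: "open {s. Re s > 0}" by (simp add: open_halfspace_Re_gt)
  have "(\<lambda>s. \<Sum>n. zterm (Suc n) s) holomorphic_on {s. Re s > 0}"
  proof (rule holomorphic_uniform_sequence[OF op])
    show "(\<lambda>s. \<Sum>n<N. zterm (Suc n) s) holomorphic_on {s. Re s > 0}" for N
      unfolding zterm_def by (intro holomorphic_intros)
    fix s assume s: "s \<in> {s. Re s > 0}"
    define d where "d = Re s / 2"
    have d: "d > 0" using s by (simp add: d_def)
    have in_ball: "Re z \<ge> d \<and> norm z \<le> norm s + d \<and> norm (z - 1) \<le> norm s + d + 1" if "z \<in> cball s d" for z
    proof -
      have "norm (z - s) \<le> d" using that by (simp add: dist_norm norm_minus_commute)
      moreover have "\<bar>Re (z - s)\<bar> \<le> norm (z - s)" by (rule abs_Re_le_cmod)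
      moreover have "norm z \<le> norm s + norm (z - s)" using norm_triangle_sub[of z s] by simp
      moreover have "norm (z - 1) \<le> norm z + 1" using norm_triangle_ineq4[of z 1] by simp
      ultimately show ?thesis by (auto simp: d_def)
    qed
    have "uniform_limit (cball s d) (\<lambda>N s. \<Sum>n<N. zterm (Suc n) s) (\<lambda>s. \<Sum>n. zterm (Suc n) s) sequentially"
    proof (rule Weierstrass_m_test)
      show "summable (\<lambda>n. (norm s + d) * (norm s + d + 1) * real (Suc n) powr (- d - 1))"
        by (intro summable_mult summable_zterm_bound d)
      fix n z assume z: "z \<in> cball s d"
      note z' = in_ball[OF z]
      have "norm (zterm (Suc n) z) \<le> norm z * norm (z - 1) * real (Suc n) powr (- Re z - 1)"
        using norm_zterm_le[of "Suc n" z] z' d by simp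
      also have "\<dots> \<le> (norm s + d) * (norm s + d + 1) * real (Suc n) powr (- d - 1)"
        using z' d by (intro mult_mono powr_mono) auto
      finally show "norm (zterm (Suc n) z) \<le> (norm s + d) * (norm s + d + 1) * real (Suc n) powr (- d - 1)" .
    qed
    moreover have "cball s d \<subseteq> {s. Re s > 0}"
    proof
      fix z assume "z \<in> cball s d"
      then show "z \<in> {s. Re s > 0}" using in_ball[of z] d by simp
    qed
    ultimately show "\<exists>d>0. cball s d \<subseteq> {s. 0 < Re s} \<and> uniform_limit (cball s d) (\<lambda>N s. \<Sum>n<N. zterm (Suc n) s) (\<lambda>s. \<Sum>n. zterm (Suc n) s) sequentially"
      using d by blast
  qed
  then show ?thesis unfolding Z_def[abs_def] by (intro holomorphic_intros)
qed

text \<open>Quadratic growth in the strip; divided by |s - 1|, it becomes the crude upper bound for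
  zeta on which Littlewood's argument rests. The first term is split off because
  \<open>Z_partial\<close> starts at N > 0.\<close>

lemma norm_Z_le:
  assumes "Re s \<ge> \<sigma>" "\<sigma> > 0"
  shows "norm (Z s) \<le> 1 + norm s * norm (s - 1) * (1 + 1 / \<sigma>)"
proof -
  have s: "Re s > 0" using assms by simp
  have "norm (\<Sum>n. zterm (Suc n) s) \<le> norm (zterm 1 s) + norm (\<Sum>n. zterm (Suc (n+1)) s)"
    using suminf_split_initial_segment[OF summable_zterm[OF s], of 1] norm_triangle_ineq by (simp add: add.commute)
  moreover have "norm (zterm 1 s) \<le> norm s * norm (s - 1)"
    using norm_zterm_le[of 1 s] s by simp
  moreover have "norm (\<Sum>n. zterm (Suc (n+1)) s) \<le> norm s * norm (s - 1) / \<sigma>"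
  proof -
    have "(\<Sum>n. zterm (Suc n) s) = (\<Sum>n. zterm (Suc (n + 1)) s) + (\<Sum>n<1. zterm (Suc n) s)"
      by (rule suminf_split_initial_segment[OF summable_zterm[OF s]])
    then have "(\<Sum>n. zterm (Suc (n+1)) s) = Z s - (s - 1) * (\<Sum>n\<in>{1..1::nat}. cpow (real n) (-s)) - cpow (Suc 1) (1 - s)"
      unfolding Z_def sum_zterm by simp
    then have "norm (\<Sum>n. zterm (Suc (n+1)) s) \<le> norm s * norm (s - 1) / Re s"
      using Z_partial[OF s, of 1] by simp
    also have "\<dots> \<le> norm s * norm (s - 1) / \<sigma>"
      using assms by (intro divide_left_mono mult_pos_pos) auto
    finally show ?thesis .
  qed
  moreover have "norm (Z s) \<le> 1 + norm (\<Sum>n. zterm (Suc n) s)"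
    unfolding Z_def by (rule order_trans[OF norm_triangle_ineq]) simp
  ultimately show ?thesis by (simp add: algebra_simps)
qed

section \<open>Convolution identities\<close>

lemma mem_floor_exp: "m \<in> {1..nat \<lfloor>exp v\<rfloor>} \<longleftrightarrow> m \<ge> 1 \<and> ln (real m) \<le> v"
proof (cases "m \<ge> 1")
  case True
  then have "m \<le> nat \<lfloor>exp v\<rfloor> \<longleftrightarrow> real m \<le> exp v"
    by (simp add: le_nat_iff le_floor_iff)
  also have "\<dots> \<longleftrightarrow> ln (real m) \<le> v"
    using True ln_le_cancel_iff[of "real m" "exp v"] by simp
  finally show ?thesis using True by simp
qed auto

text \<open>The kernel \<open>Kker s y\<close> is \<open>exp (s y) Z s\<close> up to a bounded error \<open>Rker s y\<close>; hence it is bounded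
  at the zeros of \<open>Z\<close>. On the other hand, its convolution with \<open>mertens (exp v)\<close> is \<open>Gker s\<close>, which has size \<open>exp (Re s * y)\<close>.\<close>

definition gker :: "complex \<Rightarrow> real \<Rightarrow> complex" where
  "gker s y = (s - 1) * exp (s * of_real y) + 1"

definition Gker :: "complex \<Rightarrow> real \<Rightarrow> complex" where
  "Gker s y = (s - 1) * (exp (s * of_real y) - 1) / s + of_real y"

definition Kker :: "complex \<Rightarrow> real \<Rightarrow> complex" where
  "Kker s y = (\<Sum>n\<in>{1..nat \<lfloor>exp y\<rfloor>}. gker s (y - ln (real n)))"

definition Rker :: "complex \<Rightarrow> real \<Rightarrow> complex" where
  "Rker s y = Kker s y - exp (s * of_real y) * Z s"

lemma Kker_eq:
  "Kker s y = (s - 1) * (exp (s * of_real y) * (\<Sum>n\<in>{1..nat \<lfloor>exp y\<rfloor>}. cpow (real n) (-s))) + of_nat (nat \<lfloor>exp y\<rfloor>)"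
proof -
  have "exp (s * of_real (y - ln (real n))) = exp (s * of_real y) * cpow (real n) (-s)" for n
    by (simp add: cpow_def mult_exp_exp algebra_simps)
  then show ?thesis
    unfolding Kker_def gker_def sum.distrib sum_distrib_left by simp
qed

text \<open>The sum of the three errors in \<open>norm_Rker_le\<close>. It is continuous in s, hence
  bounded on the compact discs of the later Cauchy estimates.\<close>

definition Rbound :: "complex \<Rightarrow> real" where
  "Rbound s = 1 + norm (s - 1) + norm s * norm (s - 1) * 2 powr Re s / Re s"

text \<open>The summand 1 in \<open>gker\<close> contributes floor (exp y) to the kernel. Up to 1
  this cancels the main term u^s * u^(1 - s) = u, u = exp y, by which u^s Z s differs from its
  Dirichlet polynomial part. What remains is the tail of Z and the rounding from u to N + 1.\<close>

lemma norm_Rker_le: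
  assumes "Re s > 0" "y \<ge> 0"
  shows "norm (Rker s y) \<le> Rbound s"
proof -
  define u where "u = exp y"
  define N where "N = nat \<lfloor>u\<rfloor>"
  define P where "P = (\<Sum>n\<in>{1..N}. cpow (real n) (-s))"
  have u: "u \<ge> 1" using assms by (simp add: u_def)
  then have fl: "\<lfloor>u\<rfloor> \<ge> 1" by (simp add: le_floor_iff)
  then have N: "N > 0" "real N \<le> u" "u < real N + 1" using u by (simp_all add: N_def)
  have N1: "real N \<ge> 1" using N by linarith
  have e: "exp (s * of_real y) = cpow u s" by (simp add: u_def cpow_of_exp)
  have "cpow u s * cpow u (1 - s) = of_real u"
    using u by (simp flip: cpow_add add: cpow_one_right)
  then have "Rker s y = (of_nat N - of_real u) - cpow u s * (Z s - (s - 1) * P - cpow (Suc N) (1 - s))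
                - cpow u s * (cpow (Suc N) (1 - s) - cpow u (1 - s))"
    by (simp add: Rker_def Kker_eq e algebra_simps N_def P_def flip: u_def)
  also have "norm \<dots> \<le> norm (of_nat N - complex_of_real u) + norm (cpow u s * (Z s - (s - 1) * P - cpow (Suc N) (1 - s)))
       + norm (cpow u s * (cpow (Suc N) (1 - s) - cpow u (1 - s)))"
    by (intro order_trans[OF norm_triangle_ineq4] add_mono order_refl)
  also have "norm (of_nat N - complex_of_real u) = \<bar>real N - u\<bar>"
    by (metis norm_of_real of_real_diff of_real_of_nat_eq)
  also have "\<dots> \<le> 1" using N by simp
  also have "norm (cpow u s * (Z s - (s - 1) * P - cpow (Suc N) (1 - s)))
      \<le> norm s * norm (s - 1) * 2 powr Re s / Re s"
  proof -
    have "u \<le> 2 * real N" using N N1 by linarith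
    then have "u powr Re s \<le> (2 * real N) powr Re s"
      using u assms by (intro powr_mono2) auto
    then have "u powr Re s \<le> 2 powr Re s * real N powr Re s"
      by (simp add: powr_mult)
    then have *: "u powr Re s * real N powr (- Re s) \<le> 2 powr Re s"
      using N by (simp add: powr_minus field_simps)
    have "norm (cpow u s * (Z s - (s - 1) * P - cpow (Suc N) (1 - s)))
        \<le> u powr Re s * (norm s * norm (s - 1) * real N powr (- Re s) / Re s)"
      unfolding norm_mult using Z_partial[OF assms(1) N(1)] u unfolding P_def
      by (intro mult_mono) (auto simp: norm_cpow)
    also have "\<dots> = norm s * norm (s - 1) / Re s * (u powr Re s * real N powr (- Re s))"
      by simp
    also have "\<dots> \<le> norm s * norm (s - 1) / Re s * 2 powr Re s"
      using * assms by (intro mult_left_mono) auto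
    finally show ?thesis by simp
  qed
  also have "norm (cpow u s * (cpow (Suc N) (1 - s) - cpow u (1 - s))) \<le> norm (s - 1)"
  proof -
    have "norm (cpow (Suc N) (1 - s) - cpow u (1 - s)) \<le> norm (1 - s) * u powr (Re (1 - s) - 1) * (Suc N - u)"
      by (rule norm_cpow_diff_le) (use u N assms in auto)
    also have "\<dots> \<le> norm (1 - s) * u powr (Re (1 - s) - 1) * 1"
      using N by (intro mult_left_mono) auto
    finally have "norm (cpow u s) * norm (cpow (Suc N) (1 - s) - cpow u (1 - s)) \<le> u powr Re s * (norm (1 - s) * u powr (- Re s))"
      using u by (intro mult_mono) (auto simp: norm_cpow)
    also have "\<dots> = norm (s - 1)" using u by (simp add: powr_minus norm_minus_commute)
    finally show ?thesis by (simp add: norm_mult)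
  qed
  finally show ?thesis by (simp add: Rbound_def)
qed

text \<open>The pair (m, n) is active exactly for v in [ln m, L - ln n], which is nonempty iff m n
  \<le> exp L. Integrating g there gives a m * G (L - ln (m n)), because G 0 = 0 removes the upper
  endpoint. Grouping the pairs by their product produces the divisor sum b.\<close>

lemma convolution_has_integral:
  fixes a b :: "nat \<Rightarrow> real" and g G :: "real \<Rightarrow> complex"
  assumes G: "\<And>y. (G has_vector_derivative g y) (at y)" and G0: "G 0 = 0"
    and b: "\<And>n. n > 0 \<Longrightarrow> b n = (\<Sum>d | d dvd n. a d)"
    and L: "L \<ge> 0"
  shows "((\<lambda>v. of_real (\<Sum>m\<in>{1..nat \<lfloor>exp v\<rfloor>}. a m) * (\<Sum>n\<in>{1..nat \<lfloor>exp (L - v)\<rfloor>}. g (L - v - ln (real n))))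
           has_integral (\<Sum>n\<in>{1..nat \<lfloor>exp L\<rfloor>}. of_real (b n) * G (L - ln (real n)))) {0..L}"
proof -
  define X where "X = nat \<lfloor>exp L\<rfloor>"
  define f where "f m n v = of_real (a m) * g (L - v - ln (real n))" for m n :: nat and v
  have X: "{1..X} = {m. m \<ge> 1 \<and> ln (real m) \<le> L}"
    unfolding X_def using mem_floor_exp by blast
  have single: "((\<lambda>v. if v \<in> {ln (real m)..L - ln (real n)} then f m n v else 0) has_integral
      (if m * n \<le> X then of_real (a m) * G (L - ln (real (m * n))) else 0)) {0..L}"
    if mn: "m \<in> {1..X}" "n \<in> {1..X}" for m n
  proof -
    have mn1: "m \<ge> 1" "n \<ge> 1" using mn by auto
    have ln0: "ln (real m) \<ge> 0" "ln (real n) \<ge> 0" using mn1 by auto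
    have lnmn: "ln (real (m * n)) = ln (real m) + ln (real n)" using mn1 by (simp add: ln_mult)
    have "m * n \<le> X \<longleftrightarrow> m * n \<in> {1..X}" using mn1 by auto
    also have "\<dots> \<longleftrightarrow> ln (real m) + ln (real n) \<le> L" unfolding X using mn1 lnmn by (simp add: le_simps)
    finally have le: "m * n \<le> X \<longleftrightarrow> ln (real m) + ln (real n) \<le> L" .
    have "(f m n has_integral (if m * n \<le> X then of_real (a m) * G (L - ln (real (m * n))) else 0)) {ln (real m)..L - ln (real n)}"
    proof (cases "m * n \<le> X")
      case True
      have "(f m n has_integral (- of_real (a m) * G (L - (L - ln (real n)) - ln (real n)) - (- of_real (a m) * G (L - ln (real m) - ln (real n))))) {ln (real m)..L - ln (real n)}"
      proof (rule fundamental_theorem_of_calculus)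
        fix v
        have 1: "((\<lambda>v. L - v - ln (real n)) has_real_derivative -1) (at v within {ln (real m)..L - ln (real n)})"
          by (auto intro!: derivative_eq_intros)
        have "((G \<circ> (\<lambda>v. L - v - ln (real n))) has_vector_derivative (- 1) *\<^sub>R g (L - v - ln (real n))) (at v within {ln (real m)..L - ln (real n)})"
          by (rule vector_diff_chain_within[OF 1[unfolded has_real_derivative_iff_has_vector_derivative] has_vector_derivative_at_within[OF G]])
        from has_vector_derivative_mult_right[OF this, of "- of_real (a m)"]
        show "((\<lambda>v. - of_real (a m) * G (L - v - ln (real n))) has_vector_derivative f m n v) (at v within {ln (real m)..L - ln (real n)})"
          by (simp add: f_def comp_def)
      qed (use True le in simp)
      then show ?thesis using True lnmn by (simp add: G0 diff_diff_eq)
    next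
      case False
      then have "{ln (real m)..L - ln (real n)} = {}" using le by auto
      then show ?thesis using False by simp
    qed
    then show ?thesis
      by (subst has_integral_restrict) (use ln0 in auto)
  qed
  have int: "((\<lambda>v. \<Sum>m\<in>{1..X}. \<Sum>n\<in>{1..X}. if v \<in> {ln (real m)..L - ln (real n)} then f m n v else 0) has_integral
      (\<Sum>m\<in>{1..X}. \<Sum>n\<in>{1..X}. if m * n \<le> X then of_real (a m) * G (L - ln (real (m * n))) else 0)) {0..L}"
    by (rule has_integral_sum, simp, rule has_integral_sum, simp, rule single)
  have eq: "(\<Sum>m\<in>{1..X}. \<Sum>n\<in>{1..X}. if v \<in> {ln (real m)..L - ln (real n)} then f m n v else 0)
     = of_real (\<Sum>m\<in>{1..nat \<lfloor>exp v\<rfloor>}. a m) * (\<Sum>n\<in>{1..nat \<lfloor>exp (L - v)\<rfloor>}. g (L - v - ln (real n)))"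
    if v: "v \<in> {0..L}" for v
  proof -
    have Y1: "{1..nat \<lfloor>exp v\<rfloor>} = {m\<in>{1..X}. ln (real m) \<le> v}"
      by (rule set_eqI, unfold X mem_floor_exp) (use v in auto)
    have Y2: "{1..nat \<lfloor>exp (L - v)\<rfloor>} = {m\<in>{1..X}. v \<le> L - ln (real m)}"
      by (rule set_eqI, unfold X mem_Collect_eq mem_floor_exp) (use v in \<open>auto intro: order_trans\<close>)
    have E1: "complex_of_real (\<Sum>m\<in>{1..nat \<lfloor>exp v\<rfloor>}. a m) = (\<Sum>m\<in>{1..X}. if ln (real m) \<le> v then of_real (a m) else 0)"
      unfolding Y1 of_real_sum by (rule sum.inter_filter) simp
    have E2: "(\<Sum>n\<in>{1..nat \<lfloor>exp (L - v)\<rfloor>}. g (L - v - ln (real n))) = (\<Sum>n\<in>{1..X}. if v \<le> L - ln (real n) then g (L - v - ln (real n)) else 0)"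
      unfolding Y2 by (rule sum.inter_filter) simp
    show ?thesis
      unfolding E1 E2 sum_product by (intro sum.cong refl) (simp add: f_def)
  qed
  have sums: "(\<Sum>m\<in>{1..X}. \<Sum>n\<in>{1..X}. if m * n \<le> X then of_real (a m) * G (L - ln (real (m * n))) else 0)
     = (\<Sum>n\<in>{1..X}. of_real (b n) * G (L - ln (real n)))"
  proof -
    have "(\<Sum>m\<in>{1..X}. \<Sum>n\<in>{1..X}. if m * n \<le> X then of_real (a m) * G (L - ln (real (m * n))) else 0)
       = (\<Sum>(m,n)\<in>{1..X}\<times>{1..X}. if m * n \<le> X then of_real (a m) * G (L - ln (real (m * n))) else 0)"
      by (simp add: sum.cartesian_product)
    also have "\<dots> = (\<Sum>(m,n)\<in>{p\<in>{1..X}\<times>{1..X}. fst p * snd p \<le> X}. of_real (a m) * G (L - ln (real (m * n))))"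
      by (subst sum.inter_filter) (auto intro!: sum.cong simp: case_prod_unfold)
    also have "\<dots> = (\<Sum>(n,d)\<in>(SIGMA n:{1..X}. {d. d dvd n}). of_real (a d) * G (L - ln (real n)))"
    proof (rule sum.reindex_bij_witness[of _ "\<lambda>(n,d). (d, n div d)" "\<lambda>(m,n). (m * n, m)"])
      fix p assume "p \<in> (SIGMA n:{1..X}. {d. d dvd n})"
      then obtain n d where p: "p = (n, d)" "1 \<le> n" "n \<le> X" "d dvd n" by auto
      then obtain k where k: "n = d * k" by auto
      then have dk: "d \<ge> 1" "k \<ge> 1" using p by (auto simp: Suc_le_eq intro: Nat.gr0I)
      then have "d \<le> d * k" "k \<le> d * k" by auto
      then have "d \<le> X" "k \<le> X" using p(3) k by linarith+
      then show "(case p of (n, d) \<Rightarrow> (d, n div d)) \<in> {p \<in> {1..X} \<times> {1..X}. fst p * snd p \<le> X}"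
        using p k dk by auto
    qed (auto simp: Suc_le_eq)
    also have "\<dots> = (\<Sum>n\<in>{1..X}. \<Sum>d | d dvd n. of_real (a d) * G (L - ln (real n)))"
      by (subst sum.Sigma) (auto simp: finite_divisors_nat)
    also have "\<dots> = (\<Sum>n\<in>{1..X}. of_real (b n) * G (L - ln (real n)))"
      by (intro sum.cong refl) (simp add: b sum_distrib_right)
    finally show ?thesis .
  qed
  show ?thesis unfolding X_def[symmetric]
    using has_integral_eq[OF eq int] unfolding sums .
qed

lemma Gker_has_vector_derivative: "s \<noteq> 0 \<Longrightarrow> (Gker s has_vector_derivative gker s y) (at y)"
proof -
  assume s: "s \<noteq> 0"
  have 1: "((\<lambda>y. of_real y :: complex) has_vector_derivative 1) (at y)"
    by (rule has_vector_derivative_real_field) (auto intro!: derivative_eq_intros)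
  have "((\<lambda>z. (s - 1) * (exp (s * z) - 1) / s + z) has_field_derivative gker s y) (at (of_real y))"
    unfolding gker_def using s by (auto intro!: derivative_eq_intros)
  from field_vector_diff_chain_at[OF 1 this] show ?thesis
    by (simp add: Gker_def[abs_def] comp_def)
qed

lemma Gker_0 [simp]: "Gker s 0 = 0"
  by (simp add: Gker_def)

lemma arith_Kker_has_integral:
  fixes a b :: "nat \<Rightarrow> real"
  assumes "s \<noteq> 0" "\<And>n. n > 0 \<Longrightarrow> b n = (\<Sum>d | d dvd n. a d)" "L \<ge> 0"
  shows "((\<lambda>v. of_real (\<Sum>m\<in>{1..nat \<lfloor>exp v\<rfloor>}. a m) * Kker s (L - v))
           has_integral (\<Sum>n\<in>{1..nat \<lfloor>exp L\<rfloor>}. of_real (b n) * Gker s (L - ln (real n)))) {0..L}"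
  unfolding Kker_def
  by (rule convolution_has_integral[OF Gker_has_vector_derivative[OF assms(1)] Gker_0 assms(2,3)])

text \<open>This handles the linear term of \<open>Delta\<close>. The product of exp v with
  \<open>gker\<close> has the elementary primitive H, so the value is exact.\<close>

lemma exp_Kker_has_integral:
  assumes L: "L \<ge> 0"
  shows "((\<lambda>v. of_real (exp v) * Kker s (L - v))
           has_integral (\<Sum>n\<in>{1..nat \<lfloor>exp L\<rfloor>}. exp (s * of_real (L - ln (real n))) - 1)) {0..L}"
proof -
  define X where "X = nat \<lfloor>exp L\<rfloor>"
  have X: "{1..X} = {m. m \<ge> 1 \<and> ln (real m) \<le> L}"
    unfolding X_def using mem_floor_exp by blast
  define f where "f l v = of_real (exp v) * gker s (L - v - l)" for l v
  have single: "((\<lambda>v. if v \<in> {0..L - ln (real n)} then f (ln (real n)) v else 0) has_integral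
      (exp (s * of_real (L - ln (real n))) - 1)) {0..L}"
    if n: "n \<in> {1..X}" for n
  proof -
    define l where "l = ln (real n)"
    have l: "0 \<le> l" "l \<le> L" using n unfolding X l_def by auto
    define H where "H v = - exp v * exp (s * (of_real (L - l) - v)) + exp v" for v :: complex
    have "(f l has_integral (H (of_real (L - l)) - H (of_real 0))) {0..L - l}"
    proof (rule fundamental_theorem_of_calculus)
      fix v
      have "(H has_field_derivative f l v) (at (of_real v))"
        unfolding H_def f_def gker_def
        by (auto intro!: derivative_eq_intros simp: algebra_simps exp_of_real)
      then show "((\<lambda>v. H (of_real v)) has_vector_derivative f l v) (at v within {0..L - l})"
        by (intro has_vector_derivative_real_field)
    qed (use l in auto)
    also have "H (of_real (L - l)) - H (of_real 0) = exp (s * of_real (L - l)) - 1"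
      by (simp add: H_def)
    finally show ?thesis
      unfolding l_def[symmetric] by (subst has_integral_restrict) (use l in auto)
  qed
  have "((\<lambda>v. \<Sum>n\<in>{1..X}. if v \<in> {0..L - ln (real n)} then f (ln (real n)) v else 0) has_integral
      (\<Sum>n\<in>{1..X}. exp (s * of_real (L - ln (real n))) - 1)) {0..L}"
    by (rule has_integral_sum, simp, rule single)
  moreover have "(\<Sum>n\<in>{1..X}. if v \<in> {0..L - ln (real n)} then f (ln (real n)) v else 0)
     = of_real (exp v) * Kker s (L - v)"
    if v: "v \<in> {0..L}" for v
  proof -
    have Y2: "{1..nat \<lfloor>exp (L - v)\<rfloor>} = {m\<in>{1..X}. v \<le> L - ln (real m)}"
      by (rule set_eqI, unfold X mem_Collect_eq mem_floor_exp) (use v in \<open>auto intro: order_trans\<close>)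
    have E2: "Kker s (L - v) = (\<Sum>n\<in>{1..X}. if v \<le> L - ln (real n) then gker s (L - v - ln (real n)) else 0)"
      unfolding Kker_def Y2 by (rule sum.inter_filter) simp
    show ?thesis
      unfolding E2 sum_distrib_left using v by (intro sum.cong refl) (simp add: f_def)
  qed
  ultimately show ?thesis unfolding X_def[symmetric]
    by (rule has_integral_eq[rotated])
qed

section \<open>Moebius inversion\<close>

lemma moebius_prime_mult:
  assumes "prime p" "\<not> p dvd d"
  shows "moebius (p * d) = - moebius d"
proof (cases "squarefree d")
  case True
  have cop: "coprime p d" using assms by (simp add: prime_imp_coprime)
  have "d \<noteq> 0" using assms by (intro notI) simp
  have "squarefree (p * d)"
    by (intro squarefree_mult_coprime[OF cop] squarefree_prime[OF assms(1)] True)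
  moreover have "prime_factors (p * d) = insert p (prime_factors d)"
    using assms \<open>d \<noteq> 0\<close> by (auto simp: prime_factors_product prime_prime_factors)
  moreover have "p \<notin> prime_factors d" using assms by (auto simp: in_prime_factors_iff)
  ultimately show ?thesis using True by (simp add: moebius_def)
next
  case False
  then have "\<not> squarefree (p * d)" using squarefree_multD by blast
  with False show ?thesis by (simp add: moebius_def)
qed

text \<open>For n > 1 fix a prime p dividing n and pair the squarefree divisors as d and p d with d
  prime to p; the two values have opposite signs.\<close>

lemma sum_moebius:
  assumes "n > 0"
  shows "(\<Sum>d | d dvd n. moebius d) = (if n = 1 then 1 else 0)"
proof (cases "n = 1")
  case True
  then show ?thesis by (simp add: moebius_def)
next
  case False
  then obtain p where p: "prime p" "p dvd n" using prime_factor_nat by blast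
  define A where "A = {d. d dvd n \<and> \<not> p dvd d \<and> squarefree d}"
  define B where "B = {d. d dvd n \<and> p dvd d \<and> squarefree d}"
  have fin: "finite {d. d dvd n}" using assms by (simp add: finite_divisors_nat)
  have p0: "p > 0" using p prime_gt_0_nat by blast
  have B: "B = (\<lambda>d. p * d) ` A"
  proof (intro set_eqI iffI)
    fix d assume d: "d \<in> B"
    then obtain e where e: "d = p * e" by (auto simp: B_def)
    have "\<not> p dvd e"
    proof
      assume "p dvd e"
      then have "p\<^sup>2 dvd d" using e by (auto simp: power2_eq_square)
      then show False using d p squarefreeD[of d p] by (auto simp: B_def)
    qed
    moreover have "e dvd n" using d e by (auto simp: B_def dest: dvd_mult_right)
    moreover have "squarefree e" using d e squarefree_multD by (auto simp: B_def)
    ultimately show "d \<in> (\<lambda>d. p * d) ` A" using e by (auto simp: A_def)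
  next
    fix d assume "d \<in> (\<lambda>d. p * d) ` A"
    then obtain e where e: "d = p * e" "e \<in> A" by auto
    then have cop: "coprime p e" using p by (auto simp: A_def prime_imp_coprime)
    have "squarefree (p * e)" using e
      by (intro squarefree_mult_coprime[OF cop] squarefree_prime[OF p(1)]) (auto simp: A_def)
    moreover have "p * e dvd n" using cop p e by (intro divides_mult) (auto simp: A_def)
    ultimately show "d \<in> B" using e by (auto simp: B_def)
  qed
  have "(\<Sum>d | d dvd n. moebius d) = (\<Sum>d\<in>A \<union> B. moebius d)"
    by (rule sum.mono_neutral_right) (use fin in \<open>auto simp: A_def B_def moebius_def\<close>)
  also have "\<dots> = (\<Sum>d\<in>A. moebius d) + (\<Sum>d\<in>B. moebius d)"
    by (rule sum.union_disjoint) (auto simp: A_def B_def intro: finite_subset[OF _ fin])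
  also have "(\<Sum>d\<in>B. moebius d) = (\<Sum>d\<in>A. moebius (p * d))"
    unfolding B by (subst sum.reindex) (use p0 in \<open>auto simp: inj_on_def\<close>)
  also have "\<dots> = (\<Sum>d\<in>A. - moebius d)"
    by (intro sum.cong refl moebius_prime_mult p) (auto simp: A_def)
  finally show ?thesis using False by (simp add: sum_negf)
qed

section \<open>Measurability and truncated Laplace transforms\<close>

lemma measurable_floor_sum:
  "(\<lambda>v. \<Sum>m\<in>{1..nat \<lfloor>h v\<rfloor>}. a m :: real) \<in> borel_measurable borel" if "h \<in> borel_measurable borel" for h :: "real \<Rightarrow> real"
proof -
  have "(\<lambda>v. nat \<lfloor>h v\<rfloor>) \<in> measurable borel (count_space UNIV)"
    by (rule measurable_compose[OF measurable_compose[OF that measurable_real_floor]]) simp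
  moreover have "(\<lambda>n::nat. \<Sum>m\<in>{1..n}. a m) \<in> measurable (count_space UNIV) borel"
    by simp
  ultimately show ?thesis by (rule measurable_compose)
qed

lemma bounded_measurable_absolutely_integrable:
  fixes f :: "real \<Rightarrow> 'b :: euclidean_space"
  assumes "f \<in> borel_measurable borel" "\<And>v. v \<in> {a..b} \<Longrightarrow> norm (f v) \<le> B"
  shows "f absolutely_integrable_on {a..b}"
proof (rule measurable_bounded_by_integrable_imp_absolutely_integrable[where g = "\<lambda>_. B"])
  have "f \<in> borel_measurable lborel" using assms(1) by simp
  then have "f \<in> borel_measurable lebesgue" by (rule measurable_completion)
  then show "f \<in> borel_measurable (lebesgue_on {a..b})" by (rule measurable_restrict_space1)
qed (use assms in auto)

text \<open>Truncation at L makes the transform meaningful for every s, also near the zeros of Z,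
  where the lower bound for \<open>Delta_log\<close> uses it.\<close>

definition laplace :: "(real \<Rightarrow> real) \<Rightarrow> real \<Rightarrow> complex \<Rightarrow> complex" where
  "laplace a L s = integral {0..L} (\<lambda>v. of_real (a v) * exp (- s * of_real v))"

lemma laplace_integrable:
  fixes s :: complex
  assumes "a \<in> borel_measurable borel" "\<And>v. v \<in> {0..L} \<Longrightarrow> \<bar>a v\<bar> \<le> B"
  shows "(\<lambda>v. of_real (a v) * exp (- s * of_real v)) absolutely_integrable_on {0..L}"
proof (rule bounded_measurable_absolutely_integrable[where B = "\<bar>B\<bar> * exp (\<bar>Re s\<bar> * L)"])
  show "(\<lambda>v. of_real (a v) * exp (- s * of_real v)) \<in> borel_measurable borel"
    using assms(1) by (intro borel_measurable_times measurable_compose[OF assms(1) borel_measurable_of_real]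
        borel_measurable_continuous_onI continuous_intros)
  fix v assume v: "v \<in> {0..L}"
  have "norm (exp (- s * of_real v)) = exp (- Re s * v)" by simp
  also have "\<dots> \<le> exp (\<bar>Re s\<bar> * L)"
  proof -
    have "- Re s * v \<le> \<bar>Re s\<bar> * v" using v by (intro mult_right_mono) auto
    also have "\<dots> \<le> \<bar>Re s\<bar> * L" using v by (intro mult_left_mono) auto
    finally show ?thesis by simp
  qed
  finally show "norm (of_real (a v) * exp (- s * of_real v)) \<le> \<bar>B\<bar> * exp (\<bar>Re s\<bar> * L)"
    unfolding norm_mult using assms(2)[OF v] by (intro mult_mono) auto
qed

text \<open>The splitting K (L - v) = exp (s (L - v)) Z s + R separates the Laplace transform from a
  remainder bounded by an L1 norm. At a zero of Z only the remainder is left, which gives lower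
  bounds for that norm; for Re s beyond the growth exponent of a the remainder is negligible, which
  identifies the transform.\<close>

lemma norm_convolution_minus_laplace_le:
  assumes meas: "a \<in> borel_measurable borel" and bd: "\<And>v. v \<in> {0..L} \<Longrightarrow> \<bar>a v\<bar> \<le> B"
    and J: "((\<lambda>v. of_real (a v) * Kker s (L - v)) has_integral J) {0..L}"
    and s: "Re s > 0" and L: "L \<ge> 0"
  shows "norm (J - exp (s * of_real L) * Z s * laplace a L s) \<le> Rbound s * integral {0..L} (\<lambda>v. \<bar>a v\<bar>)"
proof -
  have 1: "((\<lambda>v. exp (s * of_real L) * Z s * (of_real (a v) * exp (- s * of_real v))) has_integral
      exp (s * of_real L) * Z s * laplace a L s) {0..L}"
    unfolding laplace_def
    by (intro has_integral_mult_right integrable_integral set_lebesgue_integral_eq_integral laplace_integrable[OF meas bd])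
  have 2: "((\<lambda>v. of_real (a v) * Rker s (L - v)) has_integral (J - exp (s * of_real L) * Z s * laplace a L s)) {0..L}"
    by (rule has_integral_eq[OF _ has_integral_diff[OF J 1]])
       (simp add: Rker_def algebra_simps mult_exp_exp)
  have "(\<lambda>v. \<bar>a v\<bar>) absolutely_integrable_on {0..L}"
    by (rule bounded_measurable_absolutely_integrable[where B = B]) (use meas bd in auto)
  then have 3: "((\<lambda>v. Rbound s * \<bar>a v\<bar>) has_integral Rbound s * integral {0..L} (\<lambda>v. \<bar>a v\<bar>)) {0..L}"
    by (intro has_integral_mult_right integrable_integral set_lebesgue_integral_eq_integral)
  show ?thesis
  proof -
    have "norm (integral {0..L} (\<lambda>v. of_real (a v) * Rker s (L - v))) \<le> integral {0..L} (\<lambda>v. Rbound s * \<bar>a v\<bar>)"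
    proof (rule integral_norm_bound_integral)
      fix v assume v: "v \<in> {0..L}"
      have "norm (of_real (a v) * Rker s (L - v)) \<le> \<bar>a v\<bar> * Rbound s"
        unfolding norm_mult using norm_Rker_le[OF s, of "L - v"] v by (intro mult_mono) auto
      then show "norm (of_real (a v) * Rker s (L - v)) \<le> Rbound s * \<bar>a v\<bar>" by (simp add: mult.commute)
    qed (use 2 3 in auto)
    then show ?thesis using integral_unique[OF 2] integral_unique[OF 3] by simp
  qed
qed

section \<open>The two arithmetic functions in the logarithmic variable\<close>

definition M_log :: "real \<Rightarrow> real" where "M_log v = mertens (exp v)"
definition Delta_log :: "real \<Rightarrow> real" where "Delta_log v = Delta (exp v)"

lemma measurable_M_log [measurable]: "M_log \<in> borel_measurable borel"
  unfolding M_log_def[abs_def] mertens_def by (rule measurable_floor_sum) simp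

lemma measurable_Delta_log [measurable]: "Delta_log \<in> borel_measurable borel"
  unfolding Delta_log_def[abs_def] Delta_def psi_def
  by (intro borel_measurable_diff measurable_floor_sum) simp_all

lemma abs_moebius_le: "\<bar>moebius n\<bar> \<le> 1"
  by (simp add: moebius_def power_abs)

lemma abs_mertens_le: "x \<ge> 0 \<Longrightarrow> \<bar>mertens x\<bar> \<le> x"
proof -
  assume x: "x \<ge> 0"
  have "\<bar>mertens x\<bar> \<le> (\<Sum>n\<in>{1..nat \<lfloor>x\<rfloor>}. \<bar>moebius n\<bar>)"
    unfolding mertens_def by (rule sum_abs)
  also have "\<dots> \<le> real (card {1..nat \<lfloor>x\<rfloor>}) * 1"
    by (rule sum_bounded_above) (rule abs_moebius_le)
  also have "\<dots> \<le> x" using x by simp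
  finally show ?thesis .
qed

lemma psi_nonneg: "psi x \<ge> 0"
  unfolding psi_def by (intro sum_nonneg mangoldt_nonneg)

lemma psi_le: "x \<ge> 1 \<Longrightarrow> psi x \<le> x * ln x"
proof -
  assume x: "x \<ge> 1"
  have "psi x \<le> real (card {1..nat \<lfloor>x\<rfloor>}) * ln x"
    unfolding psi_def
  proof (rule sum_bounded_above)
    fix n assume n: "n \<in> {1..nat \<lfloor>x\<rfloor>}"
    then have "real n \<le> x" "n > 0" using x by (auto simp: le_nat_iff le_floor_iff)
    then have "ln (real n) \<le> ln x" by simp
    with mangoldt_le[of n] \<open>n > 0\<close> show "mangoldt n \<le> ln x" by linarith
  qed
  also have "\<dots> \<le> x * ln x" using x by (intro mult_right_mono) auto
  finally show ?thesis .
qed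

lemma abs_M_log_le: "\<bar>M_log v\<bar> \<le> exp v"
  unfolding M_log_def by (rule abs_mertens_le) simp

lemma abs_Delta_log_le: "v \<ge> 0 \<Longrightarrow> \<bar>Delta_log v\<bar> \<le> exp v * (1 + v)"
proof -
  assume v: "v \<ge> 0"
  have "0 \<le> psi (exp v)" "psi (exp v) \<le> exp v * v"
    using psi_nonneg psi_le[of "exp v"] v by auto
  moreover have "exp v * v \<ge> 0" "exp v > 0" using v by auto
  ultimately show ?thesis unfolding Delta_log_def Delta_def distrib_left abs_le_iff by linarith
qed

text \<open>The divisor sums of \<open>moebius\<close> vanish except at n = 1, so a single term of
  the convolution survives.\<close>

lemma M_log_Kker:
  assumes "s \<noteq> 0" "L \<ge> 0"
  shows "((\<lambda>v. of_real (M_log v) * Kker s (L - v)) has_integral Gker s L) {0..L}"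
proof -
  have "(\<Sum>n\<in>{1..nat \<lfloor>exp L\<rfloor>}. of_real (if n = 1 then 1 else 0 :: real) * Gker s (L - ln (real n))) =
        (\<Sum>n\<in>{1..nat \<lfloor>exp L\<rfloor>}. if n = 1 then Gker s L else 0)"
    by (intro sum.cong refl) auto
  also have "\<dots> = Gker s L"
    using assms(2) mem_floor_exp[of 1 L] by (subst sum.delta) auto
  finally show ?thesis
    using arith_Kker_has_integral[OF assms(1) sum_moebius[symmetric] assms(2)]
    by (simp add: M_log_def mertens_def)
qed

text \<open>The exact convolution value for \<open>Delta_log\<close>: ln n is the divisor sum of
  \<open>mangoldt\<close>, and the subtracted part comes from exp v.\<close>

definition Jpsi :: "complex \<Rightarrow> real \<Rightarrow> complex" where
  "Jpsi s L = (\<Sum>n\<in>{1..nat \<lfloor>exp L\<rfloor>}. of_real (ln (real n)) * Gker s (L - ln (real n)) - (exp (s * of_real (L - ln (real n))) - 1))"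

lemma Delta_log_Kker:
  assumes "s \<noteq> 0" "L \<ge> 0"
  shows "((\<lambda>v. of_real (Delta_log v) * Kker s (L - v)) has_integral Jpsi s L) {0..L}"
proof -
  have b: "ln (real n) = (\<Sum>d | d dvd n. mangoldt d)" if "n > 0" for n
    using mangoldt_sum[of n, where 'a = real] that by simp
  show ?thesis
    using has_integral_diff[OF arith_Kker_has_integral[OF assms(1) b assms(2)] exp_Kker_has_integral[OF assms(2), of s]]
    by (simp add: Delta_log_def Delta_def psi_def Jpsi_def sum_subtractf left_diff_distrib)
qed

section \<open>Sums of logarithmic weights up to exp L\<close>

lemma harm_le: "n > 0 \<Longrightarrow> harm n \<le> (1 + ln (real n) :: real)"
  using decseqD[OF decseq_harm_diff_ln, of 0 "n - 1"] by (simp add: harm_def)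

text \<open>The mean value theorem on each unit step compares h n with an increment of its
  primitive. Oscillation B / n per step costs only B * harm X, which is logarithmic in X.\<close>

lemma sum_derivative_bound:
  fixes H h :: "real \<Rightarrow> real"
  assumes der: "\<And>t. t \<ge> 1 \<Longrightarrow> (H has_real_derivative h t) (at t)"
    and bd: "\<And>n t. 1 \<le> n \<Longrightarrow> n \<le> X \<Longrightarrow> real n \<le> t \<Longrightarrow> t \<le> real n + 1 \<Longrightarrow> \<bar>h t - h (real n)\<bar> \<le> B / real n"
  shows "\<bar>(\<Sum>n\<in>{1..X}. h (real n)) - (H (real X + 1) - H 1)\<bar> \<le> B * harm X"
proof -
  have step: "\<bar>h (real n) - (H (real (Suc n)) - H (real n))\<bar> \<le> B / real n" if n: "n \<in> {1..X}" for n
  proof -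
    have "\<exists>z>real n. z < real (Suc n) \<and> H (real (Suc n)) - H (real n) = (real (Suc n) - real n) * h z"
      by (rule MVT2) (use n der in auto)
    then obtain z where z: "z > real n" "z < real (Suc n)" "H (real (Suc n)) - H (real n) = h z" by auto
    have "\<bar>h z - h (real n)\<bar> \<le> B / real n"
      using n z by (intro bd) auto
    then show ?thesis using z(3) by (simp add: abs_minus_commute)
  qed
  have "(\<Sum>n\<in>{1..X}. h (real n)) - (H (real X + 1) - H 1) = (\<Sum>n\<in>{1..X}. h (real n) - (H (real (Suc n)) - H (real n)))"
    by (induction X) (auto simp: add.commute)
  also have "\<bar>\<dots>\<bar> \<le> (\<Sum>n\<in>{1..X}. \<bar>h (real n) - (H (real (Suc n)) - H (real n))\<bar>)"
    by (rule sum_abs)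
  also have "\<dots> \<le> (\<Sum>n\<in>{1..X}. B / real n)"
    by (intro sum_mono step)
  also have "\<dots> = B * harm X"
    by (simp add: harm_def sum_distrib_left divide_inverse)
  finally show ?thesis .
qed

text \<open>Together with \<open>h2\<close> it collects what remains of s * \<open>Jpsi\<close> once
  the exponential terms have been expressed through \<open>Kker\<close> and
  \<open>Kder\<close>.\<close>

definition h1 :: "real \<Rightarrow> real \<Rightarrow> real" where "h1 L t = 1 - (L - ln t)"
definition h2 :: "real \<Rightarrow> real \<Rightarrow> real" where "h2 L t = ln t * (L - ln t) + 1 - ln t"

lemma ln_diff_le: "0 < a \<Longrightarrow> a \<le> t \<Longrightarrow> ln t - ln a \<le> (t - a) / (a :: real)"
  using ln_le_minus_one[of "t / a"] by (simp add: ln_div field_simps)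

lemma nat_floor_exp:
  assumes "L \<ge> 0"
  shows "nat \<lfloor>exp L\<rfloor> > 0" "ln (real (nat \<lfloor>exp L\<rfloor>)) \<le> L" "ln (real (nat \<lfloor>exp L\<rfloor>) + 1) \<ge> L"
    "(real (nat \<lfloor>exp L\<rfloor>) + 1) * (ln (real (nat \<lfloor>exp L\<rfloor>) + 1) - L) \<le> 2" "ln (real (nat \<lfloor>exp L\<rfloor>) + 1) \<le> L + 1"
proof -
  define X where "X = nat \<lfloor>exp L\<rfloor>"
  have "\<lfloor>exp L\<rfloor> \<ge> 1" using assms by (simp add: le_floor_iff)
  then have X: "X > 0" "real X \<le> exp L" "exp L < real X + 1" unfolding X_def by simp_all
  show "nat \<lfloor>exp L\<rfloor> > 0" using X X_def by simp
  have "ln (real X) \<le> ln (exp L)" using X by (subst ln_le_cancel_iff) auto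
  then show "ln (real (nat \<lfloor>exp L\<rfloor>)) \<le> L" by (simp add: X_def)
  have ge: "ln (exp L) \<le> ln (real X + 1)" using X by (subst ln_le_cancel_iff) auto
  then show "ln (real (nat \<lfloor>exp L\<rfloor>) + 1) \<ge> L" by (simp add: X_def)
  have "ln (real X + 1) - ln (exp L) \<le> (real X + 1 - exp L) / exp L"
    by (rule ln_diff_le) (use X in auto)
  also have "\<dots> \<le> 1 / exp L" using X by (intro divide_right_mono) auto
  finally have le: "ln (real X + 1) - L \<le> 1 / exp L" by simp
  also have "\<dots> \<le> 1" using assms by simp
  finally show "ln (real (nat \<lfloor>exp L\<rfloor>) + 1) \<le> L + 1" by (simp add: X_def)
  have "(real X + 1) * (ln (real X + 1) - L) \<le> (2 * exp L) * (1 / exp L)"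
  proof (rule mult_mono)
    have "1 \<le> exp L" using assms by simp
    then show "real X + 1 \<le> 2 * exp L" using X by linarith
  qed (use le ge in auto)
  then show "(real (nat \<lfloor>exp L\<rfloor>) + 1) * (ln (real (nat \<lfloor>exp L\<rfloor>) + 1) - L) \<le> 2" by (simp add: X_def)
qed

lemma harm_nat_floor_exp: "L \<ge> 0 \<Longrightarrow> harm (nat \<lfloor>exp L\<rfloor>) \<le> (1 + L :: real)"
  using harm_le[OF nat_floor_exp(1)[of L]] nat_floor_exp(2)[of L] by linarith

text \<open>The primitive t (ln t - L) vanishes at t = exp L, and X + 1 lies within 1 of that point.
  Hence the sum is polynomial in L although it has about exp L terms.\<close>

lemma sum_h1:
  assumes L: "L \<ge> 0"
  shows "\<bar>\<Sum>n\<in>{1..nat \<lfloor>exp L\<rfloor>}. h1 L (real n)\<bar> \<le> 3 * (1 + L)\<^sup>2"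
proof -
  define X where "X = nat \<lfloor>exp L\<rfloor>"
  define H where "H t = t * (ln t - L)" for t
  note X = nat_floor_exp[OF L, folded X_def]
  have "\<bar>(\<Sum>n\<in>{1..X}. h1 L (real n)) - (H (real X + 1) - H 1)\<bar> \<le> 1 * harm X"
  proof (rule sum_derivative_bound)
    show "(H has_real_derivative h1 L t) (at t)" if "t \<ge> 1" for t
      unfolding H_def h1_def using that by (auto intro!: derivative_eq_intros)
    fix n :: nat and t assume n: "1 \<le> n" "n \<le> X" "real n \<le> t" "t \<le> real n + 1"
    have "ln t - ln (real n) \<le> (t - real n) / real n" by (rule ln_diff_le) (use n in auto)
    also have "\<dots> \<le> 1 / real n" using n by (intro divide_right_mono) auto
    finally have "ln t - ln (real n) \<le> 1 / real n" .
    moreover have "ln (real n) \<le> ln t" using n by simp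
    ultimately show "\<bar>h1 L t - h1 L (real n)\<bar> \<le> 1 / real n" by (simp add: h1_def)
  qed
  moreover have "harm X \<le> 1 + L" unfolding X_def by (rule harm_nat_floor_exp[OF L])
  moreover have "0 \<le> H (real X + 1)" "H (real X + 1) \<le> 2" "H 1 = - L"
    using X by (auto simp: H_def)
  moreover have "3 * (1 + L)\<^sup>2 \<ge> 3 + 2 * L" using L by (simp add: power2_eq_square algebra_simps)
  ultimately show ?thesis unfolding X_def[symmetric] abs_le_iff using L by linarith
qed

lemma sum_h2:
  assumes L: "L \<ge> 0"
  shows "\<bar>\<Sum>n\<in>{1..nat \<lfloor>exp L\<rfloor>}. h2 L (real n)\<bar> \<le> 9 * (1 + L)\<^sup>2"
proof -
  define X where "X = nat \<lfloor>exp L\<rfloor>"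
  \<comment> \<open>Again a primitive with the factor L - ln t, so that its value at X + 1 is at
    most a multiple of 1 + L.\<close>
  define H where "H t = t * (L - ln t) * (ln t - 1)" for t
  note X = nat_floor_exp[OF L, folded X_def]
  have "\<bar>(\<Sum>n\<in>{1..X}. h2 L (real n)) - (H (real X + 1) - H 1)\<bar> \<le> (3 * L + 3) * harm X"
  proof (rule sum_derivative_bound)
    show "(H has_real_derivative h2 L t) (at t)" if "t \<ge> 1" for t
      unfolding H_def h2_def using that by (auto intro!: derivative_eq_intros simp: algebra_simps)
    fix n :: nat and t assume n: "1 \<le> n" "n \<le> X" "real n \<le> t" "t \<le> real n + 1"
    have "ln t - ln (real n) \<le> (t - real n) / real n" by (rule ln_diff_le) (use n in auto)
    also have "\<dots> \<le> 1 / real n" using n by (intro divide_right_mono) auto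
    finally have 1: "ln t - ln (real n) \<le> 1 / real n" .
    have 2: "ln (real n) \<le> ln t" using n by simp
    have "ln t \<le> ln (real X + 1)" using n by (subst ln_le_cancel_iff) auto
    then have 3: "ln t \<le> L + 1" using X by linarith
    have 4: "ln (real n) \<ge> 0" using n by simp
    have "\<bar>h2 L t - h2 L (real n)\<bar> = \<bar>ln t - ln (real n)\<bar> * \<bar>L - 1 - ln t - ln (real n)\<bar>"
      unfolding abs_mult[symmetric] h2_def by (simp add: algebra_simps)
    also have "\<dots> \<le> 1 / real n * (3 * L + 3)"
      using 1 2 3 4 L by (intro mult_mono) auto
    finally show "\<bar>h2 L t - h2 L (real n)\<bar> \<le> (3 * L + 3) / real n" by simp
  qed
  also have "(3 * L + 3) * harm X \<le> (3 * L + 3) * (1 + L)" unfolding X_def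
    using L harm_nat_floor_exp[OF L] by (intro mult_left_mono) auto
  also have "\<dots> = 3 * (1 + L)\<^sup>2" by (simp add: power2_eq_square algebra_simps)
  finally have *: "\<bar>(\<Sum>n\<in>{1..X}. h2 L (real n)) - (H (real X + 1) - H 1)\<bar> \<le> 3 * (1 + L)\<^sup>2" .
  have "\<bar>H (real X + 1)\<bar> = ((real X + 1) * (ln (real X + 1) - L)) * \<bar>ln (real X + 1) - 1\<bar>"
    using X by (simp add: H_def abs_mult)
  also have "\<dots> \<le> 2 * (1 + L)"
    using X L by (intro mult_mono) auto
  finally have "\<bar>H (real X + 1)\<bar> \<le> 2 * (1 + L)" .
  moreover have "H 1 = - L" by (simp add: H_def)
  moreover have "(1 + L)\<^sup>2 \<ge> 1 + L" using L by (simp add: power2_eq_square algebra_simps)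
  ultimately show ?thesis using * L
      abs_triangle_ineq[of "(\<Sum>n\<in>{1..X}. h2 L (real n)) - (H (real X + 1) - H 1)" "H (real X + 1) - H 1"]
      abs_triangle_ineq4[of "H (real X + 1)" "H 1"]
    unfolding X_def[symmetric] by simp
qed

text \<open>The derivative of \<open>Kker\<close> with respect to s.\<close>

definition Kder :: "complex \<Rightarrow> real \<Rightarrow> complex" where
  "Kder s L = (\<Sum>n\<in>{1..nat \<lfloor>exp L\<rfloor>}. exp (s * of_real (L - ln (real n))) * (1 + (s - 1) * of_real (L - ln (real n))))"

text \<open>The factor \<open>ln n\<close> in \<open>Jpsi\<close> is a derivative in \<open>s\<close> of the kernel, so that Cauchy's estimate for \<open>Rker\<close>
  turns the decomposition into an asymptotic formula.\<close>

lemma Jpsi_decomposition: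
  assumes "s \<noteq> 0"
  shows "s * Jpsi s L = of_real L * Kker s L - Kder s L - Kker s L
     + of_real (\<Sum>n\<in>{1..nat \<lfloor>exp L\<rfloor>}. h1 L (real n)) + s * of_real (\<Sum>n\<in>{1..nat \<lfloor>exp L\<rfloor>}. h2 L (real n))"
  unfolding Jpsi_def Kder_def Kker_def of_real_sum sum_distrib_left sum_subtractf[symmetric] sum.distrib[symmetric]
proof (intro sum.cong refl)
  fix n :: nat
  define e where "e = exp (s * of_real (L - ln (real n)))"
  define l where "l = complex_of_real (ln (real n))"
  define K where "K = complex_of_real L"
  show "s * (of_real (ln (real n)) * Gker s (L - ln (real n)) - (exp (s * of_real (L - ln (real n))) - 1)) =
       of_real L * gker s (L - ln (real n)) -
       exp (s * of_real (L - ln (real n))) * (1 + (s - 1) * of_real (L - ln (real n))) - gker s (L - ln (real n)) +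
       of_real (h1 L (real n)) + s * of_real (h2 L (real n))"
    unfolding Gker_def gker_def h1_def h2_def e_def[symmetric] of_real_add of_real_diff of_real_mult l_def[symmetric] K_def[symmetric] of_real_1
    using assms by (simp add: field_simps)
qed

lemma Rker_has_field_derivative:
  assumes "Re s > 0"
  shows "((\<lambda>s. Rker s L) has_field_derivative Kder s L - exp (s * of_real L) * (of_real L * Z s + deriv Z s)) (at s)"
proof -
  have Z: "(Z has_field_derivative deriv Z s) (at s)"
    by (rule holomorphic_derivI[OF holomorphic_Z]) (use assms in \<open>auto simp: open_halfspace_Re_gt\<close>)
  have K: "((\<lambda>s. Kker s L) has_field_derivative Kder s L) (at s)"
    unfolding Kker_def gker_def Kder_def
    by (rule DERIV_sum) (auto intro!: derivative_eq_intros simp: algebra_simps)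
  show ?thesis unfolding Rker_def
    by (auto intro!: derivative_eq_intros K Z simp: algebra_simps)
qed

text \<open>\<open>Rker\<close> is bounded on the disc uniformly in L, so Cauchy's inequality bounds
  its derivative in s uniformly in L as well.\<close>

lemma norm_Rker_deriv_le:
  assumes "r > 0" "\<And>z. z \<in> cball s r \<Longrightarrow> Re z > 0 \<and> Rbound z \<le> B" "L \<ge> 0"
  shows "norm (Kder s L - exp (s * of_real L) * (of_real L * Z s + deriv Z s)) \<le> B / r"
proof -
  have "norm ((deriv ^^ 1) (\<lambda>s. Rker s L) s) \<le> fact 1 * B / r ^ 1"
  proof (rule Cauchy_inequality)
    have *: "(\<lambda>s. Rker s L) holomorphic_on cball s r"
    proof (rule holomorphic_on_subset)
      show "(\<lambda>s. Rker s L) holomorphic_on {s. Re s > 0}"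
        unfolding holomorphic_on_open[OF open_halfspace_Re_gt] using Rker_has_field_derivative by auto
    qed (use assms in auto)
    then show "(\<lambda>s. Rker s L) holomorphic_on ball s r" by (rule holomorphic_on_subset) auto
    show "continuous_on (cball s r) (\<lambda>s. Rker s L)" by (rule holomorphic_on_imp_continuous_on[OF *])
    show "norm (Rker z L) \<le> B" if "norm (s - z) = r" for z
      using assms(2)[of z] norm_Rker_le[of z L] assms(3) that by (auto simp: dist_norm)
  qed (use assms in auto)
  moreover have "deriv (\<lambda>s. Rker s L) s = Kder s L - exp (s * of_real L) * (of_real L * Z s + deriv Z s)"
    by (rule DERIV_imp_deriv[OF Rker_has_field_derivative]) (use assms(1) assms(2)[of s] in auto)
  ultimately show ?thesis by simp
qed

text \<open>Insert \<open>Kker\<close> = exp (s L) Z + \<open>Rker\<close> and its s-derivative into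
  the decomposition: the terms L exp (s L) Z s cancel, leaving - exp (s L) (Z' + Z) and errors
  polynomial in L.\<close>

lemma Jpsi_asymp:
  assumes "r > 0" "\<And>z. z \<in> cball s r \<Longrightarrow> Re z > 0 \<and> Rbound z \<le> B" "L \<ge> 0"
  shows "norm (s * Jpsi s L + exp (s * of_real L) * (deriv Z s + Z s)) \<le> (2 * B + B / r + 3 + 9 * norm s) * (1 + L)\<^sup>2"
proof -
  have s: "Re s > 0" "Rbound s \<le> B" using assms(1) assms(2)[of s] by auto
  then have "s \<noteq> 0" by auto
  define D where "D = Kder s L - exp (s * of_real L) * (of_real L * Z s + deriv Z s)"
  define A1 where "A1 = (\<Sum>n\<in>{1..nat \<lfloor>exp L\<rfloor>}. h1 L (real n))"
  define A2 where "A2 = (\<Sum>n\<in>{1..nat \<lfloor>exp L\<rfloor>}. h2 L (real n))"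
  have R: "norm (Rker s L) \<le> B" using norm_Rker_le[OF s(1) assms(3)] s by linarith
  have B0: "B \<ge> 0" using norm_ge_zero[of "Rker s L"] R by linarith
  have "s * Jpsi s L + exp (s * of_real L) * (deriv Z s + Z s) = of_real L * Rker s L - D - Rker s L + of_real A1 + s * of_real A2"
    unfolding Jpsi_decomposition[OF \<open>s \<noteq> 0\<close>] A1_def[symmetric] A2_def[symmetric] D_def Rker_def by (simp add: algebra_simps)
  also have "norm \<dots> \<le> norm (of_real L * Rker s L) + norm D + norm (Rker s L) + norm (complex_of_real A1) + norm (s * of_real A2)"
    by (intro order_trans[OF norm_triangle_ineq] order_trans[OF norm_triangle_ineq4] add_mono order_refl)
  also have "\<dots> \<le> L * B + B / r + B + 3 * (1 + L)\<^sup>2 + norm s * (9 * (1 + L)\<^sup>2)"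
  proof (intro add_mono)
    show "norm (of_real L * Rker s L) \<le> L * B" using R assms(3) by (simp add: norm_mult mult_left_mono)
    show "norm D \<le> B / r" unfolding D_def by (rule norm_Rker_deriv_le[OF assms])
    show "norm (complex_of_real A1) \<le> 3 * (1 + L)\<^sup>2" using sum_h1[OF assms(3)] by (simp only: A1_def norm_of_real)
    show "norm (s * of_real A2) \<le> norm s * (9 * (1 + L)\<^sup>2)"
      unfolding norm_mult using sum_h2[OF assms(3)] by (intro mult_left_mono) (simp_all only: A2_def norm_of_real norm_ge_zero)
  qed (rule R)
  also have "\<dots> \<le> (2 * B + B / r + 3 + 9 * norm s) * (1 + L)\<^sup>2"
  proof -
    have 1: "(1 + L)\<^sup>2 \<ge> 1" "(1 + L)\<^sup>2 \<ge> L" using assms(3) by (auto simp: power2_eq_square algebra_simps)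
    have "L * B \<le> B * (1 + L)\<^sup>2" using 1 B0 by (simp add: mult.commute mult_left_mono)
    moreover have "B \<le> B * (1 + L)\<^sup>2" "B / r \<le> B / r * (1 + L)\<^sup>2"
      using mult_left_mono[OF 1(1) B0] mult_left_mono[OF 1(1), of "B / r"] B0 assms(1) by auto
    ultimately show ?thesis by (simp add: algebra_simps)
  qed
  finally show ?thesis .
qed

lemma continuous_on_Rbound: "continuous_on {s. Re s > 0} Rbound"
  unfolding Rbound_def[abs_def] by (intro continuous_intros) auto

lemma Rbound_ge_1: "Re s > 0 \<Longrightarrow> Rbound s \<ge> 1"
  unfolding Rbound_def by simp

lemma Rbound_bounded:
  assumes "compact K" "K \<subseteq> {s. Re s > 0}"
  obtains B where "B > 0" "\<And>s. s \<in> K \<Longrightarrow> Rbound s \<le> B"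
proof -
  have "compact (Rbound ` K)"
    by (rule compact_continuous_image[OF continuous_on_subset[OF continuous_on_Rbound] assms(1)]) fact
  then obtain B where "B > 0" "\<And>x. x \<in> Rbound ` K \<Longrightarrow> norm x \<le> B"
    using bounded_pos compact_imp_bounded by metis
  then show ?thesis using that[of B] by fastforce
qed

lemma M_log_bounded: "v \<in> {0..L} \<Longrightarrow> \<bar>M_log v\<bar> \<le> exp L"
  using abs_M_log_le[of v] order_trans[of _ "exp v" "exp L"] by auto

lemma Delta_log_bounded: "v \<in> {0..L} \<Longrightarrow> \<bar>Delta_log v\<bar> \<le> exp L * (1 + L)"
proof -
  assume v: "v \<in> {0..L}"
  have "exp v * (1 + v) \<le> exp L * (1 + L)" using v by (intro mult_mono) auto
  then show ?thesis using abs_Delta_log_le[of v] v by auto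
qed

lemma Delta_log_le_exp: "\<exists>C. \<forall>v\<ge>0. \<bar>Delta_log v\<bar> \<le> C * exp (\<kappa> * v)" if "\<kappa> > 1"
proof (intro exI allI impI)
  fix v :: real assume v: "v \<ge> 0"
  define e where "e = \<kappa> - 1"
  have e: "e > 0" using that by (simp add: e_def)
  have "1 + e * v \<le> exp (e * v)" by (rule exp_ge_add_one_self)
  moreover have "e * 1 \<le> e * exp (e * v)" using e v by (intro mult_left_mono) auto
  ultimately have "(1 + v) * e \<le> (1 + e) * exp (e * v)"
    unfolding distrib_right mult_1_left mult_1_right mult.commute[of v e] by linarith
  then have "1 + v \<le> (1 + e) / e * exp (e * v)" using e by (simp add: field_simps)
  then have "exp v * (1 + v) \<le> exp v * ((1 + e) / e * exp (e * v))" by (intro mult_left_mono) auto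
  also have "\<dots> = (1 + e) / e * exp (\<kappa> * v)"
    by (simp add: e_def mult_exp_exp algebra_simps)
  finally show "\<bar>Delta_log v\<bar> \<le> (1 + e) / e * exp (\<kappa> * v)" using abs_Delta_log_le[OF v] by linarith
qed

section \<open>Laplace transforms and lower bounds from a zero\<close>

text \<open>After multiplication by exp (- s L) the remainder of
  \<open>norm_convolution_minus_laplace_le\<close> is at most a constant times L exp (- (Re s -
  \<kappa>) L). The factor Z s stays on the left because its nonvanishing for Re s > 1 is itself
  deduced from such a limit.\<close>

lemma laplace_limit:
  assumes meas: "a \<in> borel_measurable borel" and bd: "\<And>v. v \<ge> 0 \<Longrightarrow> \<bar>a v\<bar> \<le> C * exp (\<kappa> * v)"
    and \<kappa>: "\<kappa> > 0" "Re s > \<kappa>"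
    and J: "\<And>L. L \<ge> 0 \<Longrightarrow> ((\<lambda>v. of_real (a v) * Kker s (L - v)) has_integral J L) {0..L}"
    and lim: "((\<lambda>L. exp (- s * of_real L) * J L) \<longlongrightarrow> Q) at_top"
  shows "((\<lambda>L. Z s * laplace a L s) \<longlongrightarrow> Q) at_top"
proof -
  have C0: "C \<ge> 0" using bd[of 0] by simp
  have s: "Re s > 0" using \<kappa> by simp
  have bdL: "\<bar>a v\<bar> \<le> C * exp (\<kappa> * L)" if "v \<in> {0..L}" for v L
  proof -
    have "C * exp (\<kappa> * v) \<le> C * exp (\<kappa> * L)" using that C0 \<kappa> by (intro mult_left_mono) auto
    then show ?thesis using bd[of v] that by auto
  qed
  have est: "norm (exp (- s * of_real L) * J L - Z s * laplace a L s) \<le> Rbound s * C * (L * exp (- (Re s - \<kappa>) * L))" if L: "L \<ge> 0" for L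
  proof -
    have "norm (J L - exp (s * of_real L) * Z s * laplace a L s) \<le> Rbound s * integral {0..L} (\<lambda>v. \<bar>a v\<bar>)"
      by (rule norm_convolution_minus_laplace_le[OF meas bdL J[OF L] s L])
    also have "integral {0..L} (\<lambda>v. \<bar>a v\<bar>) \<le> C * exp (\<kappa> * L) * L"
    proof -
      have "(\<lambda>v. \<bar>a v\<bar>) absolutely_integrable_on {0..L}"
        by (rule bounded_measurable_absolutely_integrable[where B = "C * exp (\<kappa> * L)"]) (use meas bdL in auto)
      then have "(\<lambda>v. \<bar>a v\<bar>) integrable_on {0..L}"
        by (simp add: absolutely_integrable_on_def)
      then have "integral {0..L} (\<lambda>v. \<bar>a v\<bar>) \<le> integral {0..L} (\<lambda>_. C * exp (\<kappa> * L))"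
        by (rule integral_le) (use bdL in auto)
      then show ?thesis using L by (simp add: mult_ac)
    qed
    finally have 1: "norm (J L - exp (s * of_real L) * Z s * laplace a L s) \<le> Rbound s * (C * exp (\<kappa> * L) * L)"
      using Rbound_ge_1[OF s] by (simp add: mult_left_mono)
    have "exp (- s * of_real L) * J L - Z s * laplace a L s = exp (- s * of_real L) * (J L - exp (s * of_real L) * Z s * laplace a L s)"
      by (simp add: right_diff_distrib mult.assoc[symmetric] mult_exp_exp)
    then have "norm (exp (- s * of_real L) * J L - Z s * laplace a L s) = exp (- Re s * L) * norm (J L - exp (s * of_real L) * Z s * laplace a L s)"
      by (simp add: norm_mult)
    also have "\<dots> \<le> exp (- Re s * L) * (Rbound s * (C * exp (\<kappa> * L) * L))"
      using 1 by (intro mult_left_mono) auto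
    also have "\<dots> = Rbound s * C * (L * (exp (- Re s * L) * exp (\<kappa> * L)))" by (simp only: mult_ac)
    also have "exp (- Re s * L) * exp (\<kappa> * L) = exp (- (Re s - \<kappa>) * L)" by (simp add: mult_exp_exp algebra_simps)
    finally show ?thesis .
  qed
  have "((\<lambda>L. L * exp (- (Re s - \<kappa>) * L)) \<longlongrightarrow> 0) at_top"
  proof -
    have "Re s - \<kappa> > 0" using \<kappa> by simp
    then show ?thesis by real_asymp
  qed
  then have "((\<lambda>L. Rbound s * C * (L * exp (- (Re s - \<kappa>) * L))) \<longlongrightarrow> 0) at_top"
    by (rule tendsto_mult_right_zero)
  then have "((\<lambda>L. exp (- s * of_real L) * J L - Z s * laplace a L s) \<longlongrightarrow> 0) at_top"
    by (rule Lim_null_comparison[rotated]) (use est in \<open>auto intro!: eventually_at_top_linorderI[of 0]\<close>)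
  from tendsto_diff[OF lim this] show ?thesis by simp
qed

lemma exp_neg_tendsto:
  assumes "Re s > 0" shows "((\<lambda>L. exp (- s * of_real L)) \<longlongrightarrow> 0) at_top"
proof -
  have "((\<lambda>L. exp (- Re s * L)) \<longlongrightarrow> 0) at_top" using assms by real_asymp
  then show ?thesis by (subst tendsto_norm_zero_iff[symmetric]) simp
qed

lemma laplace_M_log:
  assumes "Re s > 1"
  shows "((\<lambda>L. Z s * laplace M_log L s) \<longlongrightarrow> (s - 1) / s) at_top"
proof (rule laplace_limit[where \<kappa> = 1 and C = 1 and J = "Gker s"])
  have s: "s \<noteq> 0" using assms by auto
  show "\<And>L. L \<ge> 0 \<Longrightarrow> ((\<lambda>v. of_real (M_log v) * Kker s (L - v)) has_integral Gker s L) {0..L}"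
    by (rule M_log_Kker[OF s])
  have "exp (- s * of_real L) * Gker s L = (s - 1) / s * (1 - exp (- s * of_real L)) + of_real L * exp (- s * of_real L)" for L
    unfolding Gker_def using s by (simp add: field_simps mult_exp_exp)
  moreover have "((\<lambda>L. of_real L * exp (- s * of_real L)) \<longlongrightarrow> 0) at_top"
  proof -
    have "((\<lambda>L. L * exp (- Re s * L)) \<longlongrightarrow> 0) at_top" using assms by real_asymp
    then have "((\<lambda>L. \<bar>L * exp (- Re s * L)\<bar>) \<longlongrightarrow> 0) at_top" by (rule tendsto_rabs_zero)
    then show ?thesis by (subst tendsto_norm_zero_iff[symmetric]) (simp add: norm_mult abs_mult)
  qed
  then have "((\<lambda>L. (s - 1) / s * (1 - exp (- s * of_real L)) + of_real L * exp (- s * of_real L)) \<longlongrightarrow> (s - 1) / s * (1 - 0) + 0) at_top"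
    using assms by (intro tendsto_intros exp_neg_tendsto) auto
  ultimately show "((\<lambda>L. exp (- s * of_real L) * Gker s L) \<longlongrightarrow> (s - 1) / s) at_top" by simp
qed (use assms abs_M_log_le in \<open>auto intro: measurable_M_log\<close>)

lemma Z_1 [simp]: "Z 1 = 1"
  by (simp add: Z_def zterm_def)

text \<open>At a zero the limit for \<open>M_log\<close> would read 0 = (s - 1) / s.\<close>

lemma Z_nonzero: "Re s > 1 \<Longrightarrow> Z s \<noteq> 0"
proof
  assume s: "Re s > 1" "Z s = 0"
  then have "((\<lambda>L::real. 0) \<longlongrightarrow> (s - 1) / s) at_top" using laplace_M_log[of s] by simp
  then have "(s - 1) / s = 0" using tendsto_unique tendsto_const trivial_limit_at_top_linorder by blast
  then show False using s by auto
qed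

lemma laplace_Delta_log:
  assumes "Re s > 1"
  shows "((\<lambda>L. Z s * laplace Delta_log L s) \<longlongrightarrow> - (deriv Z s + Z s) / s) at_top"
proof -
  \<comment> \<open>Strictly between 1 and Re s: the trivial bound exp v * (1 + v) for
    \<open>Delta_log\<close> fits under any exponent above 1.\<close>
  define \<kappa> where "\<kappa> = (1 + Re s) / 2"
  have \<kappa>: "\<kappa> > 1" "Re s > \<kappa>" using assms by (auto simp: \<kappa>_def)
  obtain C where C: "\<And>v. v \<ge> 0 \<Longrightarrow> \<bar>Delta_log v\<bar> \<le> C * exp (\<kappa> * v)"
    using Delta_log_le_exp[OF \<kappa>(1)] by blast
  have s: "s \<noteq> 0" using assms by auto
  have sub: "cball s 1 \<subseteq> {s. Re s > 0}"
  proof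
    fix z assume "z \<in> cball s 1"
    then have "\<bar>Re (s - z)\<bar> \<le> 1" using abs_Re_le_cmod[of "s - z"] by (simp add: dist_norm)
    then show "z \<in> {s. Re s > 0}" using assms by auto
  qed
  obtain B where B: "B > 0" "\<And>z. z \<in> cball s 1 \<Longrightarrow> Rbound z \<le> B"
    using Rbound_bounded[OF compact_cball sub] by blast
  define E where "E = 2 * B + B / 1 + 3 + 9 * norm s"
  show ?thesis
  proof (rule laplace_limit[where \<kappa> = \<kappa> and C = C and J = "Jpsi s"])
    show "\<And>L. L \<ge> 0 \<Longrightarrow> ((\<lambda>v. of_real (Delta_log v) * Kker s (L - v)) has_integral Jpsi s L) {0..L}"
      by (rule Delta_log_Kker[OF s])
    have "((\<lambda>L. exp (- s * of_real L) * (s * Jpsi s L + exp (s * of_real L) * (deriv Z s + Z s))) \<longlongrightarrow> 0) at_top"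
    proof (rule Lim_null_comparison)
      have "((\<lambda>L. exp (- Re s * L) * (1 + L)\<^sup>2) \<longlongrightarrow> 0) at_top" using assms by real_asymp
      then show "((\<lambda>L. E * (exp (- Re s * L) * (1 + L)\<^sup>2)) \<longlongrightarrow> 0) at_top" by (rule tendsto_mult_right_zero)
      show "\<forall>\<^sub>F L in at_top. norm (exp (- s * of_real L) * (s * Jpsi s L + exp (s * of_real L) * (deriv Z s + Z s))) \<le> E * (exp (- Re s * L) * (1 + L)\<^sup>2)"
      proof (rule eventually_at_top_linorderI[of 0])
        fix L :: real assume L: "L \<ge> 0"
        have "norm (s * Jpsi s L + exp (s * of_real L) * (deriv Z s + Z s)) \<le> E * (1 + L)\<^sup>2"
          unfolding E_def by (rule Jpsi_asymp) (use B sub L in auto)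
        then have "exp (- Re s * L) * norm (s * Jpsi s L + exp (s * of_real L) * (deriv Z s + Z s)) \<le> exp (- Re s * L) * (E * (1 + L)\<^sup>2)"
          by (intro mult_left_mono) auto
        then show "norm (exp (- s * of_real L) * (s * Jpsi s L + exp (s * of_real L) * (deriv Z s + Z s))) \<le> E * (exp (- Re s * L) * (1 + L)\<^sup>2)"
          by (simp add: norm_mult mult_ac)
      qed
    qed
    from tendsto_divide[OF tendsto_diff[OF this tendsto_const[of "deriv Z s + Z s"]] tendsto_const s]
    have "((\<lambda>L. (exp (- s * of_real L) * (s * Jpsi s L + exp (s * of_real L) * (deriv Z s + Z s)) - (deriv Z s + Z s)) / s) \<longlongrightarrow> - (deriv Z s + Z s) / s) at_top"
      by simp
    also have "(\<lambda>L. (exp (- s * of_real L) * (s * Jpsi s L + exp (s * of_real L) * (deriv Z s + Z s)) - (deriv Z s + Z s)) / s) = (\<lambda>L. exp (- s * of_real L) * Jpsi s L)"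
    proof
      fix L
      have "exp (- s * of_real L) * (s * Jpsi s L + exp (s * of_real L) * (deriv Z s + Z s)) = s * (exp (- s * of_real L) * Jpsi s L) + (deriv Z s + Z s)"
        by (simp add: distrib_left mult.assoc[symmetric] mult_exp_exp)
      then show "(exp (- s * of_real L) * (s * Jpsi s L + exp (s * of_real L) * (deriv Z s + Z s)) - (deriv Z s + Z s)) / s = exp (- s * of_real L) * Jpsi s L"
        using s by simp
    qed
    finally show "((\<lambda>L. exp (- s * of_real L) * Jpsi s L) \<longlongrightarrow> - (deriv Z s + Z s) / s) at_top" .
  qed (use \<kappa> C in \<open>auto intro: measurable_Delta_log\<close>)
qed

text \<open>At the zero the Laplace term disappears, and the convolution value
  \<open>Gker \<rho> L\<close>, of size exp (Re \<rho> * L), is bounded by the L1 norm alone. As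
  \<open>Gker\<close> does not involve Z, a multiple zero causes no difficulty here.\<close>

lemma M_log_lower_bound:
  assumes "Z \<rho> = 0" "Re \<rho> > 0"
  obtains c C where "c > 0" "\<And>L. L \<ge> 0 \<Longrightarrow> c * exp (Re \<rho> * L) \<le> integral {0..L} (\<lambda>v. \<bar>M_log v\<bar>) + C * (1 + L)\<^sup>2"
proof -
  have \<rho>: "\<rho> \<noteq> 0" "\<rho> \<noteq> 1" using assms by auto
  define d where "d = norm (\<rho> - 1) / norm \<rho>"
  define B where "B = Rbound \<rho>"
  have B: "B \<ge> 1" using Rbound_ge_1[OF assms(2)] by (simp add: B_def)
  have d: "d > 0" using \<rho> by (simp add: d_def)
  have "d / B * exp (Re \<rho> * L) \<le> integral {0..L} (\<lambda>v. \<bar>M_log v\<bar>) + (d + 1) * (1 + L)\<^sup>2" if L: "L \<ge> 0" for L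
  proof -
    have "norm (Gker \<rho> L) \<le> B * integral {0..L} (\<lambda>v. \<bar>M_log v\<bar>)"
      using norm_convolution_minus_laplace_le[OF measurable_M_log M_log_bounded[of _ L] M_log_Kker[OF \<rho>(1) L] assms(2) L] assms(1) by (simp add: B_def)
    moreover have "norm (Gker \<rho> L) \<ge> d * (exp (Re \<rho> * L) - 1) - L"
    proof -
      have "norm (exp (\<rho> * of_real L) - 1) \<ge> exp (Re \<rho> * L) - 1"
        using norm_triangle_ineq2[of "exp (\<rho> * of_real L)" 1] by simp
      then have "d * (exp (Re \<rho> * L) - 1) \<le> d * norm (exp (\<rho> * of_real L) - 1)" using d by (intro mult_left_mono) auto
      also have "\<dots> = norm ((\<rho> - 1) * (exp (\<rho> * of_real L) - 1) / \<rho>)" by (simp add: norm_mult norm_divide d_def)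
      also have "\<dots> \<le> norm (Gker \<rho> L) + norm (complex_of_real L)"
        unfolding Gker_def using norm_triangle_ineq4[of "(\<rho> - 1) * (exp (\<rho> * of_real L) - 1) / \<rho> + of_real L" "of_real L"] by simp
      finally show ?thesis using L by simp
    qed
    ultimately have "d * exp (Re \<rho> * L) \<le> B * integral {0..L} (\<lambda>v. \<bar>M_log v\<bar>) + (d + L)"
      by (simp add: algebra_simps)
    also have "d + L \<le> B * ((d + 1) * (1 + L)\<^sup>2)"
    proof -
      have "(1 + L)\<^sup>2 \<ge> 1" "(1 + L)\<^sup>2 \<ge> L" using L by (auto simp: power2_eq_square algebra_simps)
      then have "d * 1 + L \<le> d * (1 + L)\<^sup>2 + (1 + L)\<^sup>2" using d by (intro add_mono mult_left_mono) auto
      also have "\<dots> = 1 * ((d + 1) * (1 + L)\<^sup>2)" by (simp add: algebra_simps)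
      also have "\<dots> \<le> B * ((d + 1) * (1 + L)\<^sup>2)" using B d by (intro mult_right_mono) auto
      finally show ?thesis by simp
    qed
    finally have "d * exp (Re \<rho> * L) \<le> B * (integral {0..L} (\<lambda>v. \<bar>M_log v\<bar>) + (d + 1) * (1 + L)\<^sup>2)"
      by (simp add: algebra_simps)
    then show ?thesis using B by (simp add: field_simps)
  qed
  then show thesis using that[of "d / B" "d + 1"] d B by simp
qed

lemma Delta_log_abs_integrable: "(\<lambda>v. \<bar>Delta_log v\<bar>) integrable_on {0..L}"
proof -
  have "(\<lambda>v. \<bar>Delta_log v\<bar>) absolutely_integrable_on {0..L}"
    by (rule bounded_measurable_absolutely_integrable) (use Delta_log_bounded in \<open>auto intro: measurable_Delta_log\<close>)
  then show ?thesis by (simp add: absolutely_integrable_on_def)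
qed

text \<open>A finite sum of elementary functions of s, which makes the holomorphy of the truncated
  transform visible.\<close>

lemma laplace_Delta_log_eq:
  assumes "L \<ge> 0" "s \<noteq> 0" "s \<noteq> 1"
  shows "laplace Delta_log L s = (\<Sum>m\<in>{1..nat \<lfloor>exp L\<rfloor>}. of_real (mangoldt m) * ((exp (- s * of_real (ln (real m))) - exp (- s * of_real L)) / s))
     - (exp ((1 - s) * of_real L) - 1) / (1 - s)"
proof -
  define X where "X = nat \<lfloor>exp L\<rfloor>"
  have X: "{1..X} = {m. m \<ge> 1 \<and> ln (real m) \<le> L}"
    unfolding X_def using mem_floor_exp by blast
  have single: "((\<lambda>v. if v \<in> {ln (real m)..L} then of_real (mangoldt m) * exp (- s * of_real v) else 0) has_integral
     of_real (mangoldt m) * ((exp (- s * of_real (ln (real m))) - exp (- s * of_real L)) / s)) {0..L}" if m: "m \<in> {1..X}" for m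
  proof -
    define H where "H v = - exp (- s * v) / s" for v :: complex
    have l: "ln (real m) \<ge> 0" "ln (real m) \<le> L" using m unfolding X by auto
    have "((\<lambda>v. exp (- s * of_real v)) has_integral H (of_real L) - H (of_real (ln (real m)))) {ln (real m)..L}"
    proof (rule fundamental_theorem_of_calculus)
      fix v
      have "(H has_field_derivative exp (- s * of_real v)) (at (of_real v))"
        unfolding H_def using assms by (auto intro!: derivative_eq_intros)
      then show "((\<lambda>v. H (of_real v)) has_vector_derivative exp (- s * of_real v)) (at v within {ln (real m)..L})"
        by (rule has_vector_derivative_real_field)
    qed (use l in auto)
    then have "((\<lambda>v. of_real (mangoldt m) * exp (- s * of_real v)) has_integral of_real (mangoldt m) * (H (of_real L) - H (of_real (ln (real m))))) {ln (real m)..L}"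
      by (rule has_integral_mult_right)
    also have "H (of_real L) - H (of_real (ln (real m))) = (exp (- s * of_real (ln (real m))) - exp (- s * of_real L)) / s"
      by (simp add: H_def diff_divide_distrib)
    finally show ?thesis
      by (subst has_integral_restrict) (use l in auto)
  qed
  have 1: "((\<lambda>v. \<Sum>m\<in>{1..X}. if v \<in> {ln (real m)..L} then of_real (mangoldt m) * exp (- s * of_real v) else 0) has_integral
     (\<Sum>m\<in>{1..X}. of_real (mangoldt m) * ((exp (- s * of_real (ln (real m))) - exp (- s * of_real L)) / s))) {0..L}"
    by (rule has_integral_sum, simp, rule single)
  define H where "H v = exp ((1 - s) * v) / (1 - s)" for v :: complex
  have 2: "((\<lambda>v. exp ((1 - s) * of_real v)) has_integral H (of_real L) - H (of_real 0)) {0..L}"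
  proof (rule fundamental_theorem_of_calculus)
    fix v
    have "(H has_field_derivative exp ((1 - s) * of_real v)) (at (of_real v))"
      unfolding H_def using assms by (auto intro!: derivative_eq_intros)
    then show "((\<lambda>v. H (of_real v)) has_vector_derivative exp ((1 - s) * of_real v)) (at v within {0..L})"
      by (rule has_vector_derivative_real_field)
  qed (use assms in auto)
  have "((\<lambda>v. of_real (Delta_log v) * exp (- s * of_real v)) has_integral
     (\<Sum>m\<in>{1..X}. of_real (mangoldt m) * ((exp (- s * of_real (ln (real m))) - exp (- s * of_real L)) / s)) - (H (of_real L) - H (of_real 0))) {0..L}"
  proof (rule has_integral_eq[OF _ has_integral_diff[OF 1 2]])
    fix v assume v: "v \<in> {0..L}"
    have Y: "{1..nat \<lfloor>exp v\<rfloor>} = {m\<in>{1..X}. ln (real m) \<le> v}"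
      by (rule set_eqI, unfold X mem_floor_exp) (use v in auto)
    have "complex_of_real (psi (exp v)) = (\<Sum>m\<in>{1..X}. if ln (real m) \<le> v then of_real (mangoldt m) else 0)"
      unfolding psi_def Y of_real_sum by (rule sum.inter_filter) simp
    then have "of_real (psi (exp v)) * exp (- s * of_real v) = (\<Sum>m\<in>{1..X}. if v \<in> {ln (real m)..L} then of_real (mangoldt m) * exp (- s * of_real v) else 0)"
      using v by (simp only: sum_distrib_right) (intro sum.cong refl, auto)
    moreover have "exp ((1 - s) * of_real v) = of_real (exp v) * exp (- s * of_real v)"
      by (simp add: exp_of_real[symmetric] mult_exp_exp algebra_simps)
    ultimately show "(\<Sum>m\<in>{1..X}. if v \<in> {ln (real m)..L} then of_real (mangoldt m) * exp (- s * of_real v) else 0) - exp ((1 - s) * of_real v)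
       = of_real (Delta_log v) * exp (- s * of_real v)"
      by (simp add: Delta_log_def Delta_def left_diff_distrib)
  qed
  then show ?thesis unfolding laplace_def X_def
    by (simp add: integral_unique H_def diff_divide_distrib)
qed

lemma laplace_Delta_log_holomorphic:
  assumes "L \<ge> 0" "0 \<notin> A" "1 \<notin> A"
  shows "laplace Delta_log L holomorphic_on A"
proof (rule holomorphic_transform)
  show "(\<lambda>s. (\<Sum>m\<in>{1..nat \<lfloor>exp L\<rfloor>}. of_real (mangoldt m) * ((exp (- s * of_real (ln (real m))) - exp (- s * of_real L)) / s))
     - (exp ((1 - s) * of_real L) - 1) / (1 - s)) holomorphic_on A"
    using assms by (intro holomorphic_intros) auto
qed (use assms in \<open>subst laplace_Delta_log_eq, auto\<close>)

text \<open>At a zero of multiplicity m > 1 the main term Z' + Z of \<open>Jpsi_asymp\<close>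
  vanishes. On a circle around \<rho>, combining \<open>Jpsi_asymp\<close> with
  \<open>norm_convolution_minus_laplace_le\<close> eliminates \<open>Jpsi\<close>; what is left is
  holomorphic, divisible by (s - \<rho>)^(m - 1), and bounded by the L1 norm plus a power of L.
  After the division the maximum principle gives a bound at the centre, where the quotient is m
  g(\<rho>) exp (\<rho> L), with Z = (s - \<rho>)^m g.\<close>

lemma Delta_log_lower_bound:
  assumes "Z \<rho> = 0" "Re \<rho> > 0"
  obtains c C where "c > 0" "\<And>L. L \<ge> 0 \<Longrightarrow> c * exp (Re \<rho> * L) \<le> integral {0..L} (\<lambda>v. \<bar>Delta_log v\<bar>) + C * (1 + L)\<^sup>2"
proof -
  have \<rho>: "\<rho> \<noteq> 0" "\<rho> \<noteq> 1" using assms by auto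
  define U where "U = {s. Re s > 0}"
  have U: "open U" "connected U" unfolding U_def
    by (simp_all add: open_halfspace_Re_gt convex_connected convex_halfspace_Re_gt)
  have \<rho>U: "\<rho> \<in> U" using assms by (simp add: U_def)
  have "\<exists>w\<in>U. Z w \<noteq> 0" by (rule bexI[of _ 1]) (auto simp: U_def)
  then have nc: "\<not> Z constant_on U" using \<rho>U assms(1) unfolding constant_on_def by metis
  obtain g r and m :: nat where g: "0 < m" "0 < r" "ball \<rho> r \<subseteq> U" "g holomorphic_on ball \<rho> r"
     "\<And>w. w \<in> ball \<rho> r \<Longrightarrow> Z w = (w - \<rho>) ^ m * g w" "\<And>w. w \<in> ball \<rho> r \<Longrightarrow> g w \<noteq> 0"
    by (rule holomorphic_factor_zero_nonconstant[OF holomorphic_Z[folded U_def] U \<rho>U assms(1) nc]) (rule that)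
  \<comment> \<open>Keeps the disc inside Re s > 0 and away from the apparent poles 0 and 1 of the
    explicit transform.\<close>
  define r1 where "r1 = min r (min (Re \<rho>) (norm (\<rho> - 1)))"
  have r1: "r1 > 0" using g(2) assms \<rho> by (simp add: r1_def)
  define r0 where "r0 = r1 / 2"
  have r0: "r0 > 0" "r0 < r1" using r1 by (auto simp: r0_def)
  have ball1: "ball \<rho> r1 \<subseteq> ball \<rho> r" by (auto simp: r1_def)
  have not1: "s \<noteq> 1" "s \<noteq> 0" "Re s > 0" if "s \<in> ball \<rho> r1" for s
  proof -
    have d: "norm (\<rho> - s) < r1" using that by (simp add: dist_norm)
    then show "s \<noteq> 1" by (auto simp: r1_def)
    have "Re (\<rho> - s) \<le> norm (\<rho> - s)" by (rule complex_Re_le_cmod)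
    then show "Re s > 0" using d by (auto simp: r1_def)
    then show "s \<noteq> 0" by auto
  qed
  have sub0: "cball \<rho> r0 \<subseteq> ball \<rho> r1" using r0 by auto
  \<comment> \<open>r0 + r2 is three quarters of r1, so Cauchy discs of radius r2 around points of
    \<open>cball \<rho> r0\<close> stay inside the large disc.\<close>
  define r2 where "r2 = r1 / 4"
  have r2: "r2 > 0" using r1 by (simp add: r2_def)
  define K where "K = cball \<rho> (r0 + r2)"
  have Ksub: "K \<subseteq> ball \<rho> r1" using r1 by (auto simp: K_def r0_def r2_def)
  have "K \<subseteq> {s. Re s > 0}" using Ksub not1 by blast
  then obtain B where B: "B > 0" "\<And>s. s \<in> K \<Longrightarrow> Rbound s \<le> B"
    using Rbound_bounded[of K] by (auto simp: K_def)
  have sK: "cball s r2 \<subseteq> K" if "s \<in> cball \<rho> r0" for s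
  proof
    fix z assume "z \<in> cball s r2"
    then show "z \<in> K" using that dist_triangle[of \<rho> z s] by (simp add: K_def)
  qed
  define N where "N = norm \<rho> + r0"
  have N: "norm s \<le> N" if "s \<in> cball \<rho> r0" for s
    using that norm_triangle_sub[of s \<rho>] by (simp add: N_def dist_norm norm_minus_commute)
  define E where "E = 2 * B + B / r2 + 3 + 9 * N"
  have N0: "N > 0" using r0 by (simp add: N_def add_nonneg_pos)
  have E0: "E > 0" using B N0 r2 by (simp add: E_def add_pos_pos)
  define I where "I L = integral {0..L} (\<lambda>v. \<bar>Delta_log v\<bar>)" for L
  \<comment> \<open>No factor exp (Re s * L) on the right: the large terms on the left cancel, even
    at points of the disc with Re s > Re \<rho>.\<close>
  have key: "norm (exp (s * of_real L) * (deriv Z s + Z s) + exp (s * of_real L) * Z s * (s * laplace Delta_log L s))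
     \<le> N * B * I L + E * (1 + L)\<^sup>2" if s: "s \<in> cball \<rho> r0" and L: "L \<ge> 0" for s L
  proof -
    have "s \<in> ball \<rho> r1" using sub0 s by blast
    then have s': "s \<noteq> 0" "Re s > 0" using not1[of s] by blast+
    have sin: "s \<in> K" using sK[OF s] r2 by auto
    have "norm (Jpsi s L - exp (s * of_real L) * Z s * laplace Delta_log L s) \<le> Rbound s * I L"
      unfolding I_def by (rule norm_convolution_minus_laplace_le[OF measurable_Delta_log Delta_log_bounded Delta_log_Kker[OF s'(1) L] s'(2) L]) auto
    also have "\<dots> \<le> B * I L"
      using B(2)[OF sin] unfolding I_def by (intro mult_right_mono integral_nonneg[OF Delta_log_abs_integrable]) auto
    finally have 1: "norm (Jpsi s L - exp (s * of_real L) * Z s * laplace Delta_log L s) \<le> B * I L" .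
    have a1: "norm (s * (Jpsi s L - exp (s * of_real L) * Z s * laplace Delta_log L s)) \<le> N * (B * I L)"
      unfolding norm_mult using 1 N[OF s] N0 by (intro mult_mono) auto
    have a2: "norm (s * Jpsi s L + exp (s * of_real L) * (deriv Z s + Z s)) \<le> (2 * B + B / r2 + 3 + 9 * norm s) * (1 + L)\<^sup>2"
    proof (rule Jpsi_asymp[OF r2 _ L])
      fix z assume "z \<in> cball s r2"
      then have "z \<in> K" using sK[OF s] by auto
      then show "Re z > 0 \<and> Rbound z \<le> B" using B(2) Ksub not1(3) by auto
    qed
    have a3: "(2 * B + B / r2 + 3 + 9 * norm s) * (1 + L)\<^sup>2 \<le> E * (1 + L)\<^sup>2"
      unfolding E_def using N[OF s] by (intro mult_right_mono) auto
    have eq: "exp (s * of_real L) * (deriv Z s + Z s) + exp (s * of_real L) * Z s * (s * laplace Delta_log L s)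
       = (s * Jpsi s L + exp (s * of_real L) * (deriv Z s + Z s)) - s * (Jpsi s L - exp (s * of_real L) * Z s * laplace Delta_log L s)"
      by (simp add: algebra_simps)
    show ?thesis unfolding eq
      using norm_triangle_ineq4[of "s * Jpsi s L + exp (s * of_real L) * (deriv Z s + Z s)" "s * (Jpsi s L - exp (s * of_real L) * Z s * laplace Delta_log L s)"] a1 a2 a3
      unfolding mult.assoc by linarith
  qed
  have main: "m * norm (g \<rho>) * exp (Re \<rho> * L) \<le> (N * B * I L + E * (1 + L)\<^sup>2) / r0 ^ (m - 1)" if L: "L \<ge> 0" for L
  proof -
    \<comment> \<open>The left side of \<open>key\<close> divided by (s - \<rho>)^(m - 1). The terms
      with the Laplace transform keep a factor s - \<rho> and drop out at the centre.\<close>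
    define q where "q s = exp (s * of_real L) * (of_nat m * g s + (s - \<rho>) * (deriv g s + g s + g s * (s * laplace Delta_log L s)))" for s
    have gh: "g holomorphic_on ball \<rho> r1" using g(4) ball1 by (rule holomorphic_on_subset)
    have hol: "q holomorphic_on ball \<rho> r1"
      unfolding q_def by (intro holomorphic_intros gh holomorphic_deriv laplace_Delta_log_holomorphic L) (use not1 in \<open>auto simp del: mem_ball\<close>)
    \<comment> \<open>Cauchy's inequality for the derivative of order 0 is the maximum
      principle.\<close>
    have "norm ((deriv ^^ 0) q \<rho>) \<le> fact 0 * ((N * B * I L + E * (1 + L)\<^sup>2) / r0 ^ (m - 1)) / r0 ^ 0"
    proof (rule Cauchy_inequality[OF _ _ r0(1)])
      show "q holomorphic_on ball \<rho> r0" "continuous_on (cball \<rho> r0) q"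
        using holomorphic_on_subset[OF hol] sub0 ball_subset_cball[of \<rho> r0] holomorphic_on_imp_continuous_on
        by blast+
      fix s assume s: "norm (\<rho> - s) = r0"
      then have sc: "s \<in> cball \<rho> r0" by (simp add: dist_norm)
      then have sb: "s \<in> ball \<rho> r" using sub0 ball1 by blast
      have "(Z has_field_derivative (of_nat m * (s - \<rho>) ^ (m - 1) * g s + (s - \<rho>) ^ m * deriv g s)) (at s)"
      proof (rule has_field_derivative_transform_within_open[OF _ open_ball sb])
        have "(g has_field_derivative deriv g s) (at s)"
          using g(4) sb by (intro holomorphic_derivI) auto
        then show "((\<lambda>w. (w - \<rho>) ^ m * g w) has_field_derivative of_nat m * (s - \<rho>) ^ (m - 1) * g s + (s - \<rho>) ^ m * deriv g s) (at s)"
          by (auto intro!: derivative_eq_intros)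
      qed (use g(5) in auto)
      then have dZ: "deriv Z s = of_nat m * (s - \<rho>) ^ (m - 1) * g s + (s - \<rho>) ^ m * deriv g s"
        by (rule DERIV_imp_deriv)
      have pw: "(s - \<rho>) ^ m = (s - \<rho>) ^ (m - 1) * (s - \<rho>)" using g(1) by (metis power_minus_mult)
      have "(s - \<rho>) ^ (m - 1) * q s = exp (s * of_real L) * (deriv Z s + Z s) + exp (s * of_real L) * Z s * (s * laplace Delta_log L s)"
        unfolding dZ g(5)[OF sb] pw q_def by (simp add: algebra_simps)
      then have "norm ((s - \<rho>) ^ (m - 1) * q s) \<le> N * B * I L + E * (1 + L)\<^sup>2"
        using key[OF sc L] by simp
      then have "r0 ^ (m - 1) * norm (q s) \<le> N * B * I L + E * (1 + L)\<^sup>2"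
        using s by (simp add: norm_mult norm_power norm_minus_commute)
      then show "norm (q s) \<le> (N * B * I L + E * (1 + L)\<^sup>2) / r0 ^ (m - 1)"
        using r0 by (simp add: pos_le_divide_eq mult.commute)
    qed
    then show ?thesis by (simp add: q_def norm_mult mult.commute mult.left_commute)
  qed
  define c where "c = m * norm (g \<rho>) * r0 ^ (m - 1) / (N * B)"
  have gr: "g \<rho> \<noteq> 0" using g(2,6) by simp
  have "c > 0" unfolding c_def using g(1) gr r0 N0 B by simp
  moreover have "c * exp (Re \<rho> * L) \<le> I L + E / (N * B) * (1 + L)\<^sup>2" if L: "L \<ge> 0" for L
  proof -
    have p: "r0 ^ (m - 1) > 0" "N * B > 0" using r0 N0 B by auto
    have "m * norm (g \<rho>) * exp (Re \<rho> * L) * r0 ^ (m - 1) \<le> N * B * I L + E * (1 + L)\<^sup>2"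
      using main[OF L] p by (simp add: pos_le_divide_eq)
    then have "(m * norm (g \<rho>) * exp (Re \<rho> * L) * r0 ^ (m - 1)) / (N * B) \<le> (N * B * I L + E * (1 + L)\<^sup>2) / (N * B)"
      using p by (intro divide_right_mono) auto
    also have "\<dots> = I L + E / (N * B) * (1 + L)\<^sup>2" using N0 B(1) by (simp add: add_divide_distrib)
    finally show ?thesis by (simp add: c_def mult_ac)
  qed
  ultimately show thesis using that unfolding I_def by blast
qed

section \<open>Littlewood bounds in a zero-free half-plane\<close>

text \<open>For A > 0 the condition Re u < A means |u| < |2 A - u|, so f / (2 A - f) maps the disc
  into the unit disc and Schwarz's lemma applies after rescaling.\<close>

lemma borel_caratheodory:
  assumes hol: "f holomorphic_on ball 0 R" and f0: "f 0 = 0"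
    and re: "\<And>z. z \<in> ball 0 R \<Longrightarrow> Re (f z) < A" and z: "norm z < R"
  shows "norm (f z) \<le> 2 * A * norm z / (R - norm z)"
proof -
  have R: "R > 0" using z norm_ge_zero[of z] by linarith
  have A: "A > 0" using re[of 0] R f0 by simp
  define g where "g w = f (of_real R * w) / (2 * of_real A - f (of_real R * w))" for w
  have inb: "of_real R * w \<in> ball 0 R" if "w \<in> ball 0 1" for w :: complex
    using that R by (simp add: norm_mult)
  have ne: "2 * of_real A - f (of_real R * w) \<noteq> 0" if "w \<in> ball 0 1" for w
  proof
    assume "2 * of_real A - f (of_real R * w) = 0"
    then have "f (of_real R * w) = of_real (2 * A)" by simp
    then have "Re (f (of_real R * w)) = 2 * A" by simp
    then show False using re[OF inb[OF that]] A by simp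
  qed
  have fh: "(\<lambda>w. f (of_real R * w)) holomorphic_on ball 0 1"
  proof -
    have "(\<lambda>w::complex. of_real R * w) ` ball 0 1 \<subseteq> ball 0 R" using inb by blast
    then show ?thesis
      using holomorphic_on_compose_gen[of "\<lambda>w. of_real R * w" "ball 0 1" f "ball 0 R"] hol
      by (simp add: comp_def holomorphic_intros)
  qed
  have "g holomorphic_on ball 0 1"
    unfolding g_def using fh ne by (intro holomorphic_intros) auto
  moreover have "g 0 = 0" by (simp add: g_def f0)
  moreover have "norm (g w) < 1" if "norm w < 1" for w
  proof -
    define u where "u = f (of_real R * w)"
    have "Re u < A" using re inb that by (simp add: u_def)
    then have "(Re u)\<^sup>2 < (2 * A - Re u)\<^sup>2" using A
      by (simp add: power2_eq_square algebra_simps)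
    then have "(norm u)\<^sup>2 < (norm (2 * of_real A - u))\<^sup>2"
      by (simp add: cmod_power2)
    then have "norm u < norm (2 * of_real A - u)"
      by (rule power_less_imp_less_base) simp
    then show ?thesis unfolding g_def u_def[symmetric] by (simp add: norm_divide divide_less_eq)
  qed
  ultimately have sch: "norm (g w) \<le> norm w" if "norm w < 1" for w
    using Schwarz_Lemma(1)[of g w] that by blast
  define w where "w = z / of_real R"
  define u where "u = f z"
  have w: "norm w = norm z / R" "norm w < 1" "of_real R * w = z" using R z by (auto simp: w_def norm_divide)
  have "norm u / norm (2 * of_real A - u) \<le> norm w"
    using sch[OF w(2)] unfolding g_def w(3) u_def by (simp add: norm_divide)
  moreover have "norm (2 * of_real A - u) > 0" using ne[of w] w by (simp add: u_def)
  ultimately have "norm u \<le> norm w * norm (2 * of_real A - u)" by (simp add: divide_le_eq)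
  also have "\<dots> \<le> norm w * (2 * A + norm u)"
    using norm_triangle_ineq4[of "2 * complex_of_real A" u] A by (intro mult_left_mono) (auto simp: norm_mult)
  finally have "norm u * R \<le> norm z * (2 * A + norm u)" using R w by (simp add: field_simps)
  then have "norm u * (R - norm z) \<le> 2 * A * norm z" by (simp add: algebra_simps)
  then show ?thesis using z by (simp add: u_def pos_le_divide_eq)
qed

text \<open>The first Taylor coefficients of \<open>f\<close> are controlled on the small disc, the remaining ones
  form a geometric tail that absorbs all but a small multiple of \<open>L\<close>.\<close>

lemma littlewood_convexity:
  fixes r R \<delta> c \<eta> :: real
  assumes "0 < r" "r < R" "0 < \<delta>" "\<delta> < R" "0 < \<eta>"
  obtains C where "\<And>f L z. f holomorphic_on ball 0 R \<Longrightarrow> f 0 = 0 \<Longrightarrow> (\<And>z. z \<in> ball 0 R \<Longrightarrow> Re (f z) < L) \<Longrightarrow>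
      (\<And>z. z \<in> ball 0 \<delta> \<Longrightarrow> Re (f z) < c) \<Longrightarrow> norm z \<le> r \<Longrightarrow> norm (f z) \<le> C + \<eta> * L"
proof -
  define r' where "r' = (r + R) / 2"
  have r': "r < r'" "r' < R" "0 < r'" using assms by (auto simp: r'_def)
  define K where "K = 2 * r' / (R - r')"
  have K: "K > 0" using r' by (simp add: K_def)
  define \<theta> where "\<theta> = r / r'"
  have \<theta>: "0 < \<theta>" "\<theta> < 1" using r' assms by (auto simp: \<theta>_def)
  have "(\<lambda>k. K / (1 - \<theta>) * \<theta> ^ k) \<longlonglongrightarrow> 0"
    using \<theta> by (intro tendsto_mult_right_zero LIMSEQ_realpow_zero) auto
  \<comment> \<open>k depends only on the radii and on \<eta>, which makes C uniform in f and
    L.\<close>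
  then obtain k where k: "K / (1 - \<theta>) * \<theta> ^ k < \<eta>"
    using eventually_happens'[OF sequentially_bot order_tendstoD(2)[OF _ assms(5)]] by blast
  define C where "C = (\<Sum>n<k. 2 * c / (\<delta> / 2) ^ n * r ^ n)"
  show thesis
  proof (rule that[of C])
    fix f :: "complex \<Rightarrow> complex" and L :: real and z :: complex
    assume hol: "f holomorphic_on ball 0 R" and f0: "f 0 = 0" and re: "\<And>z. z \<in> ball 0 R \<Longrightarrow> Re (f z) < L"
      and re0: "\<And>z. z \<in> ball 0 \<delta> \<Longrightarrow> Re (f z) < c" and z: "norm z \<le> r"
    have L: "L > 0" using re[of 0] f0 assms by simp
    define a where "a n = (deriv ^^ n) f 0 / fact n" for n
    have cont: "continuous_on (cball 0 \<rho>) f" "f holomorphic_on ball 0 \<rho>" if "\<rho> < R" for \<rho>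
      using hol that by (auto intro!: holomorphic_on_imp_continuous_on elim!: holomorphic_on_subset)
    have a1: "norm (a n) \<le> K * L / r' ^ n" for n
    proof -
      have "norm ((deriv ^^ n) f 0) \<le> fact n * (K * L) / r' ^ n"
      proof (rule Cauchy_inequality[OF cont(2,1)])
        fix w :: complex assume "norm (0 - w) = r'"
        then show "norm (f w) \<le> K * L"
          using borel_caratheodory[OF hol f0 re, of w] r' by (simp add: K_def mult_ac)
      qed (use r' in auto)
      then have "norm ((deriv ^^ n) f 0) / fact n \<le> (fact n * (K * L) / r' ^ n) / fact n"
        by (intro divide_right_mono) auto
      then show ?thesis by (simp add: a_def norm_divide)
    qed
    have a2: "norm (a n) \<le> 2 * c / (\<delta> / 2) ^ n" for n
    proof -
      have "norm ((deriv ^^ n) f 0) \<le> fact n * (2 * c) / (\<delta> / 2) ^ n"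
      proof (rule Cauchy_inequality[OF cont(2,1)])
        fix w :: complex assume w: "norm (0 - w) = \<delta> / 2"
        have "norm (f w) \<le> 2 * c * norm w / (\<delta> - norm w)"
          by (rule borel_caratheodory[OF cont(2) f0 re0]) (use w assms in auto)
        also have "norm w = \<delta> / 2" using w by simp
        also have "2 * c * (\<delta> / 2) / (\<delta> - \<delta> / 2) = 2 * c" using assms by (simp add: field_simps)
        finally show "norm (f w) \<le> 2 * c" .
      qed (use assms in auto)
      then have "norm ((deriv ^^ n) f 0) / fact n \<le> (fact n * (2 * c) / (\<delta> / 2) ^ n) / fact n"
        by (intro divide_right_mono) auto
      then show ?thesis by (simp add: a_def norm_divide)
    qed
    have s: "(\<lambda>n. a n * z ^ n) sums f z"
      using holomorphic_power_series[OF hol, of z] z assms unfolding a_def by simp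
    have "f z = (\<Sum>n. a (n + k) * z ^ (n + k)) + (\<Sum>n<k. a n * z ^ n)"
      using suminf_split_initial_segment[OF sums_summable[OF s], of k] sums_unique[OF s] by simp
    also have "norm \<dots> \<le> norm (\<Sum>n. a (n + k) * z ^ (n + k)) + norm (\<Sum>n<k. a n * z ^ n)"
      by (rule norm_triangle_ineq)
    also have "norm (\<Sum>n<k. a n * z ^ n) \<le> C"
      unfolding C_def
    proof (rule sum_norm_le)
      fix n
      show "norm (a n * z ^ n) \<le> 2 * c / (\<delta> / 2) ^ n * r ^ n"
        unfolding norm_mult norm_power using a2[of n] z order_trans[OF norm_ge_zero a2[of n]]
        by (intro mult_mono power_mono) auto
    qed
    also have "norm (\<Sum>n. a (n + k) * z ^ (n + k)) \<le> \<eta> * L"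
    proof -
      define b where "b n = K * L * \<theta> ^ k * \<theta> ^ n" for n
      have b: "b sums (K * L * \<theta> ^ k * (1 / (1 - \<theta>)))"
        unfolding b_def using \<theta> by (intro sums_mult geometric_sums) auto
      have "norm (a (n + k) * z ^ (n + k)) \<le> b n" for n
      proof -
        have "norm (a (n + k) * z ^ (n + k)) \<le> K * L / r' ^ (n + k) * r ^ (n + k)"
          unfolding norm_mult norm_power using a1[of "n + k"] z K L r'
          by (intro mult_mono power_mono) auto
        also have "\<dots> = K * L * \<theta> ^ (n + k)" by (simp add: \<theta>_def power_divide)
        also have "\<dots> = b n" by (simp add: b_def power_add)
        finally show ?thesis .
      qed
      then have "norm (\<Sum>n. a (n + k) * z ^ (n + k)) \<le> (\<Sum>n. b n)"
        by (rule norm_suminf_le[OF _ sums_summable[OF b]])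
      also have "\<dots> = (K / (1 - \<theta>) * \<theta> ^ k) * L" using sums_unique[OF b] by (simp add: mult_ac)
      also have "\<dots> \<le> \<eta> * L" using k L by (intro mult_right_mono) auto
      finally show ?thesis .
    qed
    finally show "norm (f z) \<le> C + \<eta> * L" by simp
  qed
qed

section \<open>Bounds for zeta and for its logarithm\<close>

definition zet :: "complex \<Rightarrow> complex" where "zet s = Z s / (s - 1)"

text \<open>From the third term on, N^(-2) is compared with the telescoping 1 / (N - 1) - 1 / N; the
  induction starts from 1/4 = 3/4 - 1/2.\<close>

lemma zet_near_1:
  assumes "Re s \<ge> 2"
  shows "norm (zet s - 1) \<le> 3 / 4"
proof -
  have s: "Re s > 0" "s \<noteq> 1" using assms by auto
  define P where "P N = (\<Sum>n\<in>{1..N}. cpow (real n) (-s))" for N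
  have "(\<lambda>N. norm s * norm (s - 1) * real N powr (- Re s) / Re s) \<longlonglongrightarrow> 0"
    by (intro tendsto_divide_zero tendsto_mult_right_zero tendsto_neg_powr filterlim_real_sequentially) (use s in auto)
  then have "(\<lambda>N. Z s - (s - 1) * P N - cpow (Suc N) (1 - s)) \<longlonglongrightarrow> 0"
  proof (rule Lim_null_comparison[rotated], intro eventually_sequentiallyI[of 1])
    fix N :: nat assume "1 \<le> N"
    then show "norm (Z s - (s - 1) * P N - cpow (Suc N) (1 - s)) \<le> norm s * norm (s - 1) * real N powr (- Re s) / Re s"
      unfolding P_def by (intro Z_partial s) auto
  qed
  moreover have "(\<lambda>N. cpow (Suc N) (1 - s)) \<longlonglongrightarrow> 0"
  proof -
    have "(\<lambda>N. real N powr (Re (1 - s))) \<longlonglongrightarrow> 0"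
      by (intro tendsto_neg_powr filterlim_real_sequentially) (use assms in auto)
    then have "(\<lambda>N. real (Suc N) powr (Re (1 - s))) \<longlonglongrightarrow> 0"
      by (rule LIMSEQ_Suc)
    then show ?thesis by (subst tendsto_norm_zero_iff[symmetric]) (simp add: norm_cpow)
  qed
  ultimately have "(\<lambda>N. Z s - (Z s - (s - 1) * P N - cpow (Suc N) (1 - s)) - cpow (Suc N) (1 - s)) \<longlonglongrightarrow> Z s - 0 - 0"
    by (intro tendsto_intros)
  then have "(\<lambda>N. (s - 1) * P N / (s - 1)) \<longlonglongrightarrow> Z s / (s - 1)"
    by (intro tendsto_divide) (use s in \<open>auto simp: algebra_simps\<close>)
  then have lim: "P \<longlonglongrightarrow> zet s" using s by (simp add: zet_def)
  have bd: "norm (P N - 1) \<le> 3 / 4 - 1 / N" if "N \<ge> 2" for N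
    using that
  proof (induction N rule: dec_induct)
    case base
    have "P 2 = 1 + cpow 2 (-s)" by (simp add: P_def numeral_2_eq_2)
    then have "norm (P 2 - 1) = 2 powr (- Re s)" by (simp add: norm_cpow)
    also have "\<dots> \<le> 2 powr (-2)" using assms by (intro powr_mono) auto
    finally show ?case by (simp add: powr_minus)
  next
    case (step N)
    have "P (Suc N) - 1 = (P N - 1) + cpow (real (Suc N)) (-s)" by (simp add: P_def)
    also have "norm \<dots> \<le> norm (P N - 1) + norm (cpow (real (Suc N)) (-s))" by (rule norm_triangle_ineq)
    also have "norm (cpow (real (Suc N)) (-s)) \<le> real (Suc N) powr (-2)"
      using assms by (simp only: norm_cpow of_nat_0_less_iff zero_less_Suc) (intro powr_mono, auto)
    also have "real (Suc N) powr (-2) = 1 / (real (Suc N))\<^sup>2" by (simp add: powr_minus divide_inverse powr_numeral)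
    also have "\<dots> \<le> 1 / (real N * real (Suc N))"
      using step.hyps by (intro divide_left_mono) (auto simp: power2_eq_square)
    also have "\<dots> = 1 / N - 1 / Suc N" using step.hyps by (simp add: field_simps)
    finally show ?case using step.IH by linarith
  qed
  have "(\<lambda>N. norm (P N - 1)) \<longlonglongrightarrow> norm (zet s - 1)" using lim by (intro tendsto_intros)
  then show ?thesis
  proof (rule LIMSEQ_le_const2, intro exI[of _ 2] allI impI)
    fix N :: nat assume "N \<ge> 2"
    then have "norm (P N - 1) \<le> 3 / 4 - 1 / N" by (rule bd)
    moreover have "1 / real N \<ge> 0" by simp
    ultimately show "norm (P N - 1) \<le> 3 / 4" by linarith
  qed
qed

lemma zet_bounds:
  assumes "Re s \<ge> 2"
  shows "norm (zet s) \<ge> 1 / 4" "norm (zet s) \<le> 7 / 4"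
  using zet_near_1[OF assms] norm_triangle_ineq2[of 1 "zet s"] norm_triangle_ineq2[of "zet s" 1]
  by (auto simp: norm_minus_commute)

text \<open>Littlewood's argument is applied to the logarithm of zet (s1 + z) / zet s1 on a disc
  centred at s1 = 3 + i Im s. Its real part is at most ln |Im s| + O(1) on the disc and bounded near
  the centre, so on a smaller disc the logarithm itself is at most \<eta> ln |Im s| + O(1).
  Exponentiation bounds 1 / zet, and Cauchy's inequality bounds the logarithmic derivative.\<close>

lemma zet_log_bound:
  assumes \<sigma>1: "0 < \<sigma>1" "\<sigma>1 < \<sigma>0" "\<sigma>0 < 3" and nz: "\<And>s. Re s > \<sigma>1 \<Longrightarrow> Z s \<noteq> 0" and \<eta>: "\<eta> > 0"
  obtains C where "C > 0"
    "\<And>s. \<sigma>0 \<le> Re s \<Longrightarrow> Re s \<le> 3 \<Longrightarrow> \<bar>Im s\<bar> \<ge> 4 \<Longrightarrow> norm (1 / zet s) \<le> C * \<bar>Im s\<bar> powr \<eta> \<and> norm (deriv zet s / zet s) \<le> C * \<bar>Im s\<bar> powr \<eta>"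
proof -
  define R where "R = 3 - \<sigma>1"
  define r where "r = 3 - \<sigma>0"
  \<comment> \<open>A radius strictly between r and R leaves room for Cauchy's inequality on discs
    of radius r' - r.\<close>
  define r' where "r' = (r + R) / 2"
  have r: "0 < r" "r < r'" "r' < R" "R < 3" "0 < r'" using \<sigma>1 by (auto simp: R_def r_def r'_def)
  define \<delta> where "\<delta> = min 1 r'"
  have \<delta>: "0 < \<delta>" "\<delta> < R" "\<delta> \<le> 1" using r by (auto simp: \<delta>_def)
  obtain C1 where C1: "\<And>f L z. f holomorphic_on ball 0 R \<Longrightarrow> f 0 = 0 \<Longrightarrow> (\<And>z. z \<in> ball 0 R \<Longrightarrow> Re (f z) < L) \<Longrightarrow>
      (\<And>z. z \<in> ball 0 \<delta> \<Longrightarrow> Re (f z) < ln 8) \<Longrightarrow> norm z \<le> r' \<Longrightarrow> norm (f z) \<le> C1 + \<eta> * L"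
    using littlewood_convexity[OF r(5,3) \<delta>(1,2) \<eta>, where c = "ln 8"] by blast
  define A where "A = 4 * (1 + 3 * (1 + 1 / \<sigma>1))"
  have A: "A \<ge> 1" using \<sigma>1 by (simp add: A_def)
  define E where "E = exp (C1 + \<eta> * (ln A + 1))"
  define C where "C = max (4 * E) (E / (r' - r))"
  show thesis
  proof (rule that[of C])
    show "C > 0" by (simp add: C_def E_def less_max_iff_disj)
    fix s assume s: "\<sigma>0 \<le> Re s" "Re s \<le> 3" "\<bar>Im s\<bar> \<ge> 4"
    define t where "t = \<bar>Im s\<bar>"
    define s1 where "s1 = Complex 3 (Im s)"
    have inball: "Re w > \<sigma>1 \<and> w \<noteq> 1 \<and> norm (zet w) \<le> A / 4 * t" if w: "norm (w - s1) < R" for w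
    proof -
      have "\<bar>Re (w - s1)\<bar> < R" "\<bar>Im (w - s1)\<bar> < R" using w abs_Re_le_cmod[of "w - s1"] abs_Im_le_cmod[of "w - s1"] by linarith+
      \<comment> \<open>R < 3 and |Im s| \<ge> 4 keep the disc away from the pole at 1.\<close>
      then have 1: "Re w > \<sigma>1" "\<bar>Im w\<bar> > 1" using s r by (auto simp: s1_def R_def)
      have 2: "norm (w - 1) \<ge> 1" using abs_Im_le_cmod[of "w - 1"] 1 by simp
      have "norm w \<le> norm s1 + R" using norm_triangle_sub[of w s1] w by simp
      also have "norm s1 \<le> 3 + t" using cmod_le[of s1] by (simp add: s1_def t_def)
      finally have 3: "norm w \<le> 3 * t" using s r by (simp add: t_def)
      have "norm (Z w) \<le> 1 + norm w * norm (w - 1) * (1 + 1 / \<sigma>1)" using norm_Z_le[of \<sigma>1 w] 1 \<sigma>1 by simp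
      then have "norm (zet w) \<le> (1 + norm w * norm (w - 1) * (1 + 1 / \<sigma>1)) / norm (w - 1)"
        unfolding zet_def norm_divide by (intro divide_right_mono) auto
      also have "\<dots> = 1 / norm (w - 1) + norm w * (1 + 1 / \<sigma>1)" using 1 by (auto simp: add_divide_distrib)
      also have "\<dots> \<le> 1 * t + 3 * t * (1 + 1 / \<sigma>1)"
      proof (intro add_mono mult_right_mono)
        have "1 / norm (w - 1) \<le> 1" using 2 by (simp add: divide_simps)
        then show "1 / norm (w - 1) \<le> 1 * t" using s unfolding t_def by linarith
      qed (use 3 \<sigma>1 in auto)
      also have "\<dots> = A / 4 * t" by (simp add: A_def algebra_simps)
      finally show ?thesis using 1 by auto
    qed
    have z1: "norm (zet s1) \<ge> 1 / 4" by (rule zet_bounds) (simp add: s1_def)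
    then have z1n: "zet s1 \<noteq> 0" by auto
    define \<phi> where "\<phi> z = zet (s1 + z) / zet s1" for z
    have op: "open {s. Re s > \<sigma>1 \<and> s \<noteq> 1}"
    proof -
      have "{s. Re s > \<sigma>1 \<and> s \<noteq> 1} = {s. Re s > \<sigma>1} - {1}" by auto
      then show ?thesis by (simp add: open_halfspace_Re_gt open_Diff)
    qed
    have zh: "zet holomorphic_on {s. Re s > \<sigma>1 \<and> s \<noteq> 1}"
      unfolding zet_def[abs_def] using \<sigma>1 by (intro holomorphic_intros holomorphic_on_subset[OF holomorphic_Z]) auto
    have sub: "(\<lambda>z. s1 + z) ` ball 0 R \<subseteq> {s. Re s > \<sigma>1 \<and> s \<noteq> 1}"
    proof
      fix w assume "w \<in> (\<lambda>z. s1 + z) ` ball 0 R"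
      then have "norm (w - s1) < R" by (auto simp: dist_norm norm_minus_commute)
      then show "w \<in> {s. Re s > \<sigma>1 \<and> s \<noteq> 1}" using inball[of w] by simp
    qed
    have "(\<lambda>z. s1 + z) holomorphic_on ball 0 R" by (intro holomorphic_intros)
    from holomorphic_on_compose_gen[OF this zh sub]
    have "(\<lambda>z. zet (s1 + z)) holomorphic_on ball 0 R" by (simp add: comp_def)
    then have \<phi>h: "\<phi> holomorphic_on ball 0 R"
      unfolding \<phi>_def using z1n by (intro holomorphic_intros)
    have \<phi>n: "\<phi> z \<noteq> 0" if "z \<in> ball 0 R" for z
      using nz inball[of "s1 + z"] that z1n by (auto simp: \<phi>_def zet_def)
    obtain h where h: "h holomorphic_on ball 0 R" "\<And>z. z \<in> ball 0 R \<Longrightarrow> exp (h z) = \<phi> z"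
      using holomorphic_logarithm_exists[OF convex_ball open_ball \<phi>h _ ] \<phi>n r by (metis centre_in_ball less_trans)
    define f where "f z = h z - h 0" for z
    have z0: "0 \<in> ball 0 R" using r by auto
    have f: "f holomorphic_on ball 0 R" "f 0 = 0" "\<And>z. z \<in> ball 0 R \<Longrightarrow> exp (f z) = \<phi> z"
    proof -
      show "f holomorphic_on ball 0 R" unfolding f_def[abs_def] by (intro holomorphic_intros h(1))
      show "f 0 = 0" by (simp add: f_def)
      show "exp (f z) = \<phi> z" if "z \<in> ball 0 R" for z
        using h(2)[OF that] h(2)[OF z0] z1n by (simp add: f_def exp_diff \<phi>_def)
    qed
    define L where "L = ln (A * t) + 1"
    have t: "t \<ge> 4" using s by (simp add: t_def)
    have reL: "Re (f z) < L" if z: "z \<in> ball 0 R" for z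
    proof -
      have "exp (Re (f z)) = norm (\<phi> z)" using f(3)[OF z] by (metis norm_exp_eq_Re)
      also have "\<dots> \<le> (A / 4 * t) / (1 / 4)"
        unfolding \<phi>_def norm_divide using inball[of "s1 + z"] z z1 A t by (intro frac_le) auto
      finally have "exp (Re (f z)) \<le> exp (ln (A * t))" using A t by simp
      then show ?thesis by (simp add: L_def)
    qed
    have re0: "Re (f z) < ln 8" if z: "z \<in> ball 0 \<delta>" for z
    proof -
      have z': "z \<in> ball 0 R" using z \<delta> by auto
      have "\<bar>Re z\<bar> < 1" using z \<delta> abs_Re_le_cmod[of z] by auto
      then have "Re (s1 + z) \<ge> 2" by (simp add: s1_def)
      then have "norm (zet (s1 + z)) \<le> 7 / 4" by (rule zet_bounds)
      have "exp (Re (f z)) = norm (\<phi> z)" using f(3)[OF z'] by (metis norm_exp_eq_Re)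
      also have "\<dots> \<le> (7 / 4) / (1 / 4)"
        unfolding \<phi>_def norm_divide using \<open>norm (zet (s1 + z)) \<le> 7 / 4\<close> z1 by (intro frac_le) auto
      also have "\<dots> = 7" by simp
      also have "7 < exp (ln 8 :: real)" by simp
      finally show ?thesis by (simp only: exp_less_cancel_iff)
    qed
    have fbd: "norm (f z) \<le> C1 + \<eta> * L" if "norm z \<le> r'" for z
      by (rule C1[OF f(1,2) reL re0 that])
    have eE: "exp (C1 + \<eta> * L) = E * t powr \<eta>"
    proof -
      have "C1 + \<eta> * L = C1 + \<eta> * (ln A + 1) + \<eta> * ln t" using A t by (simp add: L_def ln_mult algebra_simps)
      then show ?thesis using t by (simp add: E_def exp_add powr_def)
    qed
    define z where "z = s - s1"
    have z: "norm z \<le> r"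
    proof -
      have "z = of_real (Re s - 3)" by (simp add: z_def s1_def complex_eq_iff)
      then have "norm z = \<bar>Re s - 3\<bar>" by (simp only: norm_of_real)
      then show ?thesis using s by (simp add: r_def)
    qed
    have zb: "z \<in> ball 0 R" using z r by auto
    have zs: "zet s = zet s1 * exp (f z)" using f(3)[OF zb] z1n by (simp add: \<phi>_def z_def)
    have "norm (1 / zet s) \<le> C * t powr \<eta>"
    proof -
      have "norm (1 / zet s) = 1 / norm (zet s1) * exp (- Re (f z))"
        by (simp add: zs norm_divide norm_mult exp_minus field_simps)
      also have "\<dots> \<le> 4 * exp (C1 + \<eta> * L)"
      proof (rule mult_mono)
        have "1 / norm (zet s1) \<le> 1 / (1 / 4)" using z1 by (intro frac_le) auto
        then show "1 / norm (zet s1) \<le> 4" by simp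
        show "exp (- Re (f z)) \<le> exp (C1 + \<eta> * L)" using fbd[of z] z r abs_Re_le_cmod[of "f z"] by simp
      qed auto
      also have "\<dots> = 4 * E * t powr \<eta>" by (simp add: eE)
      also have "\<dots> \<le> C * t powr \<eta>" by (intro mult_right_mono) (auto simp: C_def)
      finally show ?thesis .
    qed
    moreover have "norm (deriv zet s / zet s) \<le> C * t powr \<eta>"
    proof -
      have df: "(f has_field_derivative deriv f z) (at z)"
        using f(1) zb by (intro holomorphic_derivI) auto
      have "((\<lambda>w. zet s1 * exp (f w)) has_field_derivative zet s1 * (exp (f z) * deriv f z)) (at z)"
        by (auto intro!: derivative_eq_intros df)
      then have "((\<lambda>w. zet (s1 + w)) has_field_derivative zet s1 * (exp (f z) * deriv f z)) (at z)"
        by (rule has_field_derivative_transform_within_open[OF _ open_ball zb]) (use f(3) z1n in \<open>auto simp: \<phi>_def\<close>)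
      then have "(zet has_field_derivative zet s1 * (exp (f z) * deriv f z)) (at s)"
        using DERIV_at_within_shift[of zet _ s1 z UNIV] by (simp add: z_def)
      then have "deriv zet s = zet s * deriv f z" unfolding zs by (simp add: DERIV_imp_deriv)
      moreover have "zet s \<noteq> 0" using zs z1n by simp
      ultimately have "norm (deriv zet s / zet s) = norm ((deriv ^^ 1) f z)" by simp
      also have "\<dots> \<le> fact 1 * (C1 + \<eta> * L) / (r' - r) ^ 1"
      proof (rule Cauchy_inequality)
        have sub: "cball z (r' - r) \<subseteq> cball 0 r'"
        proof
          fix w assume "w \<in> cball z (r' - r)"
          then show "w \<in> cball 0 r'" using z norm_triangle_sub[of w z] by (simp add: dist_norm norm_minus_commute)
        qed
        then have sub2: "cball z (r' - r) \<subseteq> ball 0 R" using r by auto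
        then show "f holomorphic_on ball z (r' - r)" "continuous_on (cball z (r' - r)) f"
          using f(1) ball_subset_cball by (blast intro: holomorphic_on_imp_continuous_on holomorphic_on_subset)+
        show "norm (f w) \<le> C1 + \<eta> * L" if "norm (z - w) = r' - r" for w
        proof (rule fbd)
          have "w \<in> cball z (r' - r)" using that by (simp add: dist_norm)
          then have "w \<in> cball 0 r'" using sub by blast
          then show "norm w \<le> r'" by simp
        qed
      qed (use r in auto)
      also have "\<dots> \<le> exp (C1 + \<eta> * L) / (r' - r)"
      proof -
        have "C1 + \<eta> * L \<le> exp (C1 + \<eta> * L)" using exp_ge_add_one_self[of "C1 + \<eta> * L"] by linarith
        then show ?thesis using r by (simp add: divide_right_mono del: exp_ge_add_one_self)
      qed
      also have "\<dots> = E / (r' - r) * t powr \<eta>" by (simp add: eE)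
      also have "\<dots> \<le> C * t powr \<eta>" by (intro mult_right_mono) (auto simp: C_def)
      finally show ?thesis .
    qed
    ultimately show "norm (1 / zet s) \<le> C * \<bar>Im s\<bar> powr \<eta> \<and> norm (deriv zet s / zet s) \<le> C * \<bar>Im s\<bar> powr \<eta>"
      by (simp add: t_def)
  qed
qed

section \<open>A Tauberian theorem with Gaussian smoothing\<close>

lemma integrable_vertical_bound: "integrable lborel (\<lambda>t::real. B / (1 + t\<^sup>2))"
  using integrable_mult_right[OF integrable_inverse_1_plus_square[unfolded set_integrable_def], of B]
  by (simp add: divide_inverse)

lemma integrable_vertical_line:
  assumes hol: "h holomorphic_on {s. a \<le> Re s \<and> Re s \<le> b}" and x: "a \<le> x" "x \<le> b"
    and bd: "\<And>s. a \<le> Re s \<Longrightarrow> Re s \<le> b \<Longrightarrow> norm (h s) \<le> B / (1 + (Im s)\<^sup>2)"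
  shows "integrable lborel (\<lambda>t. h (Complex x t))"
proof (rule Bochner_Integration.integrable_bound[OF integrable_vertical_bound[of B]])
  have "continuous_on UNIV (\<lambda>t. h (Complex x t))"
    by (rule continuous_on_compose2[OF holomorphic_on_imp_continuous_on[OF hol]]) (use x in \<open>auto intro!: continuous_intros\<close>)
  then show "(\<lambda>t. h (Complex x t)) \<in> borel_measurable lborel"
    by (simp add: borel_measurable_continuous_onI)
  show "AE t in lborel. norm (h (Complex x t)) \<le> norm (B / (1 + t\<^sup>2))"
  proof (rule AE_I2)
    fix t
    show "norm (h (Complex x t)) \<le> norm (B / (1 + t\<^sup>2))" using order_trans[OF bd[of "Complex x t"] abs_ge_self] x by (simp only: real_norm_def complex.sel)
  qed
qed

text \<open>Cauchy's theorem on rectangles of height 2 T; the horizontal sides contribute O(1 /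
  T^2).\<close>

lemma vertical_shift:
  assumes hol: "h holomorphic_on {s. a \<le> Re s \<and> Re s \<le> b}" and ab: "a \<le> b"
    and bd: "\<And>s. a \<le> Re s \<Longrightarrow> Re s \<le> b \<Longrightarrow> norm (h s) \<le> B / (1 + (Im s)\<^sup>2)"
  shows "(LINT t|lborel. h (Complex a t)) = (LINT t|lborel. h (Complex b t))"
proof -
  define S where "S = {s. a \<le> Re s \<and> Re s \<le> b}"
  have S: "convex S"
  proof -
    have "S = {s. Re s \<ge> a} \<inter> {s. Re s \<le> b}" by (auto simp: S_def)
    then show ?thesis by (simp add: convex_Int convex_halfspace_Re_ge convex_halfspace_Re_le)
  qed
  have hS: "h holomorphic_on S" using hol by (simp add: S_def)
  then have cS: "continuous_on S h" by (rule holomorphic_on_imp_continuous_on)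
  have seg: "closed_segment p q \<subseteq> S" if "p \<in> S" "q \<in> S" for p q
    using S that by (rule closed_segment_subset[rotated 2])
  have lim: "(\<lambda>n. integral {- real n..real n} (\<lambda>t. h (Complex x t))) \<longlonglongrightarrow> (LINT t|lborel. h (Complex x t))"
    if x: "a \<le> x" "x \<le> b" for x
  proof -
    have int: "integrable lborel (\<lambda>t. h (Complex x t))" by (rule integrable_vertical_line[OF hol x bd])
    have "(\<lambda>n. LINT t|lborel. indicator {- real n..real n} t *\<^sub>R h (Complex x t)) \<longlonglongrightarrow> (LINT t|lborel. h (Complex x t))"
    proof (rule integral_dominated_convergence[where w = "\<lambda>t. norm (h (Complex x t))"])
      show "AE t in lborel. (\<lambda>n. indicator {- real n..real n} t *\<^sub>R h (Complex x t)) \<longlonglongrightarrow> h (Complex x t)"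
      proof (rule AE_I2, rule tendsto_eventually)
        fix t :: real
        obtain N :: nat where N: "\<bar>t\<bar> \<le> real N" using real_arch_simple by blast
        show "\<forall>\<^sub>F n in sequentially. indicator {- real n..real n} t *\<^sub>R h (Complex x t) = h (Complex x t)"
          by (rule eventually_sequentiallyI[of N]) (use N in \<open>auto simp: indicator_def\<close>)
      qed
      show "AE t in lborel. norm (indicator {- real n..real n} t *\<^sub>R h (Complex x t)) \<le> norm (h (Complex x t))" for n
        by (rule AE_I2) (auto simp: indicator_def)
    qed (use int in \<open>auto intro!: borel_measurable_integrable borel_measurable_scaleR\<close>)
    moreover have "(LINT t|lborel. indicator {- real n..real n} t *\<^sub>R h (Complex x t)) = integral {- real n..real n} (\<lambda>t. h (Complex x t))" for n
    proof -
      have "set_integrable lborel {- real n..real n} (\<lambda>t. h (Complex x t))"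
        unfolding set_integrable_def by (rule integrable_mult_indicator[OF _ int]) simp
      from set_borel_integral_eq_integral(2)[OF this] show ?thesis by (simp add: set_lebesgue_integral_def)
    qed
    ultimately show ?thesis by simp
  qed
  have est: "norm (integral {- T..T} (\<lambda>t. h (Complex b t)) - integral {- T..T} (\<lambda>t. h (Complex a t))) \<le> 2 * (B / (1 + T\<^sup>2) * (b - a))"
    if T: "T > 0" for T
  proof -
    define p q r u where "p = Complex a (-T)" and "q = Complex b (-T)" and "r = Complex b T" and "u = Complex a T"
    have pqru: "p \<in> S" "q \<in> S" "r \<in> S" "u \<in> S" using ab by (auto simp: S_def p_def q_def r_def u_def)
    have ci: "h contour_integrable_on (linepath x y)" if "x \<in> S" "y \<in> S" for x y
      by (rule contour_integrable_continuous_linepath[OF continuous_on_subset[OF cS seg[OF that]]])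
    define g where "g = linepath p q +++ linepath q r +++ linepath r u +++ linepath u p"
    have "(h has_contour_integral 0) g"
    proof (rule Cauchy_theorem_convex_simple[OF hS S])
      show "path_image g \<subseteq> S" unfolding g_def using pqru seg by (simp add: path_image_join)
    qed (auto simp: g_def)
    then have "contour_integral g h = 0" by (rule contour_integral_unique)
    moreover have "contour_integral g h = contour_integral (linepath p q) h + (contour_integral (linepath q r) h
        + (contour_integral (linepath r u) h + contour_integral (linepath u p) h))"
      unfolding g_def using pqru by (simp add: contour_integral_join contour_integrable_join ci valid_path_join)
    moreover have "contour_integral (linepath q r) h = \<i> * integral {- T..T} (\<lambda>t. h (Complex b t))"
      by (rule contour_integral_linepath_same_Re) (use T in \<open>auto simp: q_def r_def\<close>)
    moreover have "contour_integral (linepath p u) h = \<i> * integral {- T..T} (\<lambda>t. h (Complex a t))"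
      by (rule contour_integral_linepath_same_Re) (use T in \<open>auto simp: p_def u_def\<close>)
    moreover have "contour_integral (linepath u p) h = - contour_integral (linepath p u) h"
      using contour_integral_reversepath[of "linepath p u" h] by simp
    ultimately have eq: "\<i> * (integral {- T..T} (\<lambda>t. h (Complex b t)) - integral {- T..T} (\<lambda>t. h (Complex a t)))
         = - contour_integral (linepath p q) h - contour_integral (linepath r u) h"
      by (simp add: algebra_simps eq_neg_iff_add_eq_0)
    have B0: "B \<ge> 0"
    proof -
      have "norm (h p) \<le> B / (1 + T\<^sup>2)" using bd[of p] ab by (simp add: p_def)
      then have "0 \<le> B / (1 + T\<^sup>2)" using norm_ge_zero order_trans by blast
      then show ?thesis by (simp add: zero_le_divide_iff add_nonneg_eq_0_iff split: if_splits) (smt (verit) zero_le_power2)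
    qed
    have hor: "norm (contour_integral (linepath x y) h) \<le> B / (1 + T\<^sup>2) * norm (y - x)"
      if xy: "x \<in> S" "y \<in> S" "\<bar>Im x\<bar> = T" "Im y = Im x" for x y
    proof (rule contour_integral_bound_linepath[OF ci[OF xy(1,2)]])
      show "0 \<le> B / (1 + T\<^sup>2)" using B0 by simp
      fix w assume w: "w \<in> closed_segment x y"
      then have "w \<in> S" using seg[OF xy(1,2)] by blast
      moreover have "Im w = Im x"
      proof -
        obtain v where "w = (1 - v) *\<^sub>R x + v *\<^sub>R y" using w by (auto simp: closed_segment_def)
        then have "Im w = (1 - v) * Im x + v * Im x" using xy(4) by simp
        then show ?thesis by (simp add: algebra_simps)
      qed
      then have "(Im w)\<^sup>2 = T\<^sup>2" using xy(3) by (metis power2_abs)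
      ultimately show "norm (h w) \<le> B / (1 + T\<^sup>2)" using bd[of w] by (simp add: S_def)
    qed
    have "norm (q - p) = b - a" "norm (u - r) = b - a"
      using ab by (auto simp: p_def q_def r_def u_def cmod_def complex_diff)
    then have "norm (contour_integral (linepath p q) h) \<le> B / (1 + T\<^sup>2) * (b - a)"
      "norm (contour_integral (linepath r u) h) \<le> B / (1 + T\<^sup>2) * (b - a)"
      using hor[of p q] hor[of r u] pqru T by (auto simp: p_def q_def r_def u_def)
    then have "norm (- contour_integral (linepath p q) h - contour_integral (linepath r u) h) \<le> 2 * (B / (1 + T\<^sup>2) * (b - a))"
      using norm_triangle_ineq4[of "- contour_integral (linepath p q) h" "contour_integral (linepath r u) h"] by simp
    then show ?thesis unfolding eq[symmetric] norm_mult by simp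
  qed
  have "(\<lambda>n. integral {- real n..real n} (\<lambda>t. h (Complex b t)) - integral {- real n..real n} (\<lambda>t. h (Complex a t))) \<longlonglongrightarrow> 0"
  proof (rule Lim_null_comparison)
    show "\<forall>\<^sub>F n in sequentially. norm (integral {- real n..real n} (\<lambda>t. h (Complex b t)) - integral {- real n..real n} (\<lambda>t. h (Complex a t))) \<le> 2 * (B / (1 + (real n)\<^sup>2) * (b - a))"
      by (rule eventually_sequentiallyI[of 1]) (intro est, auto)
    have "(\<lambda>n. B / (1 + (real n)\<^sup>2)) \<longlonglongrightarrow> 0" by real_asymp
    then show "(\<lambda>n. 2 * (B / (1 + (real n)\<^sup>2) * (b - a))) \<longlonglongrightarrow> 0"
      by (intro tendsto_mult_right_zero tendsto_mult_left_zero)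
  qed
  moreover have "(\<lambda>n. integral {- real n..real n} (\<lambda>t. h (Complex b t)) - integral {- real n..real n} (\<lambda>t. h (Complex a t)))
      \<longlonglongrightarrow> (LINT t|lborel. h (Complex b t)) - (LINT t|lborel. h (Complex a t))"
    using ab by (intro tendsto_diff lim) auto
  ultimately have "(LINT t|lborel. h (Complex b t)) - (LINT t|lborel. h (Complex a t)) = 0"
    using LIMSEQ_unique by blast
  then show ?thesis by simp
qed

text \<open>The substitution t = K x turns the integral into the characteristic function of the
  standard normal law at c / K + K y. The value is independent of c, as a contour shift
  predicts.\<close>

lemma gaussian_line_integral:
  assumes "K > 0"
  shows "(LINT t|lborel. exp ((Complex c t)\<^sup>2 / (2 * of_real (K\<^sup>2)) + Complex c t * of_real y))
           = of_real (K * sqrt (2 * pi) * exp (- (K * y)\<^sup>2 / 2))"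
proof -
  define \<theta> where "\<theta> = c / K + K * y"
  define w where "w = exp (c\<^sup>2 / (2 * K\<^sup>2) + c * y)"
  have pt: "exp ((Complex c (K * x))\<^sup>2 / (2 * of_real (K\<^sup>2)) + Complex c (K * x) * of_real y)
     = of_real (w * sqrt (2 * pi)) * (std_normal_density x *\<^sub>R iexp (\<theta> * x))" for x
  proof -
    have "(Complex c (K * x))\<^sup>2 / (2 * of_real (K\<^sup>2)) + Complex c (K * x) * of_real y
       = of_real (c\<^sup>2 / (2 * K\<^sup>2) + c * y) + of_real (- x\<^sup>2 / 2) + \<i> * of_real (\<theta> * x)"
      using assms by (simp add: complex_eq_iff power2_eq_square \<theta>_def Re_divide_of_real Im_divide_of_real field_simps)
    then have "exp ((Complex c (K * x))\<^sup>2 / (2 * of_real (K\<^sup>2)) + Complex c (K * x) * of_real y)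
       = exp (of_real (c\<^sup>2 / (2 * K\<^sup>2) + c * y)) * exp (of_real (- x\<^sup>2 / 2)) * iexp (\<theta> * x)"
      by (simp only: exp_add)
    also have "\<dots> = of_real w * of_real (exp (- x\<^sup>2 / 2)) * iexp (\<theta> * x)"
      by (simp only: exp_of_real w_def)
    also have "of_real (exp (- x\<^sup>2 / 2)) = complex_of_real (sqrt (2 * pi) * std_normal_density x)"
      by (simp add: std_normal_density_def)
    finally show ?thesis by (simp add: scaleR_conv_of_real mult_ac)
  qed
  have "(LINT t|lborel. exp ((Complex c t)\<^sup>2 / (2 * of_real (K\<^sup>2)) + Complex c t * of_real y))
      = \<bar>K\<bar> *\<^sub>R (LINT x|lborel. exp ((Complex c (0 + K * x))\<^sup>2 / (2 * of_real (K\<^sup>2)) + Complex c (0 + K * x) * of_real y))"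
    by (rule lborel_integral_real_affine) (use assms in simp)
  also have "\<dots> = K *\<^sub>R (of_real (w * sqrt (2 * pi)) * (LINT x|lborel. std_normal_density x *\<^sub>R iexp (\<theta> * x)))"
    using assms by (simp only: add_0 pt integral_mult_right_zero abs_of_pos)
  also have "(LINT x|lborel. std_normal_density x *\<^sub>R iexp (\<theta> * x)) = char std_normal_distribution \<theta>"
    unfolding char_def by (subst integral_density) auto
  also have "\<dots> = of_real (exp (- \<theta>\<^sup>2 / 2))" by (simp add: char_std_normal_distribution)
  also have "K *\<^sub>R (of_real (w * sqrt (2 * pi)) * complex_of_real (exp (- \<theta>\<^sup>2 / 2))) = of_real (K * sqrt (2 * pi) * (w * exp (- \<theta>\<^sup>2 / 2)))"
    by (simp add: scaleR_conv_of_real)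
  also have "w * exp (- \<theta>\<^sup>2 / 2) = exp (- (K * y)\<^sup>2 / 2)"
    unfolding w_def \<theta>_def mult_exp_exp using assms by (simp add: field_simps power2_eq_square)
  finally show ?thesis .
qed

lemma gaussian_line_bound:
  assumes "K > 0"
  shows "norm (exp ((Complex c t)\<^sup>2 / (2 * of_real (K\<^sup>2)) + Complex c t * of_real y)) = exp (c\<^sup>2 / (2 * K\<^sup>2) + c * y) * exp (- t\<^sup>2 / (2 * K\<^sup>2))"
proof -
  have "Re ((Complex c t)\<^sup>2 / (2 * of_real (K\<^sup>2)) + Complex c t * of_real y) = (c\<^sup>2 / (2 * K\<^sup>2) + c * y) + - t\<^sup>2 / (2 * K\<^sup>2)"
    using assms by (simp add: power2_eq_square Re_divide_of_real field_simps)
  then show ?thesis by (simp only: norm_exp_eq_Re exp_add[of "c\<^sup>2 / (2 * K\<^sup>2) + c * y"])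
qed

lemma integrable_exp_neg_half_line: "integrable lborel (\<lambda>v::real. indicator {0..} v * exp (- v))"
proof -
  have "((\<lambda>v::real. exp (- 1 * v)) has_integral exp (- 1 * 0) / 1) {0..}"
    by (rule has_integral_exp_minus_to_infinity) simp
  then have "(\<lambda>v::real. exp (- v)) absolutely_integrable_on {0..}"
    by (intro nonnegative_absolutely_integrable_1) (auto simp: integrable_on_def)
  then have "integrable lebesgue (\<lambda>v::real. indicator {0..} v * exp (- v))"
    by (simp add: set_integrable_def)
  then show ?thesis by (subst (asm) integrable_completion) auto
qed

lemma integrable_one_plus_abs_powr:
  assumes "p < -1"
  shows "integrable lborel (\<lambda>t::real. (1 + \<bar>t\<bar>) powr p)"
proof -
  define g where "g t = indicator {1..} t * t powr p" for t :: real
  have "((\<lambda>t::real. t powr p) has_integral - (1 powr (p + 1)) / (p + 1)) {1..}"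
    by (rule has_integral_powr_to_inf) (use assms in auto)
  then have "(\<lambda>t::real. t powr p) absolutely_integrable_on {1..}"
    by (intro nonnegative_absolutely_integrable_1) (auto simp: integrable_on_def)
  then have "integrable lebesgue g"
    by (simp add: set_integrable_def g_def[abs_def])
  then have g: "integrable lborel g" unfolding g_def by (subst (asm) integrable_completion) auto
  have "integrable lborel (\<lambda>t. g (1 + 1 * t) + g (1 + (-1) * t))"
    using g by (intro Bochner_Integration.integrable_add lborel_integrable_real_affine) auto
  then show ?thesis
  proof (rule Bochner_Integration.integrable_bound)
    show "AE t in lborel. norm ((1 + \<bar>t\<bar>) powr p) \<le> norm (g (1 + 1 * t) + g (1 + (-1) * t))"
      by (rule AE_I2) (auto simp: g_def indicator_def abs_if)
  qed simp
qed

lemma norm_lborel_integral_le: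
  fixes f :: "real \<Rightarrow> 'b :: {banach, second_countable_topology}"
  assumes "integrable lborel f" "integrable lborel g" "\<And>x. norm (f x) \<le> g x"
  shows "norm (LINT x|lborel. f x) \<le> (LINT x|lborel. g x)"
  using integral_norm_bound[of lborel f] integral_mono[OF integrable_norm[OF assms(1)] assms(2,3)]
  by (rule order_trans)

lemma power2_powr:
  fixes x :: real
  assumes "x > 0"
  shows "(x\<^sup>2) powr a = x powr (2 * a)"
proof -
  have "x\<^sup>2 = x powr 2" using assms by simp
  then show ?thesis by (simp only: powr_powr)
qed

text \<open>Trades Gaussian decay for the power (1 + |t|)^(- 2 \<epsilon>) at the price K^(2
  \<epsilon>). Together with a transform of size (1 + |t|)^(\<epsilon> - 1) this is just integrable,
  and the loss in K remains a small power. The proof uses exp u \<ge> 1 + u \<ge> (1 + |t|)^2 / (4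
  K^2).\<close>

lemma exp_minus_le_powr:
  assumes "0 < \<epsilon>" "\<epsilon> \<le> 1" "K \<ge> (1::real)"
  shows "exp (- t\<^sup>2 / (2 * K\<^sup>2)) \<le> 4 * K powr (2 * \<epsilon>) * (1 + \<bar>t\<bar>) powr (- 2 * \<epsilon>)"
proof -
  define u where "u = t\<^sup>2 / (2 * K\<^sup>2)"
  have K2: "K\<^sup>2 \<ge> 1" using assms by simp
  have u: "u \<ge> 0" by (simp add: u_def)
  define w where "w = (1 + \<bar>t\<bar>)\<^sup>2 / (4 * K\<^sup>2)"
  have "1 + \<bar>t\<bar> > 0" by linarith
  then have w0: "w > 0" unfolding w_def using K2 by (intro divide_pos_pos zero_less_power) auto
  have "(1 + \<bar>t\<bar>)\<^sup>2 \<le> 2 + 2 * t\<^sup>2"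
    using zero_le_power2[of "1 - \<bar>t\<bar>"] by (simp add: power2_eq_square algebra_simps)
  also have "\<dots> \<le> 4 * K\<^sup>2 + 2 * t\<^sup>2" using K2 by simp
  also have "\<dots> = 4 * K\<^sup>2 * (1 + u)" using assms by (simp add: u_def distrib_left)
  finally have "(1 + \<bar>t\<bar>)\<^sup>2 \<le> (1 + u) * (4 * K\<^sup>2)" by (simp only: mult.commute)
  moreover have "4 * K\<^sup>2 > 0" using K2 by linarith
  ultimately have w: "w \<le> 1 + u" unfolding w_def by (simp only: pos_divide_le_eq)
  have "w powr \<epsilon> \<le> (1 + u) powr \<epsilon>" using w w0 assms by (intro powr_mono2) auto
  also have "\<dots> \<le> (1 + u) powr 1" using u assms by (intro powr_mono) auto
  also have "\<dots> \<le> exp u" using u exp_ge_add_one_self[of u] by simp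
  finally have "exp (- u) \<le> w powr (- \<epsilon>)" using w0 by (simp add: exp_minus powr_minus field_simps)
  also have "w powr (- \<epsilon>) = (4 * K\<^sup>2) powr \<epsilon> * ((1 + \<bar>t\<bar>)\<^sup>2) powr (- \<epsilon>)"
    using K2 by (simp add: w_def powr_divide powr_minus field_simps)
  also have "((1 + \<bar>t\<bar>)\<^sup>2) powr (- \<epsilon>) = (1 + \<bar>t\<bar>) powr (- 2 * \<epsilon>)"
    by (subst power2_powr) auto
  also have "(4 * K\<^sup>2) powr \<epsilon> = 4 powr \<epsilon> * K powr (2 * \<epsilon>)"
    using assms by (simp add: powr_mult power2_powr)
  also have "4 powr \<epsilon> * K powr (2 * \<epsilon>) * (1 + \<bar>t\<bar>) powr (- 2 * \<epsilon>) \<le> 4 powr 1 * K powr (2 * \<epsilon>) * (1 + \<bar>t\<bar>) powr (- 2 * \<epsilon>)"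
    using assms by (intro mult_right_mono powr_mono) auto
  finally show ?thesis by (simp add: u_def)
qed

text \<open>Multiplying the transform by exp (s^2 / (2 K^2) + s Y) and integrating over Re s = 3
  gives, by Fubini, 2 pi times the average of a against the normal density with mean Y and deviation
  1 / K. Moved to Re s = \<sigma>0, the same integral has size exp (\<sigma>0 * Y).\<close>

lemma tauberian_gaussian:
  fixes a :: "real \<Rightarrow> real"
  assumes meas: "a \<in> borel_measurable borel" and bd: "\<And>v. v \<ge> 0 \<Longrightarrow> \<bar>a v\<bar> \<le> C * exp (2 * v)"
    and hol: "G holomorphic_on {s. \<sigma>0 \<le> Re s \<and> Re s \<le> 3}" and \<sigma>0: "0 < \<sigma>0" "\<sigma>0 < 3"
    and lap: "\<And>s. Re s = 3 \<Longrightarrow> ((\<lambda>L. laplace a L s) \<longlongrightarrow> G s) at_top"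
    and bdG: "\<And>s. \<sigma>0 \<le> Re s \<Longrightarrow> Re s \<le> 3 \<Longrightarrow> norm (G s) \<le> D * (1 + \<bar>Im s\<bar>) powr (\<epsilon> - 1)"
    and \<epsilon>: "0 < \<epsilon>" "\<epsilon> \<le> 1"
  obtains E where "\<And>K Y. K \<ge> 1 \<Longrightarrow> Y \<ge> 0 \<Longrightarrow>
     \<bar>LINT v|lborel. indicator {0..} v * a v * normal_density Y (1 / K) v\<bar> \<le> E * K powr (2 * \<epsilon>) * exp (\<sigma>0 * Y)"
proof -
  define b where "b v = indicator {0..} v * a v" for v
  have b_meas [measurable]: "b \<in> borel_measurable borel"
    unfolding b_def[abs_def] by (intro borel_measurable_times borel_measurable_indicator meas) simp
  have C0: "C \<ge> 0" using bd[of 0] by simp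
  have D0: "D \<ge> 0"
  proof -
    have "norm (G (Complex 3 0)) \<le> D * (1 + 0) powr (\<epsilon> - 1)" using bdG[of "Complex 3 0"] \<sigma>0 by simp
    then have "norm (G (Complex 3 0)) \<le> D" by simp
    then show ?thesis using norm_ge_zero[of "G (Complex 3 0)"] by linarith
  qed
  define f where "f s v = complex_of_real (b v) * exp (- s * of_real v)" for s v
  have nf: "norm (f s v) = \<bar>b v\<bar> * exp (- Re s * v)" for s v
    by (simp add: f_def norm_mult)
  \<comment> \<open>The line Re s = 3 exceeds the a priori exponent 2 by 1, which leaves the
    integrable factor exp (- v).\<close>
  have b3: "\<bar>b v\<bar> * exp (- 3 * v) \<le> C * (indicator {0..} v * exp (- v))" for v
  proof (cases "v \<ge> 0")
    case True
    have "\<bar>a v\<bar> * exp (- 3 * v) \<le> C * exp (2 * v) * exp (- 3 * v)" using bd[OF True] by (intro mult_right_mono) auto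
    also have "\<dots> = C * exp (- v)" by (simp add: mult.assoc mult_exp_exp)
    finally show ?thesis using True by (simp add: b_def)
  qed (simp add: b_def)
  have intb: "integrable lborel (\<lambda>v. \<bar>b v\<bar> * exp (- 3 * v))"
  proof (rule Bochner_Integration.integrable_bound)
    show "integrable lborel (\<lambda>v. C * (indicator {0..} v * exp (- v)))"
      by (intro integrable_mult_right integrable_exp_neg_half_line)
    show "AE v in lborel. norm (\<bar>b v\<bar> * exp (- 3 * v)) \<le> norm (C * (indicator {0..} v * exp (- v)))"
    proof (rule AE_I2)
      fix v
      show "norm (\<bar>b v\<bar> * exp (- 3 * v)) \<le> norm (C * (indicator {0..} v * exp (- v)))"
        using order_trans[OF b3[of v] abs_ge_self] by (simp add: abs_mult)
    qed
  qed simp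
  have f_meas: "f s \<in> borel_measurable borel" for s unfolding f_def by measurable
  have intf: "integrable lborel (f s)" if "Re s = 3" for s
  proof (rule Bochner_Integration.integrable_bound[OF intb])
    show "AE v in lborel. norm (f s v) \<le> norm (\<bar>b v\<bar> * exp (- 3 * v))"
      by (rule AE_I2) (simp add: nf that abs_mult)
  qed (use f_meas in simp)
  have G: "G s = (LINT v|lborel. f s v)" if s: "Re s = 3" for s
  proof (rule tendsto_unique[OF _ lap[OF s]])
    have "((\<lambda>L. LINT v|lborel. indicator {..L} v *\<^sub>R f s v) \<longlongrightarrow> (LINT v|lborel. f s v)) at_top"
      by (rule tendsto_integral_at_top[OF _ intf[OF s]]) simp
    moreover have "(LINT v|lborel. indicator {..L} v *\<^sub>R f s v) = laplace a L s" for L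
    proof -
      have eq: "indicator {..L} v *\<^sub>R f s v = indicator {0..L} v *\<^sub>R (of_real (a v) * exp (- s * of_real v))" for v
        by (auto simp: f_def b_def indicator_def)
      have "set_integrable lborel {0..L} (\<lambda>v. of_real (a v) * exp (- s * of_real v))"
        unfolding set_integrable_def eq[symmetric] by (rule integrable_mult_indicator[OF _ intf[OF s]]) simp
      from set_borel_integral_eq_integral(2)[OF this] show ?thesis
        unfolding eq laplace_def by (simp add: set_lebesgue_integral_def)
    qed
    ultimately show "((\<lambda>L. laplace a L s) \<longlongrightarrow> (LINT v|lborel. f s v)) at_top" by simp
  qed simp
  define W where "W = (LINT t|lborel. (1 + \<bar>t\<bar>) powr (- 1 - \<epsilon>))"
  have intW: "integrable lborel (\<lambda>t::real. (1 + \<bar>t\<bar>) powr (- 1 - \<epsilon>))"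
    by (rule integrable_one_plus_abs_powr) (use \<epsilon> in simp)
  define E where "E = D * exp (9 / 2) * 4 * W / (2 * pi)"
  show thesis
  proof (rule that[of E])
    fix K Y :: real assume K: "K \<ge> 1" and Y: "Y \<ge> 0"
    define q where "q s y = exp (s\<^sup>2 / (2 * of_real (K\<^sup>2)) + s * of_real y)" for s :: complex and y :: real
    have nq: "norm (q (Complex c t) y) = exp (c\<^sup>2 / (2 * K\<^sup>2) + c * y) * exp (- t\<^sup>2 / (2 * K\<^sup>2))" for c t y
      unfolding q_def by (rule gaussian_line_bound) (use K in simp)
    define h where "h s = G s * q s Y" for s
    have "(LINT t|lborel. h (Complex 3 t)) = (LINT t|lborel. (LINT v|lborel. f (Complex 3 t) v * q (Complex 3 t) Y))"
      by (simp add: h_def G)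
    also have "\<dots> = (LINT v|lborel. (LINT t|lborel. f (Complex 3 t) v * q (Complex 3 t) Y))"
    proof (rule lborel_pair.Fubini_integral[symmetric], rule lborel_pair.Fubini_integrable)
      show "(\<lambda>(t, v). f (Complex 3 t) v * q (Complex 3 t) Y) \<in> borel_measurable (lborel \<Otimes>\<^sub>M lborel)"
        unfolding f_def q_def Complex_eq by measurable
      have "(LINT v|lborel. norm (f (Complex 3 t) v * q (Complex 3 t) Y))
         = (LINT v|lborel. \<bar>b v\<bar> * exp (- 3 * v)) * (exp (3\<^sup>2 / (2 * K\<^sup>2) + 3 * Y) * exp (- t\<^sup>2 / (2 * K\<^sup>2)))" for t
        by (simp add: norm_mult nf nq)
      moreover have "integrable lborel (\<lambda>t. exp (- t\<^sup>2 / (2 * K\<^sup>2)))"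
      proof -
        have "exp (- t\<^sup>2 / (2 * K\<^sup>2)) = sqrt (2 * pi * K\<^sup>2) * normal_density 0 K t" for t
          using K by (simp add: normal_density_def)
        then show ?thesis using K by simp
      qed
      ultimately show "integrable lborel (\<lambda>t. LINT v|lborel. norm (case (t, v) of (t, v) \<Rightarrow> f (Complex 3 t) v * q (Complex 3 t) Y))"
        by simp
      show "AE t in lborel. integrable lborel (\<lambda>v. case (t, v) of (t, v) \<Rightarrow> f (Complex 3 t) v * q (Complex 3 t) Y)"
        by (rule AE_I2) (simp add: intf)
    qed
    also have "\<dots> = (LINT v|lborel. of_real (2 * pi * (b v * normal_density Y (1 / K) v)))"
    proof (rule Bochner_Integration.integral_cong[OF refl])
      fix v
      have "f (Complex 3 t) v * q (Complex 3 t) Y = of_real (b v) * q (Complex 3 t) (Y - v)" for t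
        by (simp add: f_def q_def mult_exp_exp algebra_simps)
      then have "(LINT t|lborel. f (Complex 3 t) v * q (Complex 3 t) Y) = of_real (b v) * (LINT t|lborel. q (Complex 3 t) (Y - v))"
        by simp
      also have "(LINT t|lborel. q (Complex 3 t) (Y - v)) = of_real (K * sqrt (2 * pi) * exp (- (K * (Y - v))\<^sup>2 / 2))"
        unfolding q_def by (rule gaussian_line_integral) (use K in simp)
      also have "K * sqrt (2 * pi) * exp (- (K * (Y - v))\<^sup>2 / 2) = 2 * pi * normal_density Y (1 / K) v"
      proof -
        have "sqrt (2 * pi * (1 / K)\<^sup>2) = sqrt (2 * pi) / K"
          using K by (simp add: real_sqrt_mult real_sqrt_divide)
        moreover have "- (v - Y)\<^sup>2 / (2 * (1 / K)\<^sup>2) = - (K * (Y - v))\<^sup>2 / 2"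
          using K by (simp add: field_simps power2_eq_square)
        ultimately have "normal_density Y (1 / K) v = K / sqrt (2 * pi) * exp (- (K * (Y - v))\<^sup>2 / 2)"
          by (simp add: normal_density_def)
        moreover have "2 * pi * (K / sqrt (2 * pi)) = K * sqrt (2 * pi)"
          using real_sqrt_mult_self[of "2 * pi"] by (simp add: field_simps)
        ultimately show ?thesis by (metis mult.assoc)
      qed
      finally show "(LINT t|lborel. f (Complex 3 t) v * q (Complex 3 t) Y) = of_real (2 * pi * (b v * normal_density Y (1 / K) v))"
        by (simp add: mult_ac)
    qed
    also have "\<dots> = of_real (2 * pi * (LINT v|lborel. b v * normal_density Y (1 / K) v))"
      unfolding integral_complex_of_real by (simp only: integral_mult_right_zero)
    finally have 1: "(LINT t|lborel. h (Complex 3 t)) = of_real (2 * pi * (LINT v|lborel. b v * normal_density Y (1 / K) v))" .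
    \<comment> \<open>This bound may grow with K and Y, since its purpose is to license the contour
      shift; the quantitative estimate is made on the new line.\<close>
    define Bd where "Bd = D * exp (9 / 2 + 3 * Y) * (2 * K\<^sup>2)"
    have K2: "K\<^sup>2 \<ge> 1" using K by simp
    have hbd: "norm (h s) \<le> Bd / (1 + (Im s)\<^sup>2)" if s: "\<sigma>0 \<le> Re s" "Re s \<le> 3" for s
    proof -
      define c t where "c = Re s" and "t = Im s"
      have sc: "s = Complex c t" by (simp add: c_def t_def)
      have "(1 + \<bar>t\<bar>) powr (\<epsilon> - 1) \<le> 1"
        using powr_mono[of "\<epsilon> - 1" 0 "1 + \<bar>t\<bar>"] \<epsilon> by (auto split: if_splits)
      then have g1: "norm (G s) \<le> D" using bdG[OF s] mult_left_mono[OF _ D0] unfolding t_def[symmetric] by fastforce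
      have "c\<^sup>2 / (2 * K\<^sup>2) \<le> 9 / 2"
      proof -
        have "c\<^sup>2 \<le> 3\<^sup>2" using s \<sigma>0 unfolding c_def by (intro power_mono) auto
        then have "c\<^sup>2 / (2 * K\<^sup>2) \<le> 9 / (2 * 1)" using K2 by (intro frac_le) auto
        then show ?thesis by simp
      qed
      moreover have "c * Y \<le> 3 * Y" using s Y by (intro mult_right_mono) (auto simp: c_def)
      ultimately have g2: "exp (c\<^sup>2 / (2 * K\<^sup>2) + c * Y) \<le> exp (9 / 2 + 3 * Y)" by simp
      have "exp (- t\<^sup>2 / (2 * K\<^sup>2)) \<le> 2 * K\<^sup>2 / (1 + t\<^sup>2)"
      proof -
        have "1 / (2 * K\<^sup>2) \<le> 1 / 1" using K2 by (intro divide_left_mono) auto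
        then have "(1 + t\<^sup>2) / (2 * K\<^sup>2) \<le> 1 + t\<^sup>2 / (2 * K\<^sup>2)" unfolding add_divide_distrib by linarith
        also have "\<dots> \<le> exp (t\<^sup>2 / (2 * K\<^sup>2))" by (rule exp_ge_add_one_self)
        finally have le: "(1 + t\<^sup>2) / (2 * K\<^sup>2) \<le> exp (t\<^sup>2 / (2 * K\<^sup>2))" .
        have "1 + t\<^sup>2 > 0" "2 * K\<^sup>2 > 0" using K2 zero_le_power2[of t] by linarith+
        then have "(1 + t\<^sup>2) / (2 * K\<^sup>2) > 0" by (rule divide_pos_pos)
        from le_imp_inverse_le[OF le this] show ?thesis by (simp add: exp_minus)
      qed
      then have "norm (q s Y) \<le> exp (9 / 2 + 3 * Y) * (2 * K\<^sup>2 / (1 + t\<^sup>2))"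
        unfolding sc nq using g2 by (intro mult_mono) auto
      then have "norm (h s) \<le> D * (exp (9 / 2 + 3 * Y) * (2 * K\<^sup>2 / (1 + t\<^sup>2)))"
        unfolding h_def norm_mult using g1 D0 by (intro mult_mono) auto
      then show ?thesis by (simp add: Bd_def t_def)
    qed
    have hhol: "h holomorphic_on {s. \<sigma>0 \<le> Re s \<and> Re s \<le> 3}"
      unfolding h_def q_def using K by (intro holomorphic_intros hol) auto
    have 2: "(LINT t|lborel. h (Complex \<sigma>0 t)) = (LINT t|lborel. h (Complex 3 t))"
      by (rule vertical_shift[OF hhol _ hbd]) (use \<sigma>0 in auto)
    have pt: "norm (h (Complex \<sigma>0 t)) \<le> D * exp (9 / 2) * exp (\<sigma>0 * Y) * 4 * K powr (2 * \<epsilon>) * (1 + \<bar>t\<bar>) powr (- 1 - \<epsilon>)" for t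
    proof -
      have "\<sigma>0\<^sup>2 / (2 * K\<^sup>2) \<le> 9 / 2"
      proof -
        have "\<sigma>0\<^sup>2 \<le> 3\<^sup>2" using \<sigma>0 by (intro power_mono) auto
        then have "\<sigma>0\<^sup>2 / (2 * K\<^sup>2) \<le> 9 / (2 * 1)" using K2 by (intro frac_le) auto
        then show ?thesis by simp
      qed
      then have "norm (q (Complex \<sigma>0 t) Y) \<le> exp (9 / 2 + \<sigma>0 * Y) * (4 * K powr (2 * \<epsilon>) * (1 + \<bar>t\<bar>) powr (- 2 * \<epsilon>))"
        unfolding nq using exp_minus_le_powr[OF \<epsilon> K, of t] by (intro mult_mono) auto
      then have "norm (h (Complex \<sigma>0 t)) \<le> (D * (1 + \<bar>t\<bar>) powr (\<epsilon> - 1)) * (exp (9 / 2 + \<sigma>0 * Y) * (4 * K powr (2 * \<epsilon>) * (1 + \<bar>t\<bar>) powr (- 2 * \<epsilon>)))"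
        unfolding h_def norm_mult using bdG[of "Complex \<sigma>0 t"] \<sigma>0 D0 by (intro mult_mono) auto
      also have "\<dots> = D * exp (9 / 2) * exp (\<sigma>0 * Y) * 4 * K powr (2 * \<epsilon>) * ((1 + \<bar>t\<bar>) powr (\<epsilon> - 1) * (1 + \<bar>t\<bar>) powr (- 2 * \<epsilon>))"
        by (simp add: exp_add mult_ac)
      also have "(1 + \<bar>t\<bar>) powr (\<epsilon> - 1) * (1 + \<bar>t\<bar>) powr (- 2 * \<epsilon>) = (1 + \<bar>t\<bar>) powr (- 1 - \<epsilon>)"
        by (simp add: powr_add[symmetric] minus_diff_commute)
      finally show ?thesis .
    qed
    have "norm (LINT t|lborel. h (Complex \<sigma>0 t)) \<le> (LINT t|lborel. D * exp (9 / 2) * exp (\<sigma>0 * Y) * 4 * K powr (2 * \<epsilon>) * (1 + \<bar>t\<bar>) powr (- 1 - \<epsilon>))"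
      by (rule norm_lborel_integral_le[OF integrable_vertical_line[OF hhol _ _ hbd] integrable_mult_right[OF intW] pt])
        (use \<sigma>0 in auto)
    also have "\<dots> = D * exp (9 / 2) * exp (\<sigma>0 * Y) * 4 * K powr (2 * \<epsilon>) * W" by (simp add: W_def)
    finally have "norm (LINT t|lborel. h (Complex 3 t)) \<le> D * exp (9 / 2) * exp (\<sigma>0 * Y) * 4 * K powr (2 * \<epsilon>) * W"
      by (simp add: 2)
    then have "2 * pi * \<bar>LINT v|lborel. b v * normal_density Y (1 / K) v\<bar> \<le> D * exp (9 / 2) * exp (\<sigma>0 * Y) * 4 * K powr (2 * \<epsilon>) * W"
      unfolding 1 norm_of_real by (simp add: abs_mult)
    then have "\<bar>LINT v|lborel. b v * normal_density Y (1 / K) v\<bar> \<le> E * K powr (2 * \<epsilon>) * exp (\<sigma>0 * Y)"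
      by (simp add: E_def field_simps)
    then show "\<bar>LINT v|lborel. indicator {0..} v * a v * normal_density Y (1 / K) v\<bar> \<le> E * K powr (2 * \<epsilon>) * exp (\<sigma>0 * Y)"
      by (simp add: b_def)
  qed
qed

text \<open>Exponential tilting: completing the square shifts the mean.\<close>

lemma normal_density_exp:
  assumes "\<sigma> > 0"
  shows "normal_density \<mu> \<sigma> v * exp (\<theta> * (v - \<mu>)) = exp (\<theta>\<^sup>2 * \<sigma>\<^sup>2 / 2) * normal_density (\<mu> + \<theta> * \<sigma>\<^sup>2) \<sigma> v"
proof -
  have "- (v - \<mu>)\<^sup>2 / (2 * \<sigma>\<^sup>2) + \<theta> * (v - \<mu>) = \<theta>\<^sup>2 * \<sigma>\<^sup>2 / 2 + - (v - (\<mu> + \<theta> * \<sigma>\<^sup>2))\<^sup>2 / (2 * \<sigma>\<^sup>2)"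
    using assms by (simp add: field_simps power2_eq_square)
  then have "exp (- (v - \<mu>)\<^sup>2 / (2 * \<sigma>\<^sup>2)) * exp (\<theta> * (v - \<mu>)) = exp (\<theta>\<^sup>2 * \<sigma>\<^sup>2 / 2) * exp (- (v - (\<mu> + \<theta> * \<sigma>\<^sup>2))\<^sup>2 / (2 * \<sigma>\<^sup>2))"
    by (simp only: mult_exp_exp)
  then show ?thesis by (simp add: normal_density_def)
qed

lemma normal_density_mgf:
  assumes "\<sigma> > 0"
  shows "has_bochner_integral lborel (\<lambda>v. normal_density \<mu> \<sigma> v * exp (\<theta> * (v - \<mu>))) (exp (\<theta>\<^sup>2 * \<sigma>\<^sup>2 / 2))"
  unfolding normal_density_exp[OF assms]
  using assms by (simp add: has_bochner_integral_iff)

lemma ln_diff_ge: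
  fixes a t :: real
  assumes "0 < a" "a \<le> t"
  shows "(t - a) / t \<le> ln t - ln a"
proof -
  have "ln (a / t) \<le> a / t - 1" using assms by (intro ln_le_minus_one) auto
  then show ?thesis using assms by (simp add: ln_div field_simps)
qed

text \<open>Within \<delta> of Y no logarithm of an integer is crossed and b varies by at most 1.
  Outside, a Chernoff bound with parameter K works: each of the weights exp (\<plusminus> K (v - Y))
  has expectation exp (1 / 2), and with x = N + 1 the factor exp (- (K - 2) \<delta>), about exp (-
  x^2 / 2), beats exp (2 Y) \<le> x^2 from the growth of b.\<close>

lemma gaussian_local:
  fixes b :: "real \<Rightarrow> real"
  assumes meas: "b \<in> borel_measurable borel" and bd: "\<And>v. \<bar>b v\<bar> \<le> C * exp (2 * \<bar>v\<bar>)"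
    and N: "N \<ge> (1::nat)" and loc: "\<And>v. ln (real N) \<le> v \<Longrightarrow> v < ln (real N + 1) \<Longrightarrow> \<bar>b (ln (real N + 1 / 2)) - b v\<bar> \<le> 1"
    and Y_def: "Y = ln (real N + 1 / 2)" and K_def: "K = (real N + 1) ^ 3"
  shows "\<bar>b Y - (LINT v|lborel. b v * normal_density Y (1 / K) v)\<bar> \<le> 1 + 8 * exp 2 * C"
proof -
  define x where "x = real N + 1"
  have x: "x \<ge> 2" using N by (simp add: x_def)
  have Kx: "K = x ^ 3" by (simp add: K_def x_def)
  have K: "K \<ge> 8"
  proof -
    have "2 ^ 3 \<le> x ^ 3" using x by (intro power_mono) auto
    then show ?thesis by (simp add: Kx)
  qed
  have C0: "C \<ge> 0" using bd[of 0] by simp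
  have Y0: "Y \<ge> 0" using N by (simp add: Y_def)
  \<comment> \<open>A lower bound for the distances from ln (N + 1/2) to ln N and to ln (N +
    1).\<close>
  define \<delta> where "\<delta> = 1 / (2 * x)"
  define \<theta> where "\<theta> = K"
  define W where "W = 2 * C * exp (2 * Y) * exp (- (K - 2) * \<delta>)"
  have W0: "W \<ge> 0" using C0 by (simp add: W_def)
  define nd where "nd v = normal_density Y (1 / K) v" for v
  have nd0: "nd v \<ge> 0" for v by (simp add: nd_def)
  have near: "\<bar>b Y - b v\<bar> \<le> 1" if "\<bar>v - Y\<bar> < \<delta>" for v
  proof -
    have "((real N + 1 / 2) - real N) / (real N + 1 / 2) \<le> ln (real N + 1 / 2) - ln (real N)"
      by (rule ln_diff_ge) (use N in auto)
    moreover have "\<delta> \<le> ((real N + 1 / 2) - real N) / (real N + 1 / 2)"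
      using N by (simp add: \<delta>_def x_def field_simps)
    moreover have "((real N + 1) - (real N + 1 / 2)) / (real N + 1) \<le> ln (real N + 1) - ln (real N + 1 / 2)"
      by (rule ln_diff_ge) auto
    moreover have "\<delta> = ((real N + 1) - (real N + 1 / 2)) / (real N + 1)"
      using N by (simp add: \<delta>_def x_def field_simps)
    ultimately have "ln (real N) \<le> v" "v < ln (real N + 1)" using that unfolding Y_def by linarith+
    then show ?thesis unfolding Y_def by (rule loc)
  qed
  have pt: "\<bar>b Y - b v\<bar> \<le> 1 + W * (exp (\<theta> * (v - Y)) + exp (- \<theta> * (v - Y)))" for v
  proof (cases "\<bar>v - Y\<bar> < \<delta>")
    case True
    have "0 \<le> W * (exp (\<theta> * (v - Y)) + exp (- \<theta> * (v - Y)))" using W0 by (intro mult_nonneg_nonneg add_nonneg_nonneg) auto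
    then show ?thesis using near[OF True] by linarith
  next
    case False
    define \<tau> where "\<tau> = \<bar>v - Y\<bar>"
    have \<tau>: "\<tau> \<ge> \<delta>" using False by (simp add: \<tau>_def)
    have "\<bar>b Y\<bar> \<le> C * exp (2 * Y + 2 * \<tau>)"
      using bd[of Y] Y0 mult_left_mono[of "exp (2 * Y)" "exp (2 * Y + 2 * \<tau>)" C] C0 by (simp add: \<tau>_def)
    moreover have "\<bar>b v\<bar> \<le> C * exp (2 * Y + 2 * \<tau>)"
    proof -
      have "\<bar>v\<bar> \<le> Y + \<tau>" using Y0 unfolding \<tau>_def by linarith
      then have "C * exp (2 * \<bar>v\<bar>) \<le> C * exp (2 * Y + 2 * \<tau>)" using C0 by (intro mult_left_mono) auto
      then show ?thesis using bd[of v] by linarith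
    qed
    ultimately have "\<bar>b Y - b v\<bar> \<le> 2 * C * exp (2 * Y) * exp (2 * \<tau>)" by (simp add: exp_add)
    also have "exp (2 * \<tau>) \<le> exp (- (K - 2) * \<delta>) * exp (\<theta> * \<tau>)"
    proof -
      have "(K - 2) * \<delta> \<le> (K - 2) * \<tau>" using \<tau> K by (intro mult_left_mono) auto
      then show ?thesis unfolding mult_exp_exp \<theta>_def by (simp add: algebra_simps)
    qed
    also have "exp (\<theta> * \<tau>) \<le> exp (\<theta> * (v - Y)) + exp (- \<theta> * (v - Y))"
    proof (cases "v \<ge> Y")
      case False
      then have "\<theta> * \<tau> = - \<theta> * (v - Y)" by (simp add: \<tau>_def algebra_simps)
      then show ?thesis by simp
    qed (simp add: \<tau>_def)
    finally have "\<bar>b Y - b v\<bar> \<le> 2 * C * exp (2 * Y) * (exp (- (K - 2) * \<delta>) * (exp (\<theta> * (v - Y)) + exp (- \<theta> * (v - Y))))"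
      using C0 by (simp add: mult_left_mono)
    then show ?thesis by (simp add: W_def mult_ac)
  qed
  have m1: "has_bochner_integral lborel (\<lambda>v. nd v * exp (\<theta> * (v - Y))) (exp (1 / 2))"
    using normal_density_mgf[of "1 / K" Y \<theta>] K by (simp add: nd_def \<theta>_def power_divide)
  have m2: "has_bochner_integral lborel (\<lambda>v. nd v * exp (- \<theta> * (v - Y))) (exp (1 / 2))"
    using normal_density_mgf[of "1 / K" Y "- \<theta>"] K by (simp add: nd_def \<theta>_def power_divide)
  have m0: "has_bochner_integral lborel nd 1"
    unfolding nd_def[abs_def] using K by (simp add: has_bochner_integral_iff)
  have dom: "has_bochner_integral lborel (\<lambda>v. nd v + W * (nd v * exp (\<theta> * (v - Y)) + nd v * exp (- \<theta> * (v - Y)))) (1 + W * (exp (1 / 2) + exp (1 / 2)))"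
    by (intro has_bochner_integral_add has_bochner_integral_mult_right m0 m1 m2)
  have le: "norm ((b Y - b v) * nd v) \<le> nd v + W * (nd v * exp (\<theta> * (v - Y)) + nd v * exp (- \<theta> * (v - Y)))" for v
  proof -
    have "norm ((b Y - b v) * nd v) = \<bar>b Y - b v\<bar> * nd v" using nd0[of v] by (simp add: abs_mult)
    also have "\<dots> \<le> (1 + W * (exp (\<theta> * (v - Y)) + exp (- \<theta> * (v - Y)))) * nd v"
      using pt nd0 by (intro mult_right_mono)
    also have "\<dots> = nd v + W * (nd v * exp (\<theta> * (v - Y)) + nd v * exp (- \<theta> * (v - Y)))"
      by (simp only: distrib_left distrib_right mult_1_left mult_ac)
    finally show ?thesis .
  qed
  have int: "integrable lborel (\<lambda>v. (b Y - b v) * nd v)"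
  proof (rule Bochner_Integration.integrable_bound[OF integrable.intros[OF dom]])
    show "(\<lambda>v. (b Y - b v) * nd v) \<in> borel_measurable lborel"
      unfolding nd_def using meas by simp
    show "AE v in lborel. norm ((b Y - b v) * nd v) \<le> norm (nd v + W * (nd v * exp (\<theta> * (v - Y)) + nd v * exp (- \<theta> * (v - Y))))"
    proof (rule AE_I2)
      fix v
      show "norm ((b Y - b v) * nd v) \<le> norm (nd v + W * (nd v * exp (\<theta> * (v - Y)) + nd v * exp (- \<theta> * (v - Y))))"
        using order_trans[OF le[of v] abs_ge_self] by (simp only: real_norm_def)
    qed
  qed
  have "norm (LINT v|lborel. (b Y - b v) * nd v) \<le> (LINT v|lborel. nd v + W * (nd v * exp (\<theta> * (v - Y)) + nd v * exp (- \<theta> * (v - Y))))"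
    by (rule norm_lborel_integral_le[OF int integrable.intros[OF dom] le])
  also have "\<dots> = 1 + W * (exp (1 / 2) + exp (1 / 2))" by (rule has_bochner_integral_integral_eq[OF dom])
  finally have 1: "\<bar>LINT v|lborel. (b Y - b v) * nd v\<bar> \<le> 1 + W * (exp (1 / 2) + exp (1 / 2))" by simp
  have intnd: "integrable lborel (\<lambda>v. b Y * nd v)" using m0 by (simp add: has_bochner_integral_iff)
  have "(\<lambda>v. b v * nd v) = (\<lambda>v. b Y * nd v - (b Y - b v) * nd v)" by (auto simp: algebra_simps)
  then have "(LINT v|lborel. b v * nd v) = (LINT v|lborel. b Y * nd v) - (LINT v|lborel. (b Y - b v) * nd v)"
    using Bochner_Integration.integral_diff[OF intnd int] by simp
  also have "(LINT v|lborel. b Y * nd v) = b Y" using m0 by (simp add: has_bochner_integral_iff)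
  finally have 2: "b Y - (LINT v|lborel. b v * nd v) = (LINT v|lborel. (b Y - b v) * nd v)" by simp
  have W: "W \<le> 4 * exp 1 * C"
  proof -
    have "exp Y = real N + 1 / 2" using N by (simp add: Y_def)
    then have "exp Y \<le> x" by (simp add: x_def)
    then have "exp Y ^ 2 \<le> x ^ 2" by (intro power_mono) auto
    then have e2: "exp (2 * Y) \<le> x\<^sup>2" by (simp add: exp_double)
    define y where "y = x\<^sup>2 / 2"
    have "(K - 2) * \<delta> = y - 1 / x" using x by (simp add: \<delta>_def Kx y_def field_simps power2_eq_square power3_eq_cube)
    moreover have "1 / x \<le> 1" using x by simp
    ultimately have "- (K - 2) * \<delta> \<le> 1 - y" by linarith
    then have "exp (- (K - 2) * \<delta>) \<le> exp (1 - y)" by (simp only: exp_le_cancel_iff)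
    moreover have "y \<le> exp y" using exp_ge_add_one_self[of y] by linarith
    ultimately have "exp (2 * Y) * exp (- (K - 2) * \<delta>) \<le> (2 * y) * exp (1 - y)"
      using e2 by (intro mult_mono) (auto simp: y_def)
    also have "\<dots> \<le> (2 * exp y) * exp (1 - y)" using \<open>y \<le> exp y\<close> by (intro mult_right_mono) auto
    also have "\<dots> = 2 * exp 1" by (simp add: mult.assoc mult_exp_exp)
    finally have "2 * C * (exp (2 * Y) * exp (- (K - 2) * \<delta>)) \<le> 2 * C * (2 * exp 1)" using C0 by (intro mult_left_mono) auto
    then show ?thesis by (simp add: W_def mult_ac)
  qed
  have "W * (exp (1 / 2) + exp (1 / 2)) \<le> (4 * exp 1 * C) * (exp 1 + exp 1)"
    using W W0 C0 by (intro mult_mono add_mono) auto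
  also have "\<dots> = 8 * (exp 1 * exp 1) * C" by simp
  also have "exp 1 * exp 1 = exp (2::real)" by (simp add: mult_exp_exp)
  finally show ?thesis using 1 unfolding nd_def[symmetric] 2 by linarith
qed

text \<open>The Gaussian is centred at \<open>ln (N + 1 / 2)\<close> and has width \<open>(N + 1) ^ (- 3)\<close>, so it sees only the
  interval between the jumps at \<open>ln N\<close> and \<open>ln (N + 1)\<close>; this costs the exponent \<open>6 \<epsilon>\<close>.\<close>

lemma tauberian:
  fixes a :: "real \<Rightarrow> real"
  assumes meas: "a \<in> borel_measurable borel" and bd: "\<And>v. v \<ge> 0 \<Longrightarrow> \<bar>a v\<bar> \<le> C * exp (2 * v)"
    and loc: "\<And>v w. 0 \<le> v \<Longrightarrow> 0 \<le> w \<Longrightarrow> \<lfloor>exp v\<rfloor> = \<lfloor>exp w\<rfloor> \<Longrightarrow> \<bar>a v - a w\<bar> \<le> 1"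
    and hol: "G holomorphic_on {s. \<sigma>0 \<le> Re s \<and> Re s \<le> 3}" and \<sigma>0: "0 < \<sigma>0" "\<sigma>0 < 3"
    and lap: "\<And>s. Re s = 3 \<Longrightarrow> ((\<lambda>L. laplace a L s) \<longlongrightarrow> G s) at_top"
    and bdG: "\<And>s. \<sigma>0 \<le> Re s \<Longrightarrow> Re s \<le> 3 \<Longrightarrow> norm (G s) \<le> D * (1 + \<bar>Im s\<bar>) powr (\<epsilon> - 1)"
    and \<epsilon>: "0 < \<epsilon>" "\<epsilon> \<le> 1"
  obtains E where "\<And>v. v \<ge> 0 \<Longrightarrow> \<bar>a v\<bar> \<le> E * exp ((\<sigma>0 + 6 * \<epsilon>) * v)"
proof -
  obtain F where F: "\<And>K Y. K \<ge> 1 \<Longrightarrow> Y \<ge> 0 \<Longrightarrow>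
     \<bar>LINT v|lborel. indicator {0..} v * a v * normal_density Y (1 / K) v\<bar> \<le> F * K powr (2 * \<epsilon>) * exp (\<sigma>0 * Y)"
    using tauberian_gaussian[OF meas bd hol \<sigma>0 lap bdG \<epsilon>] by blast
  define b where "b v = indicator {0..} v * a v" for v
  have C0: "C \<ge> 0" using bd[of 0] by simp
  define F' where "F' = \<bar>F\<bar>"
  define E0 where "E0 = 2 + 8 * exp 2 * C"
  define \<theta> where "\<theta> = \<sigma>0 + 6 * \<epsilon>"
  have \<theta>: "\<theta> > 0" using \<sigma>0 \<epsilon> by (simp add: \<theta>_def)
  show thesis
  proof (rule that[of "E0 + F' * 2 powr \<theta>"])
    fix v :: real assume v: "v \<ge> 0"
    define N where "N = nat \<lfloor>exp v\<rfloor>"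
    have N: "N \<ge> 1" unfolding N_def using nat_floor_exp(1)[OF v] by linarith
    have fl: "\<lfloor>exp v\<rfloor> = int N" using v by (simp add: N_def)
    have Nle: "real N \<le> exp v" unfolding N_def using v by simp
    define Y where "Y = ln (real N + 1 / 2)"
    define K where "K = (real N + 1) ^ 3"
    have Y0: "Y \<ge> 0" using N by (simp add: Y_def)
    have flY: "\<lfloor>exp Y\<rfloor> = int N" unfolding Y_def using N by (simp add: floor_eq_iff)
    have K1: "K \<ge> 1" by (simp add: K_def)
    have "\<bar>b Y - (LINT v|lborel. b v * normal_density Y (1 / K) v)\<bar> \<le> 1 + 8 * exp 2 * C"
    proof (rule gaussian_local[OF _ _ N _ Y_def K_def])
      show "b \<in> borel_measurable borel" unfolding b_def[abs_def] by (intro borel_measurable_times borel_measurable_indicator meas) simp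
      show "\<bar>b v\<bar> \<le> C * exp (2 * \<bar>v\<bar>)" for v
        using bd[of v] C0 by (cases "v \<ge> 0") (auto simp: b_def)
      fix w assume w: "ln (real N) \<le> w" "w < ln (real N + 1)"
      have w0: "w \<ge> 0" using w N ln_ge_zero[of "real N"] by linarith
      have "exp (ln (real N)) \<le> exp w" using w(1) by (simp only: exp_le_cancel_iff)
      moreover have "exp w < exp (ln (real N + 1))" using w(2) by (simp only: exp_less_cancel_iff)
      ultimately have "\<lfloor>exp w\<rfloor> = int N" using N by (simp add: floor_eq_iff)
      then have "\<bar>a Y - a w\<bar> \<le> 1" using flY by (intro loc Y0 w0) auto
      then show "\<bar>b (ln (real N + 1 / 2)) - b w\<bar> \<le> 1" using Y0 w0 by (simp add: b_def flip: Y_def)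
    qed
    moreover have "\<bar>LINT v|lborel. b v * normal_density Y (1 / K) v\<bar> \<le> F * K powr (2 * \<epsilon>) * exp (\<sigma>0 * Y)"
      unfolding b_def by (rule F[OF K1 Y0])
    moreover have "\<bar>a v - a Y\<bar> \<le> 1" using fl flY by (intro loc v Y0) auto
    moreover have "b Y = a Y" using Y0 by (simp add: b_def)
    ultimately have "\<bar>a v\<bar> \<le> E0 + F * K powr (2 * \<epsilon>) * exp (\<sigma>0 * Y)" unfolding E0_def by linarith
    also have "F * K powr (2 * \<epsilon>) * exp (\<sigma>0 * Y) \<le> F' * ((real N + 1) powr (6 * \<epsilon>) * (real N + 1) powr \<sigma>0)"
    proof -
      have "K powr (2 * \<epsilon>) = (real N + 1) powr (6 * \<epsilon>)"
      proof -
        have "K = (real N + 1) powr 3" by (simp add: K_def powr_numeral)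
        then show ?thesis by (simp only: powr_powr) simp
      qed
      moreover have "exp (\<sigma>0 * Y) \<le> (real N + 1) powr \<sigma>0"
      proof -
        have "exp (\<sigma>0 * Y) = (real N + 1 / 2) powr \<sigma>0" by (simp add: powr_def Y_def)
        also have "\<dots> \<le> (real N + 1) powr \<sigma>0" using \<sigma>0 by (intro powr_mono2) auto
        finally show ?thesis .
      qed
      ultimately show ?thesis unfolding mult.assoc F'_def by (intro mult_mono) auto
    qed
    also have "(real N + 1) powr (6 * \<epsilon>) * (real N + 1) powr \<sigma>0 = (real N + 1) powr \<theta>" by (simp add: \<theta>_def powr_add[symmetric] add.commute)
    also have "\<dots> \<le> (2 * exp v) powr \<theta>" using Nle N \<theta> v by (intro powr_mono2) (auto intro: order_trans[of _ "exp v + exp v"] add_mono)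
    also have "\<dots> = 2 powr \<theta> * exp (\<theta> * v)" by (simp add: powr_mult exp_powr_real mult.commute)
    also have "E0 \<le> E0 * exp (\<theta> * v)"
      using mult_left_mono[of 1 "exp (\<theta> * v)" E0] \<theta> v C0 by (simp add: E0_def)
    finally have "\<bar>a v\<bar> \<le> E0 * exp (\<theta> * v) + F' * (2 powr \<theta> * exp (\<theta> * v))" by (simp add: F'_def mult_left_mono)
    then show "\<bar>a v\<bar> \<le> (E0 + F' * 2 powr \<theta>) * exp ((\<sigma>0 + 6 * \<epsilon>) * v)" by (simp add: \<theta>_def algebra_simps)
  qed
qed

section \<open>A zero of \<open>\<zeta>\<close>\<close>

text \<open>Repeated integration by parts against p0 = x^2 (1 - x)^2 / 24, which is (B_4(x) - B_4) /
  24 in terms of the Bernoulli polynomial. p0 and p1 vanish at both ends of [0, 1], p2 equals 1 / 12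
  there and p3 equals - 1 / 2 and 1 / 2; these are the coefficients of the correction.\<close>

lemma euler_maclaurin_step:
  assumes n: "n > 0" and s: "Re s > 0" "s \<noteq> 1"
  shows "norm (zterm n s / (s - 1) - ((cpow n (-s) - cpow (Suc n) (-s)) / 2 + s * (cpow n (-s - 1) - cpow (Suc n) (-s - 1)) / 12))
     \<le> norm (s * (s + 1) * (s + 2) * (s + 3)) / 720 * real n powr (- Re s - 4)"
proof -
  define p0 p1 p2 p3 where "p0 x = (x\<^sup>2 - 2 * x ^ 3 + x ^ 4) / 24" and "p1 x = (2 * x - 6 * x\<^sup>2 + 4 * x ^ 3) / 24"
    and "p2 x = (2 - 12 * x + 12 * x\<^sup>2) / 24" and "p3 x = (24 * x - 12) / 24" for x :: real
  define c1 c2 c3 c4 where "c1 = - s" and "c2 = s * (s + 1)" and "c3 = - (s * (s + 1) * (s + 2))" and "c4 = s * (s + 1) * (s + 2) * (s + 3)"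
  define F where "F u = of_real (p0 (u - real n)) * (c3 * cpow u (-s - 3)) - of_real (p1 (u - real n)) * (c2 * cpow u (-s - 2))
      + of_real (p2 (u - real n)) * (c1 * cpow u (-s - 1)) - of_real (p3 (u - real n)) * cpow u (-s) + cpow u (1 - s) / (1 - s)" for u :: real
  define I where "I = {real n..real (Suc n)}"
  have der: "(F has_vector_derivative of_real (p0 (u - real n)) * (c4 * cpow u (-s - 4))) (at u within I)" if u: "u \<in> I" for u
  proof -
    have u0: "u > 0" using u n by (auto simp: I_def)
    have d0: "((\<lambda>u. complex_of_real (p0 (u - real n))) has_vector_derivative of_real (p1 (u - real n))) (at u within I)"
      unfolding p0_def p1_def
      by (intro has_vector_derivative_of_real) (auto intro!: derivative_eq_intros simp: has_real_derivative_iff_has_vector_derivative[symmetric] field_simps power2_eq_square power3_eq_cube)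
    have d1: "((\<lambda>u. complex_of_real (p1 (u - real n))) has_vector_derivative of_real (p2 (u - real n))) (at u within I)"
      unfolding p1_def p2_def
      by (intro has_vector_derivative_of_real) (auto intro!: derivative_eq_intros simp: has_real_derivative_iff_has_vector_derivative[symmetric] field_simps power2_eq_square power3_eq_cube)
    have d2: "((\<lambda>u. complex_of_real (p2 (u - real n))) has_vector_derivative of_real (p3 (u - real n))) (at u within I)"
      unfolding p2_def p3_def
      by (intro has_vector_derivative_of_real) (auto intro!: derivative_eq_intros simp: has_real_derivative_iff_has_vector_derivative[symmetric] field_simps power2_eq_square power3_eq_cube)
    have d3: "((\<lambda>u. complex_of_real (p3 (u - real n))) has_vector_derivative 1) (at u within I)"
      unfolding p3_def using has_vector_derivative_of_real[of "\<lambda>u. (24 * (u - real n) - 12) / 24" 1 "at u within I"]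
      by (auto intro!: derivative_eq_intros simp: has_real_derivative_iff_has_vector_derivative[symmetric])
    note e = cpow_has_vector_derivative[OF u0]
    have e5: "((\<lambda>u. cpow u (1 - s) / (1 - s)) has_vector_derivative cpow u (-s)) (at u within I)"
      using has_vector_derivative_divide[OF e[of "1 - s"], of "1 - s"] s by simp
    have "(F has_vector_derivative (of_real (p0 (u - real n)) * (c3 * ((-s - 3) * cpow u (-s - 3 - 1))) + of_real (p1 (u - real n)) * (c3 * cpow u (-s - 3)))
       - (of_real (p1 (u - real n)) * (c2 * ((-s - 2) * cpow u (-s - 2 - 1))) + of_real (p2 (u - real n)) * (c2 * cpow u (-s - 2)))
       + (of_real (p2 (u - real n)) * (c1 * ((-s - 1) * cpow u (-s - 1 - 1))) + of_real (p3 (u - real n)) * (c1 * cpow u (-s - 1)))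
       - (of_real (p3 (u - real n)) * ((-s) * cpow u (-s - 1)) + 1 * cpow u (-s))
       + cpow u (-s)) (at u within I)"
      unfolding F_def
      by (intro has_vector_derivative_add has_vector_derivative_diff has_vector_derivative_mult d0 d1 d2 d3 has_vector_derivative_mult_right e5 e)
    moreover have "-s - 3 - 1 = -s - 4" "-s - 2 - 1 = -s - 3" "-s - 1 - 1 = -s - 2" "1 - s - 1 = -s" by auto
    ultimately show ?thesis using s by (simp add: c1_def c2_def c3_def c4_def algebra_simps)
  qed
  have int: "((\<lambda>u. of_real (p0 (u - real n)) * (c4 * cpow u (-s - 4))) has_integral F (Suc n) - F n) I"
    unfolding I_def by (rule fundamental_theorem_of_calculus) (use der in \<open>auto simp: I_def\<close>)
  \<comment> \<open>P is a primitive of p0, and P 1 = 1 / 720 is the constant of the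
    remainder.\<close>
  define P where "P x = (x ^ 3 / 3 - x ^ 4 / 2 + x ^ 5 / 5) / 24" for x :: real
  have int2: "((\<lambda>u. p0 (u - real n) * (norm c4 * real n powr (- Re s - 4))) has_integral (P (real (Suc n) - real n) * (norm c4 * real n powr (- Re s - 4)) - P (real n - real n) * (norm c4 * real n powr (- Re s - 4)))) I"
    unfolding I_def
  proof (rule fundamental_theorem_of_calculus)
    fix u :: real
    have "((\<lambda>u. P (u - real n)) has_real_derivative p0 (u - real n)) (at u within {real n..real (Suc n)})"
      unfolding P_def p0_def by (auto intro!: derivative_eq_intros simp: field_simps)
    then show "((\<lambda>u. P (u - real n) * (norm c4 * real n powr (- Re s - 4))) has_vector_derivative p0 (u - real n) * (norm c4 * real n powr (- Re s - 4))) (at u within {real n..real (Suc n)})"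
      unfolding has_real_derivative_iff_has_vector_derivative[symmetric] by (rule DERIV_cmult_right)
  qed auto
  have "norm (integral I (\<lambda>u. of_real (p0 (u - real n)) * (c4 * cpow u (-s - 4)))) \<le> integral I (\<lambda>u. p0 (u - real n) * (norm c4 * real n powr (- Re s - 4)))"
  proof (rule integral_norm_bound_integral)
    fix u assume u: "u \<in> I"
    then have u0: "u > 0" "u \<ge> real n" using n by (auto simp: I_def)
    have pe: "p0 (u - real n) = (u - real n)\<^sup>2 * (1 - (u - real n))\<^sup>2 / 24" by (simp add: p0_def power2_eq_square power3_eq_cube power4_eq_xxxx algebra_simps)
    have "p0 (u - real n) \<ge> 0" unfolding pe by (intro divide_nonneg_nonneg mult_nonneg_nonneg zero_le_power2) simp
    moreover have "norm (cpow u (-s - 4)) \<le> real n powr (- Re s - 4)"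
      using u0 n s by (simp add: norm_cpow powr_mono2')
    ultimately show "norm (of_real (p0 (u - real n)) * (c4 * cpow u (-s - 4))) \<le> p0 (u - real n) * (norm c4 * real n powr (- Re s - 4))"
      by (simp add: norm_mult mult_left_mono)
  qed (use int int2 in auto)
  then have "norm (F (Suc n) - F n) \<le> norm c4 / 720 * real n powr (- Re s - 4)"
    unfolding integral_unique[OF int] integral_unique[OF int2] by (simp add: P_def)
  moreover have "zterm n s / (s - 1) - ((cpow n (-s) - cpow (Suc n) (-s)) / 2 + s * (cpow n (-s - 1) - cpow (Suc n) (-s - 1)) / 12) = - (F (Suc n) - F n)"
  proof -
    have "zterm n s / (s - 1) = cpow n (-s) - (cpow (Suc n) (1 - s) - cpow n (1 - s)) / (1 - s)"
      using s by (simp add: zterm_def field_simps)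
    then show ?thesis
      by (simp add: F_def p0_def p1_def p2_def p3_def c1_def diff_divide_distrib add_divide_distrib algebra_simps)
  qed
  ultimately show ?thesis by (simp add: c4_def norm_minus_commute)
qed

text \<open>The boundary terms of consecutive steps telescope through Q, so beyond M only fourth
  order remainders are summed. The sum stops at M while the correction sits at M + 1; the term M + 1
  thus enters with its weight 1 / 2 inside the correction.\<close>

lemma zet_euler_maclaurin:
  assumes M: "M > 0" and s: "Re s > 0" "s \<noteq> 1"
  shows "norm (zet s - ((\<Sum>n\<in>{1..M}. cpow (real n) (-s)) + cpow (Suc M) (-s) * (of_nat (Suc M) / (s - 1) + 1 / 2 + s / (12 * of_nat (Suc M)))))
     \<le> norm (s * (s + 1) * (s + 2) * (s + 3)) / 720 * (real M powr (- Re s - 3) / (Re s + 3))"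
proof -
  define Q where "Q n = cpow n (-s) / 2 + s * cpow n (-s - 1) / 12" for n :: nat
  define d where "d n = zterm n s / (s - 1) - (Q n - Q (Suc n))" for n
  define C where "C = norm (s * (s + 1) * (s + 2) * (s + 3)) / 720"
  define \<tau> where "\<tau> = Re s + 3"
  have \<tau>: "\<tau> > 0" using s by (simp add: \<tau>_def)
  define b where "b n = C * ((real (n + M) powr (- \<tau>) - real (Suc n + M) powr (- \<tau>)) / \<tau>)" for n
  have "(\<lambda>n. real n powr (- \<tau>)) \<longlonglongrightarrow> 0"
    by (rule tendsto_neg_powr[OF _ filterlim_real_sequentially]) (use \<tau> in simp)
  then have lim: "(\<lambda>n. real (n + M) powr (- \<tau>)) \<longlonglongrightarrow> 0" by (rule LIMSEQ_ignore_initial_segment)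
  have b: "b sums (C * ((real (0 + M) powr (- \<tau>) - 0) / \<tau>))"
    unfolding b_def by (intro sums_mult sums_divide telescope_sums'[OF lim])
  have le: "norm (d (Suc (n + M))) \<le> b n" for n
  proof -
    have "d (Suc (n + M)) = zterm (Suc (n + M)) s / (s - 1) - ((cpow (Suc (n + M)) (-s) - cpow (Suc (Suc (n + M))) (-s)) / 2 + s * (cpow (Suc (n + M)) (-s - 1) - cpow (Suc (Suc (n + M))) (-s - 1)) / 12)"
      by (simp add: d_def Q_def algebra_simps diff_divide_distrib)
    then have "norm (d (Suc (n + M))) \<le> C * real (Suc (n + M)) powr (- Re s - 4)"
      unfolding C_def by (simp only: euler_maclaurin_step[OF zero_less_Suc s])
    also have "- Re s - 4 = - \<tau> - 1" by (simp add: \<tau>_def)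
    also have "C * real (Suc (n + M)) powr (- \<tau> - 1) \<le> b n"
      unfolding b_def using powr_telescope[of "Suc (n + M)" \<tau>] M \<tau>
      by (intro mult_left_mono) (auto simp: C_def)
    finally show ?thesis .
  qed
  have "(\<lambda>n. Q (Suc (n + M))) \<longlonglongrightarrow> 0"
  proof -
    have c: "(\<lambda>n. cpow (real n) w) \<longlonglongrightarrow> 0" if "Re w < 0" for w
    proof -
      have "(\<lambda>n. real n powr Re w) \<longlonglongrightarrow> 0"
        by (rule tendsto_neg_powr[OF that filterlim_real_sequentially])
      then show ?thesis
        by (rule Lim_null_comparison[rotated]) (auto intro!: eventually_sequentiallyI[of 1] simp: norm_cpow)
    qed
    have "Q \<longlonglongrightarrow> 0 / 2 + s * 0 / 12"
      unfolding Q_def by (intro tendsto_intros c) (use s in auto)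
    then have "(\<lambda>n. Q (n + Suc M)) \<longlonglongrightarrow> 0" using LIMSEQ_ignore_initial_segment by fastforce
    then show ?thesis by simp
  qed
  then have lim: "(\<lambda>n. Q (Suc (n + M))) \<longlonglongrightarrow> 0" .
  have "(\<lambda>n. Q (Suc (n + M)) - Q (Suc (Suc n + M))) sums (Q (Suc (0 + M)) - 0)"
    by (rule telescope_sums'[OF lim])
  then have sQ: "(\<lambda>n. Q (Suc (n + M)) - Q (Suc (Suc (n + M)))) sums Q (Suc M)" by simp
  have sz: "summable (\<lambda>n. zterm (Suc (n + M)) s / (s - 1))"
    using summable_zterm[OF s(1)] summable_iff_shift[of "\<lambda>n. zterm (Suc n) s" M] by (intro summable_divide) simp
  have "(\<Sum>n. zterm (Suc n) s) = (\<Sum>n. zterm (Suc (n + M)) s) + (\<Sum>n<M. zterm (Suc n) s)"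
    by (rule suminf_split_initial_segment[OF summable_zterm[OF s(1)]])
  then have Zeq: "Z s = (s - 1) * (\<Sum>n\<in>{1..M}. cpow (real n) (-s)) + cpow (Suc M) (1 - s) + (\<Sum>n. zterm (Suc (n + M)) s)"
    by (simp add: Z_def sum_zterm)
  have "summable (\<lambda>n. zterm (Suc (n + M)) s)"
    using summable_zterm[OF s(1)] summable_iff_shift[of "\<lambda>n. zterm (Suc n) s" M] by simp
  from suminf_divide[OF this, of "s - 1"]
  have "(\<Sum>n. zterm (Suc (n + M)) s) / (s - 1) = (\<Sum>n. zterm (Suc (n + M)) s / (s - 1))" by simp
  also have "\<dots> = (\<Sum>n. d (Suc (n + M)) + (Q (Suc (n + M)) - Q (Suc (Suc (n + M)))))" by (simp add: d_def)
  also have "\<dots> = (\<Sum>n. d (Suc (n + M))) + Q (Suc M)"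
  proof -
    have "summable (\<lambda>n. d (Suc (n + M)))"
      unfolding d_def by (intro summable_diff sz sums_summable[OF sQ])
    then show ?thesis using suminf_add[OF _ sums_summable[OF sQ]] sums_unique[OF sQ] by simp
  qed
  finally have tail: "(\<Sum>n. zterm (Suc (n + M)) s) / (s - 1) = (\<Sum>n. d (Suc (n + M))) + Q (Suc M)" .
  have q1: "cpow (Suc M) (1 - s) = of_nat (Suc M) * cpow (Suc M) (-s)"
    using cpow_add[of "Suc M" 1 "-s"] by (simp add: cpow_one_right del: of_nat_Suc)
  have q2: "cpow (Suc M) (-s - 1) = cpow (Suc M) (-s) / of_nat (Suc M)"
    using cpow_add[of "Suc M" "-s - 1" 1] by (simp add: cpow_one_right del: of_nat_Suc)
  have "zet s = (\<Sum>n\<in>{1..M}. cpow (real n) (-s)) + cpow (Suc M) (1 - s) / (s - 1) + (\<Sum>n. zterm (Suc (n + M)) s) / (s - 1)"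
    unfolding zet_def Zeq using s by (simp add: add_divide_distrib del: of_nat_Suc)
  also have "\<dots> = ((\<Sum>n\<in>{1..M}. cpow (real n) (-s)) + cpow (Suc M) (-s) * (of_nat (Suc M) / (s - 1) + 1 / 2 + s / (12 * of_nat (Suc M)))) + (\<Sum>n. d (Suc (n + M)))"
    unfolding tail Q_def q1 q2 by (simp add: algebra_simps del: of_nat_Suc)
  finally have "zet s - ((\<Sum>n\<in>{1..M}. cpow (real n) (-s)) + cpow (Suc M) (-s) * (of_nat (Suc M) / (s - 1) + 1 / 2 + s / (12 * of_nat (Suc M)))) = (\<Sum>n. d (Suc (n + M)))"
    by simp
  also have "norm \<dots> \<le> (\<Sum>n. b n)" by (rule norm_suminf_le[OF le sums_summable[OF b]])
  also have "\<dots> = C * (real M powr (- \<tau>) / \<tau>)" using sums_unique[OF b] by simp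
  finally show ?thesis by (simp add: C_def \<tau>_def)
qed

section \<open>Decimal values of n^(- s0)\<close>

lemma cis_approx:
  assumes x: "\<bar>x\<bar> \<le> 4 / 5"
  shows "norm (cis x - Complex (1 - x\<^sup>2 / 2 + x ^ 4 / 24 - x ^ 6 / 720) (x - x ^ 3 / 6 + x ^ 5 / 120 - x ^ 7 / 5040)) \<le> 1 / 20000"
proof -
  have "norm (exp (\<i> * of_real x) - (\<Sum>k\<le>7. (\<i> * of_real x) ^ k / fact k)) \<le> exp \<bar>Re (\<i> * of_real x)\<bar> * norm (\<i> * of_real x) ^ Suc 7 / fact 7"
    by (rule Taylor_exp)
  also have "\<dots> = \<bar>x\<bar> ^ 8 / 5040" by (simp add: norm_mult fact_numeral)
  also have "\<dots> \<le> (4 / 5) ^ 8 / 5040" using x by (intro divide_right_mono power_mono) auto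
  also have "\<dots> \<le> 1 / 20000" by (simp add: power_divide)
  also have "exp (\<i> * of_real x) = cis x" by (simp add: cis_conv_exp)
  also have "(\<Sum>k\<le>7. (\<i> * of_real x) ^ k / fact k) = Complex (1 - x\<^sup>2 / 2 + x ^ 4 / 24 - x ^ 6 / 720) (x - x ^ 3 / 6 + x ^ 5 / 120 - x ^ 7 / 5040)"
    by (simp add: complex_eq_iff power_mult_distrib eval_nat_numeral fact_numeral algebra_simps)
  finally show ?thesis .
qed

text \<open>The ratios 3/2, 5/4 and 7/4 are closer to 1, where the logarithm series converges
  faster; ln 2, computed with the most terms, converts them to ln 3, ln 5 and ln 7.\<close>

lemma ln_approx_small_primes:
  "\<bar>ln 2 - 693147 / 1000000\<bar> \<le> (1 / 100000 :: real)" "\<bar>ln 3 - 1098612 / 1000000\<bar> \<le> (1 / 100000 :: real)"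
  "\<bar>ln 5 - 1609438 / 1000000\<bar> \<le> (1 / 100000 :: real)" "\<bar>ln 7 - 1945910 / 1000000\<bar> \<le> (1 / 100000 :: real)"
proof -
  have a: "ln 2 \<in> {693146/1000000..693148/1000000 :: real}"
    using ln_approx_bounds[of 2 7] by (simp add: eval_nat_numeral)
  have b: "ln (3/2) \<in> {405464/1000000..405466/1000000 :: real}"
    using ln_approx_bounds[of "3/2" 4] by (simp add: eval_nat_numeral)
  have c: "ln (5/4) \<in> {223142/1000000..223145/1000000 :: real}"
    using ln_approx_bounds[of "5/4" 3] by (simp add: eval_nat_numeral)
  have d: "ln (7/4) \<in> {559614/1000000..559617/1000000 :: real}"
    using ln_approx_bounds[of "7/4" 6] by (simp add: eval_nat_numeral)
  have "ln (3/2) = ln 3 - ln (2::real)" "ln (5/4) = ln 5 - ln (4::real)" "ln (7/4) = ln 7 - ln (4::real)" by (simp_all add: ln_div)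
  moreover have "ln 4 = 2 * ln (2::real)" using ln_realpow[of 2 2] by simp
  ultimately have *: "ln (3/2) = ln 3 - ln (2::real)" "ln (5/4) = ln 5 - 2 * ln (2::real)" "ln (7/4) = ln 7 - 2 * ln (2::real)" by simp_all
  show "\<bar>ln 2 - 693147 / 1000000\<bar> \<le> (1 / 100000 :: real)" using a unfolding atLeastAtMost_iff by linarith
  show "\<bar>ln 3 - 1098612 / 1000000\<bar> \<le> (1 / 100000 :: real)" using a b * unfolding atLeastAtMost_iff by linarith
  show "\<bar>ln 5 - 1609438 / 1000000\<bar> \<le> (1 / 100000 :: real)" using a c * unfolding atLeastAtMost_iff by linarith
  show "\<bar>ln 7 - 1945910 / 1000000\<bar> \<le> (1 / 100000 :: real)" using a d * unfolding atLeastAtMost_iff by linarith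
qed

text \<open>The first zero of \<open>\<zeta>\<close> is \<open>1/2 + 14.1347\<dots> i\<close>.\<close>

definition s0 :: complex where "s0 = Complex (1 / 2) (1413 / 100)"

lemma norm_diff_add_le:
  fixes a b c :: complex
  assumes "norm a \<le> e1" "norm b \<le> e2" "norm c \<le> e3"
  shows "norm (a - b + c) \<le> e1 + e2 + e3"
  using assms norm_triangle_ineq[of "a - b" c] norm_triangle_ineq4[of a b] by linarith

text \<open>The angle \<open>14.13 ln p\<close> is reduced by an odd multiple \<open>j\<close> of \<open>pi\<close> to a small \<open>x\<close>; \<open>q\<close> approximates \<open>p powr (- 1 / 2)\<close>.\<close>

lemma cpow_prime_approx:
  fixes x q X Y :: real and j :: nat
  assumes p: "p > 0" and j: "odd j" and l: "\<bar>ln p - l\<bar> \<le> 1 / 100000"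
    and x: "\<bar>1413 / 100 * l - j * (31415926 / 10000000) - x\<bar> \<le> 9 / 100000" "\<bar>x\<bar> \<le> 4 / 5"
    and j9: "j \<le> 9"
    and q: "q > 0" "q \<le> 1" "\<bar>1 / p - q\<^sup>2\<bar> \<le> q / 10000"
    and X: "\<bar>q * (1 - x\<^sup>2 / 2 + x ^ 4 / 24 - x ^ 6 / 720) + X\<bar> \<le> 1 / 20000"
    and Y: "\<bar>q * (x - x ^ 3 / 6 + x ^ 5 / 120 - x ^ 7 / 5040) - Y\<bar> \<le> 1 / 20000"
  shows "norm (cpow p (- s0) - Complex X Y) \<le> 1 / 2000"
proof -
  define y where "y = p powr (- 1 / 2)"
  define \<phi> where "\<phi> = 1413 / 100 * ln p - j * pi"
  define T where "T = Complex (1 - x\<^sup>2 / 2 + x ^ 4 / 24 - x ^ 6 / 720) (- (x - x ^ 3 / 6 + x ^ 5 / 120 - x ^ 7 / 5040))"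
  have y0: "y > 0" using p by (simp add: y_def)
  have "y * y = p powr (- 1 / 2 + - 1 / 2)" unfolding y_def by (rule powr_add[symmetric])
  also have "\<dots> = 1 / p" using p by (simp add: powr_minus_divide)
  finally have y2: "y * y = 1 / p" .
  \<comment> \<open>The irrational y = p^(- 1/2) is compared with q through the squares, which are
    rational.\<close>
  have "(y - q) * (y + q) = 1 / p - q\<^sup>2" using y2 by (simp add: algebra_simps power2_eq_square)
  then have "\<bar>y - q\<bar> * (y + q) \<le> q / 10000" using q y0 by (metis abs_mult abs_of_pos add_pos_pos)
  moreover have "\<bar>y - q\<bar> * q \<le> \<bar>y - q\<bar> * (y + q)" using y0 by (intro mult_left_mono) auto
  ultimately have "\<bar>y - q\<bar> * q \<le> (1 / 10000) * q" by simp
  then have yq: "\<bar>y - q\<bar> \<le> 1 / 10000" using q(1) by (simp only: mult_le_cancel_right_pos)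
  have pi: "\<bar>pi - 31415926 / 10000000\<bar> \<le> 1 / 10000000"
    using pi_approx unfolding abs_le_iff by (simp add: field_simps)
  have "\<bar>real j * (pi - 31415926 / 10000000)\<bar> \<le> 9 * (1 / 10000000)"
    unfolding abs_mult using pi j9 by (intro mult_mono) auto
  then have "\<bar>j * pi - j * (31415926 / 10000000)\<bar> \<le> 1 / 1000000" by (simp add: right_diff_distrib)
  then have \<phi>: "\<bar>\<phi> - x\<bar> \<le> 1 / 4000" using l x(1) unfolding \<phi>_def by linarith
  have eq: "- s0 * of_real (ln p) = of_real (- ln p / 2) + \<i> * of_real (- (1413 / 100 * ln p))"
    by (simp add: s0_def complex_eq_iff)
  have ye: "y = exp (- ln p / 2)" using p by (simp add: y_def powr_def)
  have "cpow p (- s0) = of_real y * cis (- (1413 / 100 * ln p))"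
    unfolding cpow_def eq exp_add ye cis_conv_exp exp_of_real ..
  also have "cis (- (1413 / 100 * ln p)) = cis (- \<phi>) * cis (- (j * pi))"
    by (simp add: cis_mult \<phi>_def)
  also have "cis (- (j * pi)) = -1"
  proof -
    have "cis (real i * pi) = cis pi ^ i" for i
      by (induction i) (simp_all add: distrib_right cis_mult[symmetric])
    from this[of j] have "cis (j * pi) = cis pi ^ j" .
    then have "cis (j * pi) = -1" using j by simp
    then show ?thesis by (simp add: cis_cnj[symmetric])
  qed
  finally have e: "cpow p (- s0) = - (of_real y * cis (- \<phi>))" by simp
  have "norm (cis (- \<phi>) - T) \<le> 1 / 4000 + 1 / 20000"
  proof -
    have "norm (cis (- \<phi>) - cis (- x)) \<le> \<bar>\<phi> - x\<bar>"
    proof -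
      have "norm (cis (- \<phi>) - cis (- x)) = norm (cis (- x) * (cis (x - \<phi>) - 1))" by (simp add: right_diff_distrib cis_mult)
      also have "\<dots> = norm (exp (\<i> * of_real (x - \<phi>)) - 1)" by (simp add: norm_mult cis_conv_exp)
      also have "\<dots> \<le> norm (\<i> * of_real (x - \<phi>))"
        using iexp_approx1[of "x - \<phi>" 0] by (simp add: norm_mult del: of_real_diff)
      finally show ?thesis by (simp add: norm_mult abs_minus_commute del: of_real_diff)
    qed
    moreover have "norm (cis (- x) - T) \<le> 1 / 20000"
    proof -
      have T: "T = Complex (1 - (- x)\<^sup>2 / 2 + (- x) ^ 4 / 24 - (- x) ^ 6 / 720) (- x - (- x) ^ 3 / 6 + (- x) ^ 5 / 120 - (- x) ^ 7 / 5040)"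
        by (simp add: T_def)
      show ?thesis unfolding T by (rule cis_approx) (use x(2) in simp)
    qed
    ultimately show ?thesis using \<phi> norm_triangle_ineq[of "cis (- \<phi>) - cis (- x)" "cis (- x) - T"] by simp
  qed
  then have "norm (of_real q * (cis (- \<phi>) - T)) \<le> 1 * (1 / 4000 + 1 / 20000)"
    unfolding norm_mult using q by (intro mult_mono) auto
  moreover have "norm (- (of_real (y - q) * cis (- \<phi>))) \<le> 1 / 10000"
    using yq by (simp add: norm_mult del: of_real_diff)
  moreover have "norm (- (of_real q * T) - Complex X Y) \<le> 1 / 20000 + 1 / 20000"
  proof -
    have "norm (- (of_real q * T) - Complex X Y) \<le> \<bar>Re (- (of_real q * T) - Complex X Y)\<bar> + \<bar>Im (- (of_real q * T) - Complex X Y)\<bar>" by (rule cmod_le)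
    also have "Re (- (of_real q * T) - Complex X Y) = - (q * (1 - x\<^sup>2 / 2 + x ^ 4 / 24 - x ^ 6 / 720) + X)" by (simp add: T_def)
    also have "Im (- (of_real q * T) - Complex X Y) = q * (x - x ^ 3 / 6 + x ^ 5 / 120 - x ^ 7 / 5040) - Y"
      unfolding T_def by (simp del: minus_diff_eq add: right_diff_distrib distrib_left)
    finally show ?thesis using X Y by linarith
  qed
  ultimately have "norm (- (of_real (y - q) * cis (- \<phi>)) - of_real q * (cis (- \<phi>) - T) + (- (of_real q * T) - Complex X Y))
      \<le> 1 / 10000 + 1 * (1 / 4000 + 1 / 20000) + (1 / 20000 + 1 / 20000)"
    by (intro norm_diff_add_le)
  moreover have "cpow p (- s0) - Complex X Y = - (of_real (y - q) * cis (- \<phi>)) - of_real q * (cis (- \<phi>) - T) + (- (of_real q * T) - Complex X Y)"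
    unfolding e by (simp add: algebra_simps)
  ultimately show ?thesis by (simp only:) simp
qed

text \<open>In the four prime cases j is the odd integer that makes x = 14.13 ln p - j pi small, q
  is p^(- 1/2) to five digits, and the target value is - q exp (- i x).\<close>

lemma cpow_2_approx: "norm (cpow 2 (- s0) - Complex (-6594 / 10000) (2553 / 10000)) \<le> 1 / 2000"
  by (rule cpow_prime_approx[where j = 3 and x = "3694 / 10000" and q = "70711 / 100000", OF _ _ ln_approx_small_primes(1)])
     (simp_all add: abs_le_iff power_divide)

lemma cpow_3_approx: "norm (cpow 3 (- s0) - Complex (-5675 / 10000) (-1060 / 10000)) \<le> 1 / 2000"
  by (rule cpow_prime_approx[where j = 5 and x = "-1846 / 10000" and q = "57735 / 100000", OF _ _ ln_approx_small_primes(2)])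
     (simp_all add: abs_le_iff power_divide)

lemma cpow_5_approx: "norm (cpow 5 (- s0) - Complex (-3272 / 10000) (3049 / 10000)) \<le> 1 / 2000"
  by (rule cpow_prime_approx[where j = 7 and x = "7502 / 10000" and q = "44721 / 100000", OF _ _ ln_approx_small_primes(3)])
     (simp_all add: abs_le_iff power_divide)

lemma cpow_7_approx: "norm (cpow 7 (- s0) - Complex (-2691 / 10000) (-2654 / 10000)) \<le> 1 / 2000"
  by (rule cpow_prime_approx[where j = 9 and x = "-7786 / 10000" and q = "37796 / 100000", OF _ _ ln_approx_small_primes(4)])
     (simp_all add: abs_le_iff power_divide)

lemma cpow_mult:
  assumes "a > 0" "b > 0"
  shows "cpow (a * b) w = cpow a w * cpow b w"
  using assms by (simp add: cpow_def ln_mult exp_add[symmetric] distrib_left)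

text \<open>Composite n are reduced to primes by multiplicativity. The value at q and the
  approximation at p have modulus at most 1, so the errors add; 1 / 10000 pays for rounding the
  product.\<close>

lemma cpow_prod_approx:
  assumes "norm (cpow p (- s0) - Complex X1 Y1) \<le> e1" "norm (cpow q (- s0) - Complex X2 Y2) \<le> e2"
    and pq: "p \<ge> 1" "q \<ge> 1" and XY: "X1\<^sup>2 + Y1\<^sup>2 \<le> 1"
    and X: "\<bar>X1 * X2 - Y1 * Y2 - X\<bar> \<le> 1 / 20000" and Y: "\<bar>X1 * Y2 + Y1 * X2 - Y\<bar> \<le> 1 / 20000"
  shows "norm (cpow (p * q) (- s0) - Complex X Y) \<le> e1 + e2 + 1 / 10000"
proof -
  define a b c d where "a = cpow p (- s0)" and "b = cpow q (- s0)" and "c = Complex X1 Y1" and "d = Complex X2 Y2"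
  have "norm b = q powr (- 1 / 2)" using pq by (simp add: b_def norm_cpow s0_def)
  also have "\<dots> \<le> q powr 0" using pq by (intro powr_mono) auto
  finally have b1: "norm b \<le> 1" using pq by simp
  have c1: "norm c \<le> 1" using XY by (simp add: c_def cmod_def)
  have "norm ((a - c) * b) \<le> e1 * 1"
    unfolding norm_mult using assms(1) b1 order_trans[OF norm_ge_zero assms(1)] by (intro mult_mono) (auto simp: a_def c_def)
  moreover have "norm (c * (b - d)) \<le> 1 * e2"
    unfolding norm_mult using assms(2) c1 by (intro mult_mono) (auto simp: b_def d_def)
  moreover have "norm (c * d - Complex X Y) \<le> 1 / 10000"
  proof -
    have "norm (c * d - Complex X Y) \<le> \<bar>Re (c * d - Complex X Y)\<bar> + \<bar>Im (c * d - Complex X Y)\<bar>" by (rule cmod_le)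
    then show ?thesis using X Y by (simp add: c_def d_def)
  qed
  moreover have eq: "cpow (p * q) (- s0) - Complex X Y = ((a - c) * b + c * (b - d)) + (c * d - Complex X Y)"
    using cpow_mult[of p q] pq by (simp add: a_def b_def algebra_simps)
  ultimately show ?thesis unfolding eq
    using norm_triangle_ineq[of "(a - c) * b + c * (b - d)" "c * d - Complex X Y"] norm_triangle_ineq[of "(a - c) * b" "c * (b - d)"] by linarith
qed

lemma cpow_4_approx: "norm (cpow 4 (- s0) - Complex (3696 / 10000) (-3367 / 10000)) \<le> 11 / 10000"
  using cpow_prod_approx[OF cpow_2_approx cpow_2_approx, of "3696 / 10000" "-3367 / 10000"] by (simp add: abs_le_iff power_divide)
lemma cpow_6_approx: "norm (cpow 6 (- s0) - Complex (4013 / 10000) (-750 / 10000)) \<le> 11 / 10000"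
  using cpow_prod_approx[OF cpow_2_approx cpow_3_approx, of "4013 / 10000" "-750 / 10000"] by (simp add: abs_le_iff power_divide)
lemma cpow_8_approx: "norm (cpow 8 (- s0) - Complex (-1578 / 10000) (3164 / 10000)) \<le> 17 / 10000"
  using cpow_prod_approx[OF cpow_2_approx cpow_4_approx, of "-1578 / 10000" "3164 / 10000"] by (simp add: abs_le_iff power_divide)
lemma cpow_9_approx: "norm (cpow 9 (- s0) - Complex (3108 / 10000) (1203 / 10000)) \<le> 11 / 10000"
  using cpow_prod_approx[OF cpow_3_approx cpow_3_approx, of "3108 / 10000" "1203 / 10000"] by (simp add: abs_le_iff power_divide)
lemma cpow_10_approx: "norm (cpow 10 (- s0) - Complex (1379 / 10000) (-2846 / 10000)) \<le> 11 / 10000"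
  using cpow_prod_approx[OF cpow_2_approx cpow_5_approx, of "1379 / 10000" "-2846 / 10000"] by (simp add: abs_le_iff power_divide)

text \<open>9 / 25 exceeds (3 / 20) ln 10, the largest modulus of an exponent that will occur; 13 /
  50 is the cubic coefficient 1 / 6 plus room for the later terms.\<close>

lemma exp_taylor2:
  fixes w :: complex
  assumes "norm w \<le> 9 / 25"
  shows "norm (exp w - (1 + w + w\<^sup>2 / 2)) \<le> 13 / 50 * norm w ^ 3"
proof -
  have "norm (exp w - (\<Sum>i\<le>3. w ^ i / fact i)) \<le> exp (norm w) * norm w ^ Suc 3 / fact 3"
    by (rule Taylor_exp_field)
  also have "\<dots> = norm w ^ 3 * (exp (norm w) * norm w) / 6" by (simp add: fact_numeral eval_nat_numeral)
  also have "\<dots> \<le> norm w ^ 3 * (3 / 2 * (9 / 25)) / 6"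
  proof (intro divide_right_mono mult_left_mono mult_mono)
    have "exp (norm w) \<le> exp (9 / 25)" using assms by simp
    also have "\<dots> \<le> 1 + 9 / 25 + (9 / 25)\<^sup>2" by (rule exp_bound) auto
    also have "\<dots> \<le> 3 / 2" by (simp add: power_divide)
    finally show "exp (norm w) \<le> 3 / 2" .
  qed (use assms in auto)
  finally have 1: "norm (exp w - (\<Sum>i\<le>3. w ^ i / fact i)) \<le> norm w ^ 3 * (3 / 2 * (9 / 25)) / 6" .
  have eq: "exp w - (1 + w + w\<^sup>2 / 2) = (exp w - (\<Sum>i\<le>3. w ^ i / fact i)) + w ^ 3 / 6"
    by (simp add: fact_numeral eval_nat_numeral)
  have "norm (w ^ 3 / 6) = norm w ^ 3 / 6" by (simp add: norm_divide norm_power)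
  then have "norm (exp w - (1 + w + w\<^sup>2 / 2)) \<le> norm w ^ 3 * (3 / 2 * (9 / 25)) / 6 + norm w ^ 3 / 6"
    unfolding eq using 1 norm_triangle_ineq[of "exp w - (\<Sum>i\<le>3. w ^ i / fact i)" "w ^ 3 / 6"] by linarith
  also have "\<dots> \<le> 13 / 50 * norm w ^ 3" using zero_le_power[of "norm w" 3] by (simp add: field_simps)
  finally show ?thesis .
qed

text \<open>By Euler--Maclaurin summation \<open>\<zeta>(s0 + z)\<close> is close to the sum of \<open>Bc n * n powr (- z)\<close> over \<open>n \<le> 10\<close>, where
  the correction factor \<open>wcor\<close> of the last term is frozen at \<open>s0\<close>. The decimal values \<open>Bhat n\<close> and \<open>lhat n\<close>
  approximate \<open>Bc n\<close> (up to \<open>ebnd n\<close>) and \<open>ln n\<close>.\<close>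

definition wcor :: "complex \<Rightarrow> complex" where "wcor s = 10 / (s - 1) + 1 / 2 + s / 120"

definition Bc :: "nat \<Rightarrow> complex" where "Bc n = (if n = 10 then cpow 10 (- s0) * wcor s0 else cpow (real n) (- s0))"

definition Bhat :: "nat \<Rightarrow> complex" where
  "Bhat n = [0, 1, Complex (-6594 / 10000) (2553 / 10000), Complex (-5675 / 10000) (-1060 / 10000),
     Complex (3696 / 10000) (-3367 / 10000), Complex (-3272 / 10000) (3049 / 10000), Complex (4013 / 10000) (-750 / 10000),
     Complex (-2691 / 10000) (-2654 / 10000), Complex (-1578 / 10000) (3164 / 10000), Complex (3108 / 10000) (1203 / 10000),
     Complex (-1016 / 10000) (-2176 / 10000)] ! n"

definition lhat :: "nat \<Rightarrow> real" where
  "lhat n = [0, 0, 693147 / 1000000, 1098612 / 1000000, 1386294 / 1000000, 1609438 / 1000000, 1791759 / 1000000,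
     1945910 / 1000000, 2079441 / 1000000, 2197224 / 1000000, 2302585 / 1000000] ! n"

definition ebnd :: "nat \<Rightarrow> real" where
  "ebnd n = [0, 0, 5 / 10000, 5 / 10000, 11 / 10000, 5 / 10000, 11 / 10000, 5 / 10000, 17 / 10000, 11 / 10000, 11 / 10000] ! n"

lemma set_1_10: "{1..10::nat} = {1, 2, 3, 4, 5, 6, 7, 8, 9, 10}"
  unfolding set_eq_iff atLeastAtMost_iff insert_iff empty_iff by presburger

lemma wcor_s0: "norm (wcor s0 - Complex (479155 / 1000000) (-589079 / 1000000)) \<le> 1 / 100000"
proof -
  have "norm (wcor s0 - Complex (479155 / 1000000) (-589079 / 1000000)) \<le>
    \<bar>Re (wcor s0 - Complex (479155 / 1000000) (-589079 / 1000000))\<bar> + \<bar>Im (wcor s0 - Complex (479155 / 1000000) (-589079 / 1000000))\<bar>"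
    by (rule cmod_le)
  also have "\<dots> \<le> 1 / 100000"
    by (simp add: wcor_def s0_def Re_divide Im_divide power_divide)
  finally show ?thesis .
qed

lemma Bc_approx: "n \<in> {1..10} \<Longrightarrow> norm (Bc n - Bhat n) \<le> ebnd n"
proof -
  have "norm (cpow 10 (- s0) * wcor s0 - Complex (-1016 / 10000) (-2176 / 10000)) \<le> 11 / 10000"
  proof -
    define a b c d where "a = cpow 10 (- s0)" and "b = wcor s0" and "c = Complex (1379 / 10000) (-2846 / 10000)" and "d = Complex (479155 / 1000000) (-589079 / 1000000)"
    have nc: "norm d \<le> 77 / 100"
      by (rule power2_le_imp_le) (simp_all add: cmod_power2 d_def power_divide)
    have "norm ((a - c) * d) \<le> 11 / 10000 * (77 / 100)"
      unfolding norm_mult using cpow_10_approx nc by (intro mult_mono) (auto simp: a_def c_def)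
    moreover have "norm (a * (b - d)) \<le> 1 * (1 / 100000)"
    proof -
      have "norm a = 10 powr (- 1 / 2)" by (simp add: a_def norm_cpow s0_def)
      also have "\<dots> \<le> 10 powr 0" by (intro powr_mono) auto
      finally have "norm a \<le> 1" by simp
      then show ?thesis unfolding norm_mult using wcor_s0 by (intro mult_mono) (auto simp: b_def d_def)
    qed
    moreover have "norm (c * d - Complex (-1016 / 10000) (-2176 / 10000)) \<le> 1 / 10000"
    proof -
      have "norm (c * d - Complex (-1016 / 10000) (-2176 / 10000)) \<le> \<bar>Re (c * d - Complex (-1016 / 10000) (-2176 / 10000))\<bar> + \<bar>Im (c * d - Complex (-1016 / 10000) (-2176 / 10000))\<bar>" by (rule cmod_le)
      also have "\<dots> \<le> 1 / 10000" by (simp add: c_def d_def)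
      finally show ?thesis .
    qed
    moreover have eq: "a * b - Complex (-1016 / 10000) (-2176 / 10000) = ((a - c) * d + a * (b - d)) + (c * d - Complex (-1016 / 10000) (-2176 / 10000))"
      by (simp add: algebra_simps)
    ultimately show ?thesis unfolding a_def[symmetric] b_def[symmetric] eq
      using norm_triangle_ineq[of "(a - c) * d + a * (b - d)" "c * d - Complex (-1016 / 10000) (-2176 / 10000)"] norm_triangle_ineq[of "(a - c) * d" "a * (b - d)"] by linarith
  qed
  then have "\<forall>n\<in>{1..10}. norm (Bc n - Bhat n) \<le> ebnd n"
    unfolding set_1_10 using cpow_2_approx cpow_3_approx cpow_4_approx cpow_5_approx cpow_6_approx cpow_7_approx cpow_8_approx cpow_9_approx
    by (simp add: Bc_def Bhat_def ebnd_def)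
  then show "n \<in> {1..10} \<Longrightarrow> norm (Bc n - Bhat n) \<le> ebnd n" by blast
qed

lemma lhat_approx: "n \<in> {1..10} \<Longrightarrow> \<bar>ln (real n) - lhat n\<bar> \<le> 1 / 20000"
proof -
  have c: "ln 4 = 2 * ln (2::real)" "ln 6 = ln 2 + ln (3::real)" "ln 8 = 3 * ln (2::real)" "ln 9 = 2 * ln (3::real)" "ln 10 = ln 2 + ln (5::real)"
    using ln_realpow[of 2 2] ln_realpow[of 2 3] ln_realpow[of 3 2] ln_mult[of 2 3] ln_mult[of 2 5] by simp_all
  note p = ln_approx_small_primes
  have g1: "\<bar>ln (real 1) - lhat 1\<bar> \<le> 1 / 20000" by (simp add: lhat_def)
  have f2: "\<bar>ln 2 - 693147 / 1000000\<bar> \<le> (1 / 20000 :: real)" using p c by linarith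
  have g2: "\<bar>ln (real 2) - lhat 2\<bar> \<le> 1 / 20000" using f2 by (simp add: lhat_def)
  have f3: "\<bar>ln 3 - 1098612 / 1000000\<bar> \<le> (1 / 20000 :: real)" using p c by linarith
  have g3: "\<bar>ln (real 3) - lhat 3\<bar> \<le> 1 / 20000" using f3 by (simp add: lhat_def)
  have f4: "\<bar>ln 4 - 1386294 / 1000000\<bar> \<le> (1 / 20000 :: real)" using p c by linarith
  have g4: "\<bar>ln (real 4) - lhat 4\<bar> \<le> 1 / 20000" using f4 by (simp add: lhat_def)
  have f5: "\<bar>ln 5 - 1609438 / 1000000\<bar> \<le> (1 / 20000 :: real)" using p c by linarith
  have g5: "\<bar>ln (real 5) - lhat 5\<bar> \<le> 1 / 20000" using f5 by (simp add: lhat_def)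
  have f6: "\<bar>ln 6 - 1791759 / 1000000\<bar> \<le> (1 / 20000 :: real)" using p c by linarith
  have g6: "\<bar>ln (real 6) - lhat 6\<bar> \<le> 1 / 20000" using f6 by (simp add: lhat_def)
  have f7: "\<bar>ln 7 - 1945910 / 1000000\<bar> \<le> (1 / 20000 :: real)" using p c by linarith
  have g7: "\<bar>ln (real 7) - lhat 7\<bar> \<le> 1 / 20000" using f7 by (simp add: lhat_def)
  have f8: "\<bar>ln 8 - 2079441 / 1000000\<bar> \<le> (1 / 20000 :: real)" using p c by linarith
  have g8: "\<bar>ln (real 8) - lhat 8\<bar> \<le> 1 / 20000" using f8 by (simp add: lhat_def)
  have f9: "\<bar>ln 9 - 2197224 / 1000000\<bar> \<le> (1 / 20000 :: real)" using p c by linarith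
  have g9: "\<bar>ln (real 9) - lhat 9\<bar> \<le> 1 / 20000" using f9 by (simp add: lhat_def)
  have f10: "\<bar>ln 10 - 2302585 / 1000000\<bar> \<le> (1 / 20000 :: real)" using p c by linarith
  have g10: "\<bar>ln (real 10) - lhat 10\<bar> \<le> 1 / 20000" using f10 by (simp add: lhat_def)
  assume "n \<in> {1..10}"
  then show "\<bar>ln (real n) - lhat n\<bar> \<le> 1 / 20000"
    unfolding set_1_10
    by (elim insertE emptyE) (simp_all only: g1 g2 g3 g4 g5 g6 g7 g8 g9 g10)
qed

lemma Bhat_le_1: "n \<in> {1..10} \<Longrightarrow> norm (Bhat n) \<le> 1"
  unfolding set_1_10 by (auto simp: Bhat_def cmod_def power_divide)

lemma lhat_range: "n \<in> {1..10} \<Longrightarrow> 0 \<le> lhat n \<and> lhat n \<le> 2302585 / 1000000"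
  unfolding set_1_10 by (auto simp: lhat_def)

lemma ln_range: "n \<in> {1..10} \<Longrightarrow> 0 \<le> ln (real n) \<and> ln (real n) \<le> 231 / 100"
proof
  assume n: "n \<in> {1..10}"
  then show "0 \<le> ln (real n)" by auto
  show "ln (real n) \<le> 231 / 100" using lhat_approx[OF n] lhat_range[OF n] by linarith
qed

lemma sum_ebnd: "(\<Sum>n\<in>{1..10}. ebnd n) \<le> 81 / 10000"
  unfolding set_1_10 by (simp add: ebnd_def)

text \<open>Up to sign and factorial these sums are the Taylor coefficients at z = 0 of the sum of
  Bc n exp (- z ln n). The errors of \<open>Bc\<close> are weighted by at most (231 / 100)^k, as ln
  10 < 2.31; those of the powers of the logarithm cost 3 / 10000 for each of the ten terms.\<close>

lemma moment_approx:
  assumes k: "k \<le> 2"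
  shows "norm ((\<Sum>n\<in>{1..10}. Bc n * of_real (ln (real n)) ^ k) - (\<Sum>n\<in>{1..10}. Bhat n * of_real (lhat n) ^ k)) \<le> (231 / 100) ^ k * (81 / 10000) + 3 / 1000"
proof -
  have "norm ((\<Sum>n\<in>{1..10}. Bc n * of_real (ln (real n)) ^ k) - (\<Sum>n\<in>{1..10}. Bhat n * of_real (lhat n) ^ k))
    \<le> (\<Sum>n\<in>{1..10}. (231 / 100) ^ k * ebnd n + 3 / 10000)"
    unfolding sum_subtractf[symmetric]
  proof (rule sum_norm_le)
    fix n :: nat assume n: "n \<in> {1..10}"
    define l m where "l = ln (real n)" and "m = lhat n"
    have lm: "0 \<le> l" "l \<le> 231 / 100" "0 \<le> m" "m \<le> 231 / 100" "\<bar>l - m\<bar> \<le> 1 / 20000"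
      using ln_range[OF n] lhat_range[OF n] lhat_approx[OF n] by (auto simp: l_def m_def)
    have pw: "\<bar>l ^ k - m ^ k\<bar> \<le> 3 / 10000"
    proof -
      consider "k = 0" | "k = 1" | "k = 2" using k by linarith
      then show ?thesis
      proof cases
        case 3
        have "\<bar>l\<^sup>2 - m\<^sup>2\<bar> = \<bar>l - m\<bar> * (l + m)" using lm by (simp add: power2_eq_square square_diff_square_factored abs_mult mult.commute)
        also have "\<dots> \<le> (1 / 20000) * (231 / 100 + 231 / 100)" using lm by (intro mult_mono add_mono) auto
        finally show ?thesis using 3 by simp
      qed (use lm in auto)
    qed
    have "Bc n * of_real l ^ k - Bhat n * of_real m ^ k = (Bc n - Bhat n) * of_real (l ^ k) + Bhat n * of_real (l ^ k - m ^ k)"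
      by (simp add: algebra_simps)
    also have "norm \<dots> \<le> norm ((Bc n - Bhat n) * of_real (l ^ k)) + norm (Bhat n * of_real (l ^ k - m ^ k))"
      by (rule norm_triangle_ineq)
    also have "norm ((Bc n - Bhat n) * of_real (l ^ k)) \<le> ebnd n * (231 / 100) ^ k"
      unfolding norm_mult norm_of_real using Bc_approx[OF n] order_trans[OF norm_ge_zero Bc_approx[OF n]] lm
      by (intro mult_mono) (auto simp: power_abs intro!: power_mono)
    also have "norm (Bhat n * of_real (l ^ k - m ^ k)) \<le> 1 * (3 / 10000)"
      unfolding norm_mult norm_of_real using Bhat_le_1[OF n] pw by (intro mult_mono) auto
    finally show "norm (Bc n * of_real (ln (real n)) ^ k - Bhat n * of_real (lhat n) ^ k) \<le> (231 / 100) ^ k * ebnd n + 3 / 10000"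
      by (simp add: l_def m_def mult.commute)
  qed
  also have "\<dots> = (231 / 100) ^ k * (\<Sum>n\<in>{1..10}. ebnd n) + 3 / 1000"
    by (simp add: sum.distrib sum_distrib_left)
  also have "\<dots> \<le> (231 / 100) ^ k * (81 / 10000) + 3 / 1000"
    using sum_ebnd by (intro add_mono mult_left_mono) auto
  finally show ?thesis .
qed

text \<open>Approximates |zeta s0|, which is small because s0 is within 0.005 of the first
  zero.\<close>

lemma moment_0: "norm (\<Sum>n\<in>{1..10}. Bc n) \<le> 151 / 10000"
proof -
  have eq: "(\<Sum>n\<in>{1..10}. Bhat n) = Complex (-9 / 10000) (-19 / 5000)"
    unfolding set_1_10 by (simp add: Bhat_def complex_eq_iff)
  have b: "norm (\<Sum>n\<in>{1..10}. Bhat n) \<le> 4 / 1000"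
    unfolding eq by (rule power2_le_imp_le) (simp_all add: cmod_power2 power_divide)
  have "norm ((\<Sum>n\<in>{1..10}. Bc n) - (\<Sum>n\<in>{1..10}. Bhat n)) \<le> 81 / 10000 + 3 / 1000"
    using moment_approx[of 0] by simp
  then show ?thesis using b norm_triangle_ineq2[of "\<Sum>n\<in>{1..10}. Bc n" "\<Sum>n\<in>{1..10}. Bhat n"] by linarith
qed

text \<open>Approximates |zeta' s0|; this lower bound makes \<open>zet\<close> grow away from the
  centre.\<close>

lemma moment_1: "norm (\<Sum>n\<in>{1..10}. Bc n * of_real (ln (real n))) \<ge> 769 / 1000"
proof -
  have eq: "(\<Sum>n\<in>{1..10}. Bhat n * of_real (lhat n)) = Complex (-7785499939 / 10000000000) (-1451477419 / 10000000000)"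
    unfolding set_1_10 by (simp add: Bhat_def lhat_def complex_eq_iff)
  have b: "norm (\<Sum>n\<in>{1..10}. Bhat n * of_real (lhat n)) \<ge> 791 / 1000"
    unfolding eq by (rule power2_le_imp_le) (simp_all add: cmod_power2 power_divide)
  have "norm ((\<Sum>n\<in>{1..10}. Bc n * of_real (ln (real n))) - (\<Sum>n\<in>{1..10}. Bhat n * of_real (lhat n))) \<le> 231 / 100 * (81 / 10000) + 3 / 1000"
    using moment_approx[of 1] by (simp only: power_one_right)
  then show ?thesis
    using b norm_triangle_ineq3[of "\<Sum>n\<in>{1..10}. Bc n * of_real (ln (real n))" "\<Sum>n\<in>{1..10}. Bhat n * of_real (lhat n)"] by linarith
qed

lemma moment_2: "norm (\<Sum>n\<in>{1..10}. Bc n * of_real (ln (real n)) ^ 2) \<le> 72 / 100"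
proof -
  have eq: "(\<Sum>n\<in>{1..10}. Bhat n * of_real (lhat n) ^ 2) = Complex (-1180320644554343 / 2000000000000000) (-3130777660880657 / 10000000000000000)"
    unfolding set_1_10 by (simp add: Bhat_def lhat_def complex_eq_iff power2_eq_square)
  have b: "norm (\<Sum>n\<in>{1..10}. Bhat n * of_real (lhat n) ^ 2) \<le> 67 / 100"
    unfolding eq by (rule power2_le_imp_le) (simp_all add: cmod_power2 power_divide)
  have "norm ((\<Sum>n\<in>{1..10}. Bc n * of_real (ln (real n)) ^ 2) - (\<Sum>n\<in>{1..10}. Bhat n * of_real (lhat n) ^ 2)) \<le> (231 / 100)\<^sup>2 * (81 / 10000) + 3 / 1000"
    by (rule moment_approx) simp
  also have "\<dots> \<le> 47 / 1000" by (simp add: power_divide)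
  finally show ?thesis using b norm_triangle_ineq2[of "\<Sum>n\<in>{1..10}. Bc n * of_real (ln (real n)) ^ 2" "\<Sum>n\<in>{1..10}. Bhat n * of_real (lhat n) ^ 2"]
    by linarith
qed

text \<open>Enters through the cubic Taylor remainder, for which the crude bound of |Bhat n| by |Re|
  + |Im| is sufficient.\<close>

lemma moment_3: "(\<Sum>n\<in>{1..10}. norm (Bc n) * ln (real n) ^ 3) \<le> 26"
proof -
  have "(\<Sum>n\<in>{1..10}. norm (Bc n) * ln (real n) ^ 3) \<le> (\<Sum>n\<in>{1..10}. (\<bar>Re (Bhat n)\<bar> + \<bar>Im (Bhat n)\<bar> + 17 / 10000) * (lhat n + 1 / 20000) ^ 3)"
  proof (intro sum_mono mult_mono power_mono)
    fix n :: nat assume n: "n \<in> {1..10}"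
    have "ebnd n \<le> 17 / 10000" using n unfolding set_1_10 by (auto simp: ebnd_def)
    then show "norm (Bc n) \<le> \<bar>Re (Bhat n)\<bar> + \<bar>Im (Bhat n)\<bar> + 17 / 10000"
      using Bc_approx[OF n] cmod_le[of "Bhat n"] norm_triangle_sub[of "Bc n" "Bhat n"] by linarith
    show "ln (real n) \<le> lhat n + 1 / 20000" using lhat_approx[OF n] by linarith
    show "0 \<le> ln (real n)" "0 \<le> ln (real n) ^ 3" using ln_range[OF n] by auto
  qed auto
  also have "\<dots> \<le> 26" unfolding set_1_10 by (simp add: Bhat_def lhat_def power_divide)
  finally show ?thesis .
qed

lemma set_1_9: "{1..9::nat} = {1, 2, 3, 4, 5, 6, 7, 8, 9}"
  unfolding set_eq_iff atLeastAtMost_iff insert_iff empty_iff by presburger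

lemma norm_add_le_of_square:
  assumes "norm z \<le> 3 / 20" "a\<^sup>2 + b\<^sup>2 \<le> (c - 3 / 20)\<^sup>2" "c \<ge> 3 / 20"
  shows "norm (Complex a b + z) \<le> c"
proof -
  have "norm (Complex a b) \<le> c - 3 / 20"
    by (rule power2_le_imp_le) (use assms in \<open>simp_all add: cmod_power2\<close>)
  then show ?thesis using norm_triangle_ineq[of "Complex a b" z] assms(1) by linarith
qed

text \<open>Euler-Maclaurin summation with M = 9 accounts for an error 15 / 1000, and replacing
  \<open>wcor (s0 + z)\<close> by \<open>wcor s0\<close> for 5 / 1000.\<close>

lemma zet_near_s0:
  assumes z: "norm z \<le> 3 / 20"
  shows "norm (zet (s0 + z) - (\<Sum>n\<in>{1..10}. Bc n * exp (- z * of_real (ln (real n))))) \<le> 2 / 100"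
proof -
  define s where "s = s0 + z"
  have rez: "\<bar>Re z\<bar> \<le> 3 / 20" "\<bar>Im z\<bar> \<le> 3 / 20" using z abs_Re_le_cmod[of z] abs_Im_le_cmod[of z] by linarith+
  have res: "Re s \<ge> 7 / 20" using rez by (simp add: s_def s0_def)
  have "Im s > 0" using rez by (simp add: s_def s0_def)
  then have s1: "s \<noteq> 1" by auto
  have c: "cpow (real n) (- s) = cpow (real n) (- s0) * exp (- z * of_real (ln (real n)))" for n
    by (simp add: cpow_def s_def mult_exp_exp algebra_simps)
  have c10: "cpow 10 (- s) = cpow 10 (- s0) * exp (- z * of_real (ln 10))"
    using c[of 10] by simp
  have "norm (zet s - ((\<Sum>n\<in>{1..9}. cpow (real n) (-s)) + cpow (Suc 9) (-s) * (of_nat (Suc 9) / (s - 1) + 1 / 2 + s / (12 * of_nat (Suc 9)))))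
     \<le> norm (s * (s + 1) * (s + 2) * (s + 3)) / 720 * (real 9 powr (- Re s - 3) / (Re s + 3))"
    by (rule zet_euler_maclaurin) (use res s1 in auto)
  then have "norm (zet s - ((\<Sum>n\<in>{1..9}. cpow (real n) (-s)) + cpow 10 (-s) * wcor s))
     \<le> norm (s * (s + 1) * (s + 2) * (s + 3)) / 720 * (9 powr (- Re s - 3) / (Re s + 3))"
    by (simp add: wcor_def)
  also have "\<dots> \<le> (143 / 10 * (144 / 10) * (1455 / 100) * (1475 / 100)) / 720 * ((1 / (729 * (17 / 10))) / (335 / 100))"
  proof (intro mult_mono divide_right_mono)
    have e: "s = Complex (1 / 2) (1413 / 100) + z" "s + 1 = Complex (3 / 2) (1413 / 100) + z"
      "s + 2 = Complex (5 / 2) (1413 / 100) + z" "s + 3 = Complex (7 / 2) (1413 / 100) + z"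
      by (simp_all add: s_def s0_def complex_eq_iff)
    have n1: "norm s \<le> 143 / 10" unfolding e(1) by (rule norm_add_le_of_square[OF z]) (simp_all add: power_divide)
    have n2: "norm (s + 1) \<le> 144 / 10" unfolding e(2) by (rule norm_add_le_of_square[OF z]) (simp_all add: power_divide)
    have n3: "norm (s + 2) \<le> 1455 / 100" unfolding e(3) by (rule norm_add_le_of_square[OF z]) (simp_all add: power_divide)
    have n4: "norm (s + 3) \<le> 1475 / 100" unfolding e(4) by (rule norm_add_le_of_square[OF z]) (simp_all add: power_divide)
    note n = n1 n2 n3 n4
    show "norm (s * (s + 1) * (s + 2) * (s + 3)) \<le> 143 / 10 * (144 / 10) * (1455 / 100) * (1475 / 100)"
      unfolding norm_mult by (intro mult_mono n mult_nonneg_nonneg) auto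
    show "9 powr (- Re s - 3) / (Re s + 3) \<le> 1 / (729 * (17 / 10)) / (335 / 100)"
    proof (rule frac_le)
      \<comment> \<open>The exponent is at most -3.35; rounding it up to -3.25 leaves the fourth
        root of 9, which exceeds 1.7 since 1.7^4 = 8.3521.\<close>
      have "9 powr (- Re s - 3) \<le> 9 powr (- 3 + - (1 / 4))" using res by (intro powr_mono) auto
      also have "\<dots> = 9 powr (- 3) * 9 powr (- (1 / 4))" by (rule powr_add)
      also have "9 powr (- 3) = (1 / 729 :: real)" unfolding powr_minus_divide by simp
      also have "9 powr (- (1 / 4)) \<le> (1 / (17 / 10) :: real)"
      proof -
        have "(17 / 10 :: real) = ((17 / 10) powr 4) powr (1 / 4)" unfolding powr_powr by simp
        also have "\<dots> \<le> 9 powr (1 / 4)" by (intro powr_mono2) (auto simp: power_divide)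
        finally show ?thesis unfolding powr_minus_divide by (intro divide_left_mono) auto
      qed
      finally show "9 powr (- Re s - 3) \<le> 1 / (729 * (17 / 10))" by simp
    qed (use res in auto)
  qed (use res in auto)
  also have "\<dots> \<le> 15 / 1000" by simp
  finally have em: "norm (zet s - ((\<Sum>n\<in>{1..9}. cpow (real n) (-s)) + cpow 10 (-s) * wcor s)) \<le> 15 / 1000" .
  have corr: "norm (cpow 10 (-s) * (wcor s - wcor s0)) \<le> 5 / 1000"
  proof -
    have a: "norm (s0 - 1) \<ge> 14" using abs_Im_le_cmod[of "s0 - 1"] by (simp add: s0_def)
    have b: "norm (s - 1) \<ge> 138 / 10" using abs_Im_le_cmod[of "s - 1"] rez by (simp add: s_def s0_def)
    have nz: "s0 - 1 \<noteq> 0" "s - 1 \<noteq> 0" using a b by auto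
    have weq: "wcor s - wcor s0 = z / 120 - 10 * z / ((s0 - 1) * (s - 1))"
    proof -
      have num: "10 * (s0 - 1) - 10 * (s - 1) = - (10 * z)" by (simp add: s_def)
      have "10 / (s - 1) - 10 / (s0 - 1) = - (10 * z) / ((s - 1) * (s0 - 1))"
        unfolding diff_frac_eq[OF nz(2) nz(1)] num ..
      also have "\<dots> = - (10 * z / ((s0 - 1) * (s - 1)))" by (simp only: minus_divide_left mult.commute[of "s - 1"])
      finally have "10 / (s - 1) - 10 / (s0 - 1) = - (10 * z / ((s0 - 1) * (s - 1)))" .
      moreover have "wcor s - wcor s0 = z / 120 + (10 / (s - 1) - 10 / (s0 - 1))"
        by (simp add: wcor_def s_def add_divide_distrib)
      ultimately show ?thesis by simp
    qed
    have "norm (wcor s - wcor s0) \<le> norm (z / 120) + norm (10 * z / ((s0 - 1) * (s - 1)))"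
      unfolding weq by (rule norm_triangle_ineq4)
    also have "\<dots> = norm z / 120 + 10 * norm z / (norm (s0 - 1) * norm (s - 1))" by (simp add: norm_mult norm_divide)
    also have "\<dots> \<le> (3 / 20) / 120 + 10 * (3 / 20) / (14 * (138 / 10))"
      using z a b by (intro add_mono divide_right_mono frac_le mult_mono mult_pos_pos) auto
    also have "\<dots> \<le> 1 / 100" by simp
    finally have w: "norm (wcor s - wcor s0) \<le> 1 / 100" .
    have "norm (cpow 10 (-s)) = 10 powr (- Re s)" by (simp add: norm_cpow)
    also have "\<dots> \<le> 10 powr (- (1 / 3))" using res by (intro powr_mono) auto
    also have "\<dots> \<le> 8 powr (- (1 / 3))" by (intro powr_mono2') auto
    also have "\<dots> = 1 / 2"
    proof -
      have "(8::real) = 2 powr 3" by simp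
      then have "8 powr (- (1 / 3)) = (2::real) powr (3 * (- (1 / 3)))" by (simp only: powr_powr)
      then show ?thesis by (simp add: powr_minus_divide)
    qed
    finally have "norm (cpow 10 (-s)) \<le> 1 / 2" .
    then have "norm (cpow 10 (-s) * (wcor s - wcor s0)) \<le> 1 / 2 * (1 / 100)"
      unfolding norm_mult using w by (intro mult_mono) auto
    then show ?thesis by simp
  qed
  have "(\<Sum>n\<in>{1..10}. Bc n * exp (- z * of_real (ln (real n)))) = (\<Sum>n\<in>{1..9}. Bc n * exp (- z * of_real (ln (real n)))) + Bc 10 * exp (- z * of_real (ln (real 10)))"
    unfolding set_1_10 set_1_9 by simp
  also have "(\<Sum>n\<in>{1..9}. Bc n * exp (- z * of_real (ln (real n)))) = (\<Sum>n\<in>{1..9}. cpow (real n) (-s))"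
    by (intro sum.cong refl) (auto simp: Bc_def c)
  also have "Bc 10 * exp (- z * of_real (ln (real 10))) = cpow 10 (-s) * wcor s0" by (simp add: Bc_def c10)
  finally have eq: "zet s - (\<Sum>n\<in>{1..10}. Bc n * exp (- z * of_real (ln (real n)))) =
     (zet s - ((\<Sum>n\<in>{1..9}. cpow (real n) (-s)) + cpow 10 (-s) * wcor s)) + cpow 10 (-s) * (wcor s - wcor s0)"
    by (simp add: algebra_simps)
  show ?thesis
    unfolding s_def[symmetric] eq by (rule order_trans[OF norm_triangle_ineq]) (use em corr in linarith)
qed

text \<open>Each exponential is expanded to second order; the remainders add up to at most (13 / 50)
  (3 / 20)^3 times the third moment 26, about 0.0228.\<close>

lemma zet_quadratic:
  assumes z: "norm z \<le> 3 / 20"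
  shows "norm ((\<Sum>n\<in>{1..10}. Bc n * exp (- z * of_real (ln (real n))))
     - ((\<Sum>n\<in>{1..10}. Bc n) - z * (\<Sum>n\<in>{1..10}. Bc n * of_real (ln (real n))) + z\<^sup>2 / 2 * (\<Sum>n\<in>{1..10}. Bc n * of_real (ln (real n)) ^ 2))) \<le> 229 / 10000"
proof -
  have "(\<Sum>n\<in>{1..10}. Bc n * exp (- z * of_real (ln (real n))))
     - ((\<Sum>n\<in>{1..10}. Bc n) - z * (\<Sum>n\<in>{1..10}. Bc n * of_real (ln (real n))) + z\<^sup>2 / 2 * (\<Sum>n\<in>{1..10}. Bc n * of_real (ln (real n)) ^ 2))
    = (\<Sum>n\<in>{1..10}. Bc n * (exp (- z * of_real (ln (real n))) - (1 + (- z * of_real (ln (real n))) + (- z * of_real (ln (real n)))\<^sup>2 / 2)))"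
    unfolding sum_distrib_left sum_subtractf[symmetric] sum.distrib[symmetric]
    by (intro sum.cong refl) (simp add: algebra_simps power_mult_distrib)
  also have "norm \<dots> \<le> (\<Sum>n\<in>{1..10}. (13 / 50 * (3 / 20) ^ 3) * (norm (Bc n) * ln (real n) ^ 3))"
  proof (rule sum_norm_le)
    fix n :: nat assume n: "n \<in> {1..10}"
    define w where "w = - z * of_real (ln (real n))"
    have l: "0 \<le> ln (real n)" "ln (real n) \<le> 231 / 100" using ln_range[OF n] by auto
    have nw: "norm w \<le> 3 / 20 * ln (real n)" using mult_right_mono[OF z l(1)] l(1) by (simp only: w_def norm_mult norm_minus_cancel norm_of_real abs_of_nonneg)
    also have "\<dots> \<le> 3 / 20 * (231 / 100)" using l by (intro mult_left_mono) auto
    also have "\<dots> \<le> 9 / 25" by simp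
    finally have "norm (exp w - (1 + w + w\<^sup>2 / 2)) \<le> 13 / 50 * norm w ^ 3" by (rule exp_taylor2)
    also have "\<dots> \<le> 13 / 50 * (3 / 20 * ln (real n)) ^ 3" using nw by (intro mult_left_mono power_mono) auto
    finally have "norm (Bc n) * norm (exp w - (1 + w + w\<^sup>2 / 2)) \<le> norm (Bc n) * (13 / 50 * (3 / 20 * ln (real n)) ^ 3)"
      by (intro mult_left_mono) auto
    also have "\<dots> = (13 / 50 * (3 / 20) ^ 3) * (norm (Bc n) * ln (real n) ^ 3)"
      by (simp only: power_mult_distrib mult_ac)
    finally show "norm (Bc n * (exp (- z * of_real (ln (real n))) - (1 + (- z * of_real (ln (real n))) + (- z * of_real (ln (real n)))\<^sup>2 / 2)))
       \<le> (13 / 50 * (3 / 20) ^ 3) * (norm (Bc n) * ln (real n) ^ 3)"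
      by (simp only: norm_mult w_def)
  qed
  also have "\<dots> = (13 / 50 * (3 / 20) ^ 3) * (\<Sum>n\<in>{1..10}. norm (Bc n) * ln (real n) ^ 3)" by (simp only: sum_distrib_left)
  also have "\<dots> \<le> (13 / 50 * (3 / 20) ^ 3) * 26" using moment_3 by (intro mult_left_mono) auto
  also have "\<dots> \<le> 229 / 10000" by (simp add: power_divide)
  finally show ?thesis .
qed

text \<open>On the circle of radius \<open>3 / 20\<close> around \<open>s0\<close> the function \<open>zet\<close> is larger than at the centre,
  so the minimum modulus principle yields a zero.\<close>

lemma Z_zero_exists: "\<exists>\<rho>. Re \<rho> > 0 \<and> Z \<rho> = 0"
proof (rule ccontr)
  assume "\<not> (\<exists>\<rho>. Re \<rho> > 0 \<and> Z \<rho> = 0)"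
  then have nz: "Z s \<noteq> 0" if "Re s > 0" for s using that by blast
  define S0 S1 S2 where "S0 = (\<Sum>n\<in>{1..10}. Bc n)" and "S1 = (\<Sum>n\<in>{1..10}. Bc n * of_real (ln (real n)))" and "S2 = (\<Sum>n\<in>{1..10}. Bc n * of_real (ln (real n)) ^ 2)"
  note m = moment_0[folded S0_def] moment_1[folded S1_def] moment_2[folded S2_def]
  have center: "norm (zet s0) \<le> 36 / 1000"
  proof -
    have "norm (zet s0 - S0) \<le> 2 / 100" using zet_near_s0[of 0] by (simp add: S0_def)
    then show ?thesis using m(1) norm_triangle_sub[of "zet s0" S0] by linarith
  qed
  \<comment> \<open>The linear term has modulus at least 0.1153. The centre value, the quadratic
    term, the Taylor remainder and the Euler-Maclaurin error take away at most 0.0151 + 0.0081 +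
    0.0229 + 0.02, which leaves more than 0.048.\<close>
  have circle: "norm (zet s) \<ge> 48 / 1000" if s: "norm (s - s0) = 3 / 20" for s
  proof -
    define z where "z = s - s0"
    have z: "norm z = 3 / 20" "s = s0 + z" using s by (simp_all add: z_def)
    define E where "E = (\<Sum>n\<in>{1..10}. Bc n * exp (- z * of_real (ln (real n))))"
    have 1: "norm (zet s - E) \<le> 2 / 100" unfolding E_def z(2) by (rule zet_near_s0) (use z in simp)
    have 2: "norm (E - (S0 - z * S1 + z\<^sup>2 / 2 * S2)) \<le> 229 / 10000"
      unfolding E_def S0_def S1_def S2_def by (rule zet_quadratic) (use z in simp)
    have 3: "norm (z * S1) \<ge> 3 / 20 * (769 / 1000)" unfolding norm_mult z(1) using m(2) by (intro mult_left_mono) auto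
    have 4: "norm (z\<^sup>2 / 2 * S2) \<le> 9 / 800 * (72 / 100)"
      using m(3) by (simp add: norm_mult norm_divide norm_power z(1) power_divide)
    define F where "F = S0 - z * S1 + z\<^sup>2 / 2 * S2"
    have "norm (z * S1) = norm ((S0 + z\<^sup>2 / 2 * S2) + ((E - F) + (zet s - E)) - zet s)" by (simp add: F_def algebra_simps)
    also have "\<dots> \<le> norm ((S0 + z\<^sup>2 / 2 * S2) + ((E - F) + (zet s - E))) + norm (zet s)" by (rule norm_triangle_ineq4)
    finally have "norm (z * S1) \<le> norm S0 + norm (z\<^sup>2 / 2 * S2) + norm (E - F) + norm (zet s - E) + norm (zet s)"
      using norm_triangle_ineq[of "S0 + z\<^sup>2 / 2 * S2" "(E - F) + (zet s - E)"] norm_triangle_ineq[of S0 "z\<^sup>2 / 2 * S2"]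
        norm_triangle_ineq[of "E - F" "zet s - E"] by linarith
    then show ?thesis using 1 2[folded F_def] 3 4 m(1) by linarith
  qed
  have sub: "cball s0 (3 / 20) \<subseteq> {s. Re s > 0}"
  proof
    fix s assume "s \<in> cball s0 (3 / 20)"
    then have "\<bar>Re (s0 - s)\<bar> \<le> 3 / 20" using abs_Re_le_cmod[of "s0 - s"] by (simp add: dist_norm)
    then have "Re (s0 - s) \<le> 3 / 20" by linarith
    then show "s \<in> {s. Re s > 0}" by (simp add: s0_def)
  qed
  have nzet: "zet s \<noteq> 0" if "s \<in> cball s0 (3 / 20)" for s
  proof -
    have "\<bar>Im (s0 - s)\<bar> \<le> 3 / 20" using that abs_Im_le_cmod[of "s0 - s"] by (simp add: dist_norm)
    then have "s \<noteq> 1" by (auto simp: s0_def)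
    then show ?thesis using nz[of s] sub that by (auto simp: zet_def)
  qed
  have eq: "1 / zet s = (s - 1) / Z s" for s by (simp add: zet_def)
  have hol: "(\<lambda>s. 1 / zet s) holomorphic_on cball s0 (3 / 20)"
    unfolding eq using nz sub by (intro holomorphic_intros holomorphic_on_subset[OF holomorphic_Z]) auto
  have "norm (1 / zet s0) \<le> 1 / (48 / 1000)"
  proof (rule maximum_modulus_frontier[of "\<lambda>s. 1 / zet s" "cball s0 (3 / 20)"])
    show "(\<lambda>s. 1 / zet s) holomorphic_on interior (cball s0 (3 / 20))"
      using hol interior_subset by (rule holomorphic_on_subset)
    show "continuous_on (closure (cball s0 (3 / 20))) (\<lambda>s. 1 / zet s)"
      using holomorphic_on_imp_continuous_on[OF hol] by simp
    fix s assume "s \<in> frontier (cball s0 (3 / 20))"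
    then have "norm (s - s0) = 3 / 20" by (simp add: frontier_cball dist_norm norm_minus_commute)
    then show "norm (1 / zet s) \<le> 1 / (48 / 1000)"
      unfolding norm_divide using circle by (intro frac_le) auto
  qed auto
  moreover have "norm (zet s0) > 0" using nzet[of s0] by simp
  ultimately have "norm (zet s0) \<ge> 48 / 1000" by (simp add: norm_divide field_simps)
  then show False using center by simp
qed

section \<open>The common growth exponent\<close>

text \<open>Z is s - 1 times zeta and Z 1 = 1, so these are exactly the zeros of zeta with positive
  real part.\<close>

definition zeros :: "complex set" where "zeros = {\<rho>. Re \<rho> > 0 \<and> Z \<rho> = 0}"

definition Theta :: real where "Theta = (SUP \<rho>\<in>zeros. Re \<rho>)"

lemma zeros_nonempty: "zeros \<noteq> {}"
  using Z_zero_exists by (auto simp: zeros_def)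

lemma bdd_above_zeros: "bdd_above (Re ` zeros)"
proof (rule bdd_aboveI2)
  fix \<rho> assume "\<rho> \<in> zeros"
  then show "Re \<rho> \<le> 1" using Z_nonzero[of \<rho>] by (force simp: zeros_def)
qed

lemma Theta_le_1: "Theta \<le> 1"
  unfolding Theta_def
proof (rule cSUP_least[OF zeros_nonempty])
  fix \<rho> assume "\<rho> \<in> zeros"
  then show "Re \<rho> \<le> 1" using Z_nonzero[of \<rho>] by (force simp: zeros_def)
qed

lemma Re_zero_le_Theta: "\<rho> \<in> zeros \<Longrightarrow> Re \<rho> \<le> Theta"
  unfolding Theta_def by (rule cSUP_upper[OF _ bdd_above_zeros])

lemma Theta_pos: "Theta > 0"
proof -
  obtain \<rho> where "\<rho> \<in> zeros" using zeros_nonempty by auto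
  then show ?thesis using Re_zero_le_Theta[of \<rho>] by (simp add: zeros_def)
qed

lemma Z_nonzero_right_of_Theta: "Re s > Theta \<Longrightarrow> Z s \<noteq> 0"
  using Re_zero_le_Theta[of s] Theta_pos by (force simp: zeros_def)

lemma zero_near_Theta: "\<beta> < Theta \<Longrightarrow> \<exists>\<rho>\<in>zeros. Re \<rho> > \<beta>"
  unfolding Theta_def using less_cSUP_iff[OF zeros_nonempty bdd_above_zeros] by simp

lemma holomorphic_Z_right_of_Theta: "Z holomorphic_on {s. Re s > Theta}"
  by (rule holomorphic_on_subset[OF holomorphic_Z]) (use Theta_pos in auto)

lemma holomorphic_deriv_Z: "deriv Z holomorphic_on {s. Re s > Theta}"
  by (rule holomorphic_deriv[OF holomorphic_Z_right_of_Theta open_halfspace_Re_gt])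

lemma deriv_zet:
  assumes "Re s > 0" "s \<noteq> 1"
  shows "deriv zet s = (deriv Z s * (s - 1) - Z s) / (s - 1)\<^sup>2"
proof -
  have d: "(Z has_field_derivative deriv Z s) (at s)"
    by (rule holomorphic_derivI[OF holomorphic_Z open_halfspace_Re_gt]) (use assms in auto)
  have "((\<lambda>s. Z s / (s - 1)) has_field_derivative (deriv Z s * (s - 1) - Z s * 1) / ((s - 1) * (s - 1))) (at s)"
    by (rule DERIV_divide[OF d]) (use assms in \<open>auto intro!: derivative_eq_intros\<close>)
  then have "((\<lambda>s. Z s / (s - 1)) has_field_derivative (deriv Z s * (s - 1) - Z s) / (s - 1)\<^sup>2) (at s)"
    by (simp add: power2_eq_square)
  moreover have "zet = (\<lambda>s. Z s / (s - 1))" by (simp add: zet_def fun_eq_iff)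
  ultimately show ?thesis using DERIV_imp_deriv by metis
qed

text \<open>\<open>zet_log_bound\<close> covers |Im s| \<ge> 4, and compactness of a rectangle
  covers the rest. The logarithmic derivatives of Z and \<open>zet\<close> differ by 1 / (s - 1), of
  modulus at most 1 in the upper range of |Im s|.\<close>

lemma Z_ratio_bounds:
  assumes \<sigma>0: "Theta < \<sigma>0" "\<sigma>0 < 3" and \<epsilon>: "\<epsilon> > 0"
  obtains C where "C > 0"
    "\<And>s. \<sigma>0 \<le> Re s \<Longrightarrow> Re s \<le> 3 \<Longrightarrow> norm ((s - 1) / Z s) \<le> C * (1 + \<bar>Im s\<bar>) powr \<epsilon>"
    "\<And>s. \<sigma>0 \<le> Re s \<Longrightarrow> Re s \<le> 3 \<Longrightarrow> norm (deriv Z s / Z s) \<le> C * (1 + \<bar>Im s\<bar>) powr \<epsilon>"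
proof -
  define \<sigma>1 where "\<sigma>1 = (Theta + \<sigma>0) / 2"
  have \<sigma>1: "0 < \<sigma>1" "\<sigma>1 < \<sigma>0" "Theta < \<sigma>1" using \<sigma>0 Theta_pos by (auto simp: \<sigma>1_def)
  obtain C1 where C1: "C1 > 0" "\<And>s. \<sigma>0 \<le> Re s \<Longrightarrow> Re s \<le> 3 \<Longrightarrow> \<bar>Im s\<bar> \<ge> 4 \<Longrightarrow>
      norm (1 / zet s) \<le> C1 * \<bar>Im s\<bar> powr \<epsilon> \<and> norm (deriv zet s / zet s) \<le> C1 * \<bar>Im s\<bar> powr \<epsilon>"
  proof (rule zet_log_bound[OF \<sigma>1(1,2) \<sigma>0(2) _ \<epsilon>])
    fix s assume "Re s > \<sigma>1"
    then show "Z s \<noteq> 0" using \<sigma>1 by (intro Z_nonzero_right_of_Theta) simp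
  qed blast
  define K where "K = cbox (Complex \<sigma>0 (-4)) (Complex 3 4)"
  have K: "s \<in> K \<longleftrightarrow> \<sigma>0 \<le> Re s \<and> Re s \<le> 3 \<and> \<bar>Im s\<bar> \<le> 4" for s by (auto simp: K_def in_cbox_complex_iff)
  have KT: "K \<subseteq> {s. Re s > Theta}" using \<sigma>0 by (auto simp: K)
  have nz: "Z s \<noteq> 0" if "\<sigma>0 \<le> Re s" for s using that \<sigma>0 by (intro Z_nonzero_right_of_Theta) simp
  have cont: "continuous_on K (\<lambda>s. (s - 1) / Z s)" "continuous_on K (\<lambda>s. deriv Z s / Z s)"
    using continuous_on_subset[OF holomorphic_on_imp_continuous_on[OF holomorphic_Z_right_of_Theta] KT]
      continuous_on_subset[OF holomorphic_on_imp_continuous_on[OF holomorphic_deriv_Z] KT] nz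
    by (auto intro!: continuous_intros simp: K)
  have "compact K" by (simp add: K_def)
  then have "bounded ((\<lambda>s. (s - 1) / Z s) ` K)" "bounded ((\<lambda>s. deriv Z s / Z s) ` K)"
    using cont by (auto intro: compact_imp_bounded compact_continuous_image)
  then obtain B1 B2 where B: "\<And>s. s \<in> K \<Longrightarrow> norm ((s - 1) / Z s) \<le> B1" "\<And>s. s \<in> K \<Longrightarrow> norm (deriv Z s / Z s) \<le> B2"
    unfolding bounded_iff by auto
  define C where "C = C1 + 1 + \<bar>B1\<bar> + \<bar>B2\<bar>"
  have C: "C > 0" "C1 + 1 \<le> C" "B1 \<le> C" "B2 \<le> C" using C1 by (auto simp: C_def)
  have p1: "1 \<le> (1 + \<bar>Im s\<bar>) powr \<epsilon>" for s using \<epsilon> by (intro ge_one_powr_ge_zero) auto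
  have small: "C \<le> C * (1 + \<bar>Im s\<bar>) powr \<epsilon>" for s using mult_left_mono[OF p1[of s], of C] C by simp
  have large: "(C1 + 1) * \<bar>Im s\<bar> powr \<epsilon> \<le> C * (1 + \<bar>Im s\<bar>) powr \<epsilon>" for s
    using C C1 \<epsilon> by (intro mult_mono powr_mono2) auto
  have z: "1 / zet s = (s - 1) / Z s" for s by (simp add: zet_def)
  show thesis
  proof (rule that[OF C(1)])
    fix s assume s: "\<sigma>0 \<le> Re s" "Re s \<le> 3"
    show "norm ((s - 1) / Z s) \<le> C * (1 + \<bar>Im s\<bar>) powr \<epsilon>"
    proof (cases "\<bar>Im s\<bar> \<ge> 4")
      case True
      have "norm ((s - 1) / Z s) \<le> C1 * \<bar>Im s\<bar> powr \<epsilon>" using C1(2)[OF s True] unfolding z by blast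
      also have "\<dots> \<le> (C1 + 1) * \<bar>Im s\<bar> powr \<epsilon>" by (intro mult_right_mono) auto
      finally show ?thesis using large[of s] by linarith
    next
      case False
      then have "norm ((s - 1) / Z s) \<le> B1" using s by (intro B) (simp add: K)
      then show ?thesis using small[of s] C by linarith
    qed
    show "norm (deriv Z s / Z s) \<le> C * (1 + \<bar>Im s\<bar>) powr \<epsilon>"
    proof (cases "\<bar>Im s\<bar> \<ge> 4")
      case True
      then have s1: "s \<noteq> 1" by auto
      have Zs: "Z s \<noteq> 0" using nz s by simp
      have d: "deriv zet s = (deriv Z s * (s - 1) - Z s) / (s - 1)\<^sup>2" using s \<sigma>1 s1 by (intro deriv_zet) auto
      have "deriv zet s / zet s = deriv Z s / Z s - 1 / (s - 1)"
        unfolding d zet_def using s1 Zs by (simp add: divide_simps power2_eq_square)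
      then have "deriv Z s / Z s = deriv zet s / zet s + 1 / (s - 1)" by simp
      then have "norm (deriv Z s / Z s) \<le> norm (deriv zet s / zet s) + norm (1 / (s - 1))"
        by (metis norm_triangle_ineq)
      also have "norm (1 / (s - 1)) \<le> 1"
      proof -
        have "norm (s - 1) \<ge> 1" using abs_Im_le_cmod[of "s - 1"] True by simp
        then show ?thesis by (simp add: norm_divide divide_le_eq_1)
      qed
      also have "1 \<le> \<bar>Im s\<bar> powr \<epsilon>" using True \<epsilon> by (intro ge_one_powr_ge_zero) auto
      also have "norm (deriv zet s / zet s) \<le> C1 * \<bar>Im s\<bar> powr \<epsilon>" using C1(2)[OF s True] by blast
      finally have "norm (deriv Z s / Z s) \<le> (C1 + 1) * \<bar>Im s\<bar> powr \<epsilon>" by (simp add: distrib_right)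
      then show ?thesis using large[of s] by linarith
    next
      case False
      then have "norm (deriv Z s / Z s) \<le> B2" using s by (intro B) (simp add: K)
      then show ?thesis using small[of s] C by linarith
    qed
  qed
qed

text \<open>Feeds H s / s into \<open>tauberian\<close>: division by s turns growth with exponent
  \<epsilon> into (1 + |Im s|)^(\<epsilon> - 1).\<close>

lemma abs_le_exp_of_laplace:
  fixes a :: "real \<Rightarrow> real" and H :: "complex \<Rightarrow> complex"
  assumes meas: "a \<in> borel_measurable borel" and bd: "\<And>v. v \<ge> 0 \<Longrightarrow> \<bar>a v\<bar> \<le> C * exp (2 * v)"
    and loc: "\<And>v w. 0 \<le> v \<Longrightarrow> 0 \<le> w \<Longrightarrow> \<lfloor>exp v\<rfloor> = \<lfloor>exp w\<rfloor> \<Longrightarrow> \<bar>a v - a w\<bar> \<le> 1"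
    and hol: "H holomorphic_on {s. Re s > Theta}"
    and lap: "\<And>s. Re s = 3 \<Longrightarrow> ((\<lambda>L. laplace a L s) \<longlongrightarrow> H s / s) at_top"
    and H: "\<And>\<sigma>0 \<epsilon>. Theta < \<sigma>0 \<Longrightarrow> \<sigma>0 < 3 \<Longrightarrow> \<epsilon> > 0 \<Longrightarrow>
      \<exists>D. \<forall>s. \<sigma>0 \<le> Re s \<longrightarrow> Re s \<le> 3 \<longrightarrow> norm (H s) \<le> D * (1 + \<bar>Im s\<bar>) powr \<epsilon>"
    and \<theta>: "\<theta> > Theta"
  shows "\<exists>E>0. \<forall>v\<ge>0. \<bar>a v\<bar> \<le> E * exp (\<theta> * v)"
proof -
  \<comment> \<open>The cap 2 ensures \<sigma>0 < 3 and \<epsilon> \<le> 1; the divisor 6 below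
    matches the loss 6 \<epsilon> in \<open>tauberian\<close>.\<close>
  define \<theta>' where "\<theta>' = min \<theta> 2"
  define \<sigma>0 where "\<sigma>0 = (Theta + \<theta>') / 2"
  define \<epsilon> where "\<epsilon> = (\<theta>' - \<sigma>0) / 6"
  have \<theta>': "Theta < \<theta>'" "\<theta>' \<le> 2" "\<theta>' \<le> \<theta>" using \<theta> Theta_le_1 by (auto simp: \<theta>'_def)
  have \<sigma>0: "Theta < \<sigma>0" "\<sigma>0 < 3" "0 < \<sigma>0" "\<sigma>0 < \<theta>'" using \<theta>' Theta_pos by (auto simp: \<sigma>0_def)
  have \<epsilon>: "0 < \<epsilon>" "\<epsilon> \<le> 1" "\<sigma>0 + 6 * \<epsilon> = \<theta>'" using \<sigma>0 \<theta>' by (auto simp: \<epsilon>_def field_simps)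
  obtain D where D: "\<And>s. \<sigma>0 \<le> Re s \<Longrightarrow> Re s \<le> 3 \<Longrightarrow> norm (H s) \<le> D * (1 + \<bar>Im s\<bar>) powr \<epsilon>"
    using H[OF \<sigma>0(1,2) \<epsilon>(1)] by blast
  obtain E where E: "\<And>v. v \<ge> 0 \<Longrightarrow> \<bar>a v\<bar> \<le> E * exp ((\<sigma>0 + 6 * \<epsilon>) * v)"
  proof (rule tauberian[OF meas bd loc _ \<sigma>0(3,2) lap _ \<epsilon>(1,2), of "D * (1 + 1 / \<sigma>0)"])
    show "(\<lambda>s. H s / s) holomorphic_on {s. \<sigma>0 \<le> Re s \<and> Re s \<le> 3}"
      by (intro holomorphic_intros holomorphic_on_subset[OF hol]) (use \<sigma>0 in auto)
    fix s assume s: "\<sigma>0 \<le> Re s" "Re s \<le> 3"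
    have "1 + \<bar>Im s\<bar> \<le> Re s / \<sigma>0 + \<bar>Im s\<bar>" using s \<sigma>0 by simp
    also have "\<dots> \<le> norm s / \<sigma>0 + norm s"
      using abs_Re_le_cmod[of s] abs_Im_le_cmod[of s] \<sigma>0 by (intro add_mono divide_right_mono) linarith+
    finally have "1 + \<bar>Im s\<bar> \<le> (1 + 1 / \<sigma>0) * norm s" by (simp add: algebra_simps)
    moreover have ns: "norm s > 0" using s \<sigma>0 by auto
    ultimately have inv: "1 / norm s \<le> (1 + 1 / \<sigma>0) / (1 + \<bar>Im s\<bar>)" by (simp add: field_simps)
    have pos: "0 \<le> D * (1 + \<bar>Im s\<bar>) powr \<epsilon>" using D[OF s] norm_ge_zero order_trans by blast
    have "norm (H s / s) = norm (H s) * (1 / norm s)" by (simp add: norm_divide)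
    also have "\<dots> \<le> (D * (1 + \<bar>Im s\<bar>) powr \<epsilon>) * ((1 + 1 / \<sigma>0) / (1 + \<bar>Im s\<bar>))"
      using D[OF s] inv pos by (intro mult_mono) auto
    also have "\<dots> = D * (1 + 1 / \<sigma>0) * (1 + \<bar>Im s\<bar>) powr (\<epsilon> - 1)"
      by (simp add: powr_diff)
    finally show "norm (H s / s) \<le> D * (1 + 1 / \<sigma>0) * (1 + \<bar>Im s\<bar>) powr (\<epsilon> - 1)" .
  qed (assumption | rule that)+
  have "\<bar>a v\<bar> \<le> (\<bar>E\<bar> + 1) * exp (\<theta> * v)" if v: "v \<ge> 0" for v
  proof -
    have "\<bar>a v\<bar> \<le> E * exp (\<theta>' * v)" using E[OF v] unfolding \<epsilon>(3) .
    also have "\<dots> \<le> (\<bar>E\<bar> + 1) * exp (\<theta> * v)" using \<theta>' v by (intro mult_mono) (auto intro: mult_right_mono)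
    finally show ?thesis .
  qed
  then show ?thesis by (intro exI[of _ "\<bar>E\<bar> + 1"]) auto
qed

lemma tendsto_laplace_divide:
  assumes "((\<lambda>L. Z s * laplace a L s) \<longlongrightarrow> W) at_top" "Re s > Theta"
  shows "((\<lambda>L. laplace a L s) \<longlongrightarrow> W / Z s) at_top"
proof -
  have "Z s \<noteq> 0" using Z_nonzero_right_of_Theta assms(2) .
  then show ?thesis using tendsto_divide[OF assms(1) tendsto_const[of "Z s"]] by simp
qed

lemma M_log_upper_bound:
  assumes "\<theta> > Theta"
  shows "\<exists>E>0. \<forall>v\<ge>0. \<bar>M_log v\<bar> \<le> E * exp (\<theta> * v)"
proof (rule abs_le_exp_of_laplace[where C = 1 and H = "\<lambda>s. (s - 1) / Z s"])
  fix v :: real assume "v \<ge> 0"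
  then show "\<bar>M_log v\<bar> \<le> 1 * exp (2 * v)" using abs_M_log_le[of v] by (force intro: order_trans)
next
  fix v w :: real assume "\<lfloor>exp v\<rfloor> = \<lfloor>exp w\<rfloor>"
  then show "\<bar>M_log v - M_log w\<bar> \<le> 1" by (simp add: M_log_def mertens_def)
next
  show "(\<lambda>s. (s - 1) / Z s) holomorphic_on {s. Re s > Theta}"
    by (intro holomorphic_intros holomorphic_Z_right_of_Theta) (use Z_nonzero_right_of_Theta in auto)
next
  fix s assume "Re s = 3"
  then show "((\<lambda>L. laplace M_log L s) \<longlongrightarrow> (s - 1) / Z s / s) at_top"
    using tendsto_laplace_divide[OF laplace_M_log, of s] Theta_le_1 by (simp add: mult.commute)
next
  fix \<sigma>0 \<epsilon> :: real assume "Theta < \<sigma>0" "\<sigma>0 < 3" "\<epsilon> > 0"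
  then show "\<exists>D. \<forall>s. \<sigma>0 \<le> Re s \<longrightarrow> Re s \<le> 3 \<longrightarrow> norm ((s - 1) / Z s) \<le> D * (1 + \<bar>Im s\<bar>) powr \<epsilon>"
    by (rule Z_ratio_bounds) blast
qed (use assms in \<open>simp_all add: measurable_M_log\<close>)

lemma Delta_log_upper_bound:
  assumes "\<theta> > Theta"
  shows "\<exists>E>0. \<forall>v\<ge>0. \<bar>Delta_log v\<bar> \<le> E * exp (\<theta> * v)"
proof -
  obtain C where C: "\<And>v. v \<ge> 0 \<Longrightarrow> \<bar>Delta_log v\<bar> \<le> C * exp (2 * v)"
    using Delta_log_le_exp[of 2] by auto
  show ?thesis
  proof (rule abs_le_exp_of_laplace[where C = C and H = "\<lambda>s. - (deriv Z s / Z s + 1)"])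
    fix v w :: real assume eq: "\<lfloor>exp v\<rfloor> = \<lfloor>exp w\<rfloor>"
    \<comment> \<open>Between jumps \<open>psi\<close> is constant and \<open>Delta\<close> drifts
      only with its linear term.\<close>
    then have "\<bar>exp w - exp v\<bar> \<le> 1" by linarith
    then show "\<bar>Delta_log v - Delta_log w\<bar> \<le> 1" using eq by (simp add: Delta_log_def Delta_def psi_def)
  next
    show "(\<lambda>s. - (deriv Z s / Z s + 1)) holomorphic_on {s. Re s > Theta}"
      by (intro holomorphic_intros holomorphic_Z_right_of_Theta holomorphic_deriv_Z) (use Z_nonzero_right_of_Theta in auto)
  next
    fix s assume s: "Re s = 3"
    have "Z s \<noteq> 0" using s Z_nonzero by simp
    then have e: "deriv Z s / Z s + 1 = (deriv Z s + Z s) / Z s" by (simp add: add_divide_distrib)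
    have "- (deriv Z s + Z s) / s / Z s = - (deriv Z s / Z s + 1) / s"
      unfolding e by (simp only: minus_divide_left divide_divide_eq_left mult.commute[of s])
    moreover have "((\<lambda>L. laplace Delta_log L s) \<longlongrightarrow> - (deriv Z s + Z s) / s / Z s) at_top"
      by (rule tendsto_laplace_divide[OF laplace_Delta_log]) (use s Theta_le_1 in auto)
    ultimately show "((\<lambda>L. laplace Delta_log L s) \<longlongrightarrow> - (deriv Z s / Z s + 1) / s) at_top" by simp
  next
    fix \<sigma>0 \<epsilon> :: real assume a: "Theta < \<sigma>0" "\<sigma>0 < 3" "\<epsilon> > 0"
    then obtain D where D: "\<And>s. \<sigma>0 \<le> Re s \<Longrightarrow> Re s \<le> 3 \<Longrightarrow> norm (deriv Z s / Z s) \<le> D * (1 + \<bar>Im s\<bar>) powr \<epsilon>"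
      by (rule Z_ratio_bounds) blast
    have "norm (- (deriv Z s / Z s + 1)) \<le> (D + 1) * (1 + \<bar>Im s\<bar>) powr \<epsilon>" if "\<sigma>0 \<le> Re s" "Re s \<le> 3" for s
    proof -
      have "1 \<le> (1 + \<bar>Im s\<bar>) powr \<epsilon>" using a by (intro ge_one_powr_ge_zero) auto
      then show ?thesis using D[OF that] norm_triangle_ineq[of "deriv Z s / Z s" 1]
        unfolding distrib_right norm_minus_cancel norm_one mult_1_left by linarith
    qed
    then show "\<exists>D. \<forall>s. \<sigma>0 \<le> Re s \<longrightarrow> Re s \<le> 3 \<longrightarrow> norm (- (deriv Z s / Z s + 1)) \<le> D * (1 + \<bar>Im s\<bar>) powr \<epsilon>"
      by blast
  qed (use assms C in \<open>simp_all add: measurable_Delta_log\<close>)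
qed

text \<open>A constant is harmless in the upper bound since ln E / ln x tends to 0; in the lower
  bound it can be absorbed by decreasing \<beta>. The lower bound also supplies the positivity of f
  needed for the logarithms.\<close>

lemma tendsto_ln_ratio:
  fixes f :: "real \<Rightarrow> real"
  assumes lower: "\<And>\<beta>. \<beta> < \<Theta> \<Longrightarrow> eventually (\<lambda>x. x powr \<beta> \<le> f x) at_top"
    and upper: "\<And>\<theta>. \<theta> > \<Theta> \<Longrightarrow> \<exists>E>0. eventually (\<lambda>x. f x \<le> E * x powr \<theta>) at_top"
  shows "((\<lambda>x. ln (f x) / ln x) \<longlongrightarrow> \<Theta>) at_top"
proof (rule order_tendstoI)
  fix a assume "a < \<Theta>"
  then obtain \<beta> where \<beta>: "a < \<beta>" "\<beta> < \<Theta>" using dense by blast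
  show "eventually (\<lambda>x. a < ln (f x) / ln x) at_top"
    using lower[OF \<beta>(2)] eventually_gt_at_top[of 1]
  proof eventually_elim
    case (elim x)
    have "\<beta> * ln x = ln (x powr \<beta>)" using elim by (simp add: ln_powr)
    also have "\<dots> \<le> ln (f x)" using elim by (intro ln_mono) auto
    finally have "\<beta> \<le> ln (f x) / ln x" using elim by (simp add: field_simps)
    then show ?case using \<beta> by simp
  qed
next
  fix a assume "a > \<Theta>"
  then obtain \<theta> where \<theta>: "\<Theta> < \<theta>" "\<theta> < a" using dense by blast
  obtain E where E: "E > 0" "eventually (\<lambda>x. f x \<le> E * x powr \<theta>) at_top" using upper[OF \<theta>(1)] by blast
  have "((\<lambda>x. ln E / ln x + \<theta>) \<longlongrightarrow> 0 + \<theta>) at_top"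
    by (intro tendsto_add tendsto_const tendsto_divide_0[OF tendsto_const] filterlim_at_top_imp_at_infinity ln_at_top)
  then have "eventually (\<lambda>x. ln E / ln x + \<theta> < a) at_top" using \<theta> by (intro order_tendstoD(2)) auto
  moreover have "eventually (\<lambda>x. x powr (\<Theta> - 1) \<le> f x) at_top" by (rule lower) simp
  ultimately show "eventually (\<lambda>x. ln (f x) / ln x < a) at_top"
    using E(2) eventually_gt_at_top[of 1]
  proof eventually_elim
    case (elim x)
    have "0 < x powr (\<Theta> - 1)" using elim by simp
    then have fp: "0 < f x" using elim by linarith
    have "ln (f x) \<le> ln (E * x powr \<theta>)" using elim fp by (intro ln_mono) auto
    also have "\<dots> = ln E + \<theta> * ln x" using elim E by (simp add: ln_mult ln_powr)
    finally have "ln (f x) / ln x \<le> (ln E + \<theta> * ln x) / ln x" using elim by (intro divide_right_mono) auto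
    also have "\<dots> = ln E / ln x + \<theta>" using elim by (simp add: add_divide_distrib)
    finally show ?case using elim by simp
  qed
qed

lemma tendsto_ratio_of_ln_ratio:
  fixes f g :: "real \<Rightarrow> real"
  assumes "((\<lambda>x. ln (f x) / ln x) \<longlongrightarrow> \<Theta>) at_top" "((\<lambda>x. ln (g x) / ln x) \<longlongrightarrow> \<Theta>) at_top" "\<Theta> \<noteq> 0"
  shows "((\<lambda>x. ln (f x) / ln (g x)) \<longlongrightarrow> 1) at_top"
proof -
  have "((\<lambda>x. (ln (f x) / ln x) / (ln (g x) / ln x)) \<longlongrightarrow> \<Theta> / \<Theta>) at_top"
    by (rule tendsto_divide[OF assms])
  moreover have "eventually (\<lambda>x. (ln (f x) / ln x) / (ln (g x) / ln x) = ln (f x) / ln (g x)) at_top"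
    using eventually_gt_at_top[of 1] by eventually_elim simp
  ultimately have "((\<lambda>x. ln (f x) / ln (g x)) \<longlongrightarrow> \<Theta> / \<Theta>) at_top" by (rule Lim_transform_eventually)
  then show ?thesis using assms(3) by simp
qed

text \<open>The segment [0, (1 - \<eta>) L] carries at most a multiple of exp (\<theta> (1 - \<eta>)
  L). With r > (1 - \<eta>) \<Theta> and \<theta> close enough to \<Theta> this is of smaller order
  than exp (r L), so the mass of the whole integral sits in the last segment.\<close>

lemma integral_tail_lower_bound:
  fixes a :: "real \<Rightarrow> real"
  assumes int: "\<And>L. (\<lambda>v. \<bar>a v\<bar>) integrable_on {0..L}"
    and upper: "\<And>\<theta>. \<theta> > \<Theta> \<Longrightarrow> \<exists>E>0. \<forall>v\<ge>0. \<bar>a v\<bar> \<le> E * exp (\<theta> * v)"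
    and lower: "\<And>\<beta>. \<beta> < \<Theta> \<Longrightarrow> \<exists>r>\<beta>. \<exists>c>0. \<exists>C. \<forall>L\<ge>0. c * exp (r * L) \<le> integral {0..L} (\<lambda>v. \<bar>a v\<bar>) + C * (1 + L)\<^sup>2"
    and \<Theta>: "\<Theta> > 0" and \<eta>: "0 < \<eta>" "\<eta> < 1" and \<beta>: "\<beta> < \<Theta>"
  shows "eventually (\<lambda>L. exp (\<beta> * L) \<le> integral {(1 - \<eta>) * L..L} (\<lambda>v. \<bar>a v\<bar>)) at_top"
proof -
  \<comment> \<open>Each entry makes r beat one competitor: the claimed exp (\<beta> * L), the
    initial segment, and, by positivity, the power (1 + L)^2.\<close>
  define \<beta>1 where "\<beta>1 = Max {\<beta>, (1 - \<eta>) * \<Theta>, 0}"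
  have "(1 - \<eta>) * \<Theta> < \<Theta>" using \<Theta> \<eta> by simp
  then have \<beta>1: "\<beta>1 < \<Theta>" "\<beta> \<le> \<beta>1" "(1 - \<eta>) * \<Theta> \<le> \<beta>1" "0 \<le> \<beta>1" using \<beta> \<Theta> by (auto simp: \<beta>1_def)
  obtain r c C where r: "r > \<beta>1" and c: "c > 0"
    and low: "\<And>L. L \<ge> 0 \<Longrightarrow> c * exp (r * L) \<le> integral {0..L} (\<lambda>v. \<bar>a v\<bar>) + C * (1 + L)\<^sup>2"
    using lower[OF \<beta>1(1)] by blast
  have rp: "r > 0" using r \<beta>1 by simp
  have "\<Theta> < r / (1 - \<eta>)" using \<eta> r \<beta>1 by (simp add: field_simps)
  then obtain \<theta> where \<theta>: "\<Theta> < \<theta>" "\<theta> < r / (1 - \<eta>)" using dense by blast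
  define k where "k = \<theta> * (1 - \<eta>)"
  have k: "k < r" using \<theta> \<eta> by (simp add: k_def field_simps)
  have \<theta>p: "\<theta> > 0" using \<theta> \<Theta> by simp
  obtain E where E: "E > 0" "\<And>v. v \<ge> 0 \<Longrightarrow> \<bar>a v\<bar> \<le> E * exp (\<theta> * v)" using upper[OF \<theta>(1)] by blast
  have lim: "((\<lambda>L. exp (\<beta> * L) / exp (r * L)) \<longlongrightarrow> 0) at_top"
    "((\<lambda>L. exp (k * L) / exp (r * L)) \<longlongrightarrow> 0) at_top" "((\<lambda>L. (1 + L)\<^sup>2 / exp (r * L)) \<longlongrightarrow> 0) at_top"
  proof -
    have e: "((\<lambda>L::real. exp (- (d * L))) \<longlongrightarrow> 0) at_top" if "d > 0" for d using that by real_asymp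
    show "((\<lambda>L. exp (\<beta> * L) / exp (r * L)) \<longlongrightarrow> 0) at_top" using e[of "r - \<beta>"] r \<beta>1
      by (simp add: exp_diff[symmetric] left_diff_distrib)
    show "((\<lambda>L. exp (k * L) / exp (r * L)) \<longlongrightarrow> 0) at_top" using e[of "r - k"] k
      by (simp add: exp_diff[symmetric] left_diff_distrib)
    show "((\<lambda>L. (1 + L)\<^sup>2 / exp (r * L)) \<longlongrightarrow> 0) at_top" using rp by real_asymp
  qed
  have "((\<lambda>L. exp (\<beta> * L) / exp (r * L) + E / \<theta> * (exp (k * L) / exp (r * L)) + C * ((1 + L)\<^sup>2 / exp (r * L))) \<longlongrightarrow> 0 + E / \<theta> * 0 + C * 0) at_top"
    by (intro tendsto_intros lim)
  then have "eventually (\<lambda>L. exp (\<beta> * L) / exp (r * L) + E / \<theta> * (exp (k * L) / exp (r * L)) + C * ((1 + L)\<^sup>2 / exp (r * L)) < c) at_top"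
    using c by (intro order_tendstoD(2)) auto
  then show ?thesis using eventually_ge_at_top[of 0]
  proof eventually_elim
    case (elim L)
    define y where "y = (1 - \<eta>) * L"
    have y: "0 \<le> y" "y \<le> L" using elim \<eta> by (auto simp: y_def mult_left_le_one_le)
    have "(exp (\<beta> * L) + E / \<theta> * exp (k * L) + C * (1 + L)\<^sup>2) / exp (r * L) < c"
      using elim(1) by (simp add: add_divide_distrib)
    then have main: "exp (\<beta> * L) + E / \<theta> * exp (k * L) + C * (1 + L)\<^sup>2 < c * exp (r * L)"
      by (simp add: pos_divide_less_eq)
    have hi: "((\<lambda>v. E * exp (\<theta> * v)) has_integral (E / \<theta> * exp (\<theta> * y) - E / \<theta> * exp (\<theta> * 0))) {0..y}"
      using y \<theta>p by (intro fundamental_theorem_of_calculus)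
        (auto intro!: derivative_eq_intros simp: has_real_derivative_iff_has_vector_derivative[symmetric])
    have "integral {0..y} (\<lambda>v. \<bar>a v\<bar>) \<le> integral {0..y} (\<lambda>v. E * exp (\<theta> * v))"
      using E hi by (intro integral_le int) auto
    also have "\<dots> \<le> E / \<theta> * exp (\<theta> * y)" unfolding integral_unique[OF hi] using E \<theta>p by simp
    also have "\<theta> * y = k * L" by (simp add: k_def y_def)
    finally have "integral {0..y} (\<lambda>v. \<bar>a v\<bar>) \<le> E / \<theta> * exp (k * L)" .
    moreover have "integral {0..y} (\<lambda>v. \<bar>a v\<bar>) + integral {y..L} (\<lambda>v. \<bar>a v\<bar>) = integral {0..L} (\<lambda>v. \<bar>a v\<bar>)"
      by (rule Henstock_Kurzweil_Integration.integral_combine[OF y int])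
    ultimately show ?case unfolding y_def[symmetric] using main low[OF elim(2)] by linarith
  qed
qed

text \<open>The properties shared by \<open>mertens\<close> and \<open>Delta\<close>.
  \<open>near_0\<close> covers [0, 1], most of which the variable v = ln u \<ge> 0 does not
  reach.\<close>

locale growth_function =
  fixes A :: "real \<Rightarrow> real"
  assumes measurable: "A \<in> borel_measurable borel"
    and near_0: "\<And>u. 0 \<le> u \<Longrightarrow> u \<le> 1 \<Longrightarrow> \<bar>A u\<bar> \<le> 1"
    and upper: "\<And>\<theta>. \<theta> > Theta \<Longrightarrow> \<exists>E>0. \<forall>v\<ge>0. \<bar>A (exp v)\<bar> \<le> E * exp (\<theta> * v)"
    and lower: "\<And>\<rho>. Z \<rho> = 0 \<Longrightarrow> Re \<rho> > 0 \<Longrightarrow> \<exists>c>0. \<exists>C. \<forall>L\<ge>0. c * exp (Re \<rho> * L) \<le> integral {0..L} (\<lambda>v. \<bar>A (exp v)\<bar>) + C * (1 + L)\<^sup>2"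
begin

lemma powr_bound:
  assumes "\<theta> > Theta"
  obtains E where "E > 0" "\<And>x u. x \<ge> 1 \<Longrightarrow> 0 \<le> u \<Longrightarrow> u \<le> x \<Longrightarrow> \<bar>A u\<bar> \<le> E * x powr \<theta>"
proof -
  obtain E where E: "E > 0" "\<And>v. v \<ge> 0 \<Longrightarrow> \<bar>A (exp v)\<bar> \<le> E * exp (\<theta> * v)" using upper[OF assms] by blast
  have \<theta>: "\<theta> > 0" using assms Theta_pos by simp
  show thesis
  proof (rule that[of "E + 1"])
    fix x u :: real assume x: "x \<ge> 1" "0 \<le> u" "u \<le> x"
    show "\<bar>A u\<bar> \<le> (E + 1) * x powr \<theta>"
    proof (cases "u \<ge> 1")
      case True
      have "\<bar>A u\<bar> \<le> E * exp (\<theta> * ln u)" using E(2)[of "ln u"] True by simp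
      also have "\<dots> = E * u powr \<theta>" using True by (simp add: powr_def)
      also have "\<dots> \<le> (E + 1) * x powr \<theta>" using x E \<theta> by (intro mult_mono powr_mono2) auto
      finally show ?thesis .
    next
      case False
      have "\<bar>A u\<bar> \<le> 1 * 1" using near_0 x False by simp
      also have "\<dots> \<le> (E + 1) * x powr \<theta>" using x E \<theta> by (intro mult_mono ge_one_powr_ge_zero) auto
      finally show ?thesis .
    qed
  qed (use E in auto)
qed

lemma absolutely_integrable: "A absolutely_integrable_on {a..b}" if ab: "0 \<le> a"
proof -
  have "Theta < 2" using Theta_le_1 by simp
  then obtain E where E: "\<And>x u. x \<ge> 1 \<Longrightarrow> 0 \<le> u \<Longrightarrow> u \<le> x \<Longrightarrow> \<bar>A u\<bar> \<le> E * x powr 2"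
    by (rule powr_bound) blast
  show ?thesis
    by (rule bounded_measurable_absolutely_integrable[OF measurable, of _ _ "E * max 1 b powr 2"])
      (use E[of "max 1 b"] ab in auto)
qed

lemma integrable_abs: "0 \<le> a \<Longrightarrow> (\<lambda>u. \<bar>A u\<bar>) integrable_on {a..b}"
  using absolutely_integrable[of a b] by (simp add: absolutely_integrable_on_def)

lemma integrable_abs_exp: "(\<lambda>v. \<bar>A (exp v)\<bar>) integrable_on {0..L}"
proof -
  have "Theta < 2" using Theta_le_1 by simp
  then obtain E where E: "E > 0" "\<And>v. v \<ge> 0 \<Longrightarrow> \<bar>A (exp v)\<bar> \<le> E * exp (2 * v)" using upper[of 2] by blast
  have "(\<lambda>v. A (exp v)) absolutely_integrable_on {0..L}"
  proof (rule bounded_measurable_absolutely_integrable)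
    show "(\<lambda>v. A (exp v)) \<in> borel_measurable borel"
      using measurable by (rule measurable_compose[rotated]) simp
    fix v assume v: "v \<in> {0..L}"
    have "E * exp (2 * v) \<le> E * exp (2 * L)" using v E(1) by (intro mult_left_mono) auto
    then show "norm (A (exp v)) \<le> E * exp (2 * L)" using E(2)[of v] v by simp
  qed
  then show ?thesis by (simp add: absolutely_integrable_on_def)
qed

lemma tail:
  assumes "0 < \<eta>" "\<eta> < 1" "\<beta> < Theta"
  shows "eventually (\<lambda>L. exp (\<beta> * L) \<le> integral {(1 - \<eta>) * L..L} (\<lambda>v. \<bar>A (exp v)\<bar>)) at_top"
proof (rule integral_tail_lower_bound[OF integrable_abs_exp upper _ Theta_pos assms])
  fix \<beta> assume "\<beta> < Theta"
  then obtain \<rho> where "\<rho> \<in> zeros" "Re \<rho> > \<beta>" using zero_near_Theta by blast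
  then show "\<exists>r>\<beta>. \<exists>c>0. \<exists>C. \<forall>L\<ge>0. c * exp (r * L) \<le> integral {0..L} (\<lambda>v. \<bar>A (exp v)\<bar>) + C * (1 + L)\<^sup>2"
    using lower[of \<rho>] by (intro exI[of _ "Re \<rho>"]) (simp add: zeros_def)
qed

lemma tail_at_ln:
  assumes "0 < \<eta>" "\<eta> < 1" "\<beta> < Theta"
  shows "eventually (\<lambda>x. x powr \<beta> \<le> integral {(1 - \<eta>) * ln x..ln x} (\<lambda>v. \<bar>A (exp v)\<bar>)) at_top"
proof -
  have "eventually (\<lambda>x. exp (\<beta> * ln x) \<le> integral {(1 - \<eta>) * ln x..ln x} (\<lambda>v. \<bar>A (exp v)\<bar>)) at_top"
    using eventually_compose_filterlim[OF tail[OF assms] ln_at_top] .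
  then show ?thesis using eventually_gt_at_top[of 0] by eventually_elim (simp add: powr_def)
qed

text \<open>The substitution u = exp v turns the last segment into [x^(1 - \<eta>), x] with weight
  exp v \<ge> x^(1 - \<eta>), so the division by x loses only x^\<eta>.\<close>

lemma mean_value_growth: "((\<lambda>x. ln (1 / x * integral {0..x} (\<lambda>u. \<bar>A u\<bar>)) / ln x) \<longlongrightarrow> Theta) at_top"
proof (rule tendsto_ln_ratio)
  fix \<beta> assume \<beta>: "\<beta> < Theta"
  \<comment> \<open>Half of the gap \<open>Theta\<close> - \<beta> goes into \<beta>', the other
    half into the loss \<eta>; the cap 1 / 2 keeps \<eta> < 1.\<close>
  define \<eta> where "\<eta> = min (1 / 2) ((Theta - \<beta>) / 2)"
  define \<beta>' where "\<beta>' = (Theta + \<beta>) / 2"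
  have \<eta>: "0 < \<eta>" "\<eta> < 1" "\<beta>' < Theta" "\<beta> \<le> \<beta>' - \<eta>" using \<beta> by (auto simp: \<eta>_def \<beta>'_def field_simps min_def)
  show "eventually (\<lambda>x. x powr \<beta> \<le> 1 / x * integral {0..x} (\<lambda>u. \<bar>A u\<bar>)) at_top"
    using tail_at_ln[OF \<eta>(1-3)] eventually_gt_at_top[of 1]
  proof eventually_elim
    case (elim x)
    define y where "y = (1 - \<eta>) * ln x"
    have lx: "ln x > 0" using elim by simp
    have y: "0 \<le> y" "y \<le> ln x" using lx \<eta> by (auto simp: y_def mult_left_le_one_le)
    have im: "exp ` {y..ln x} = {exp y..x}"
    proof
      show "{exp y..x} \<subseteq> exp ` {y..ln x}"
      proof
        fix u assume u: "u \<in> {exp y..x}"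
        then have "exp y \<le> u" by simp
        then have up: "u > 0" by (rule less_le_trans[OF exp_gt_zero])
        have "ln u \<in> {y..ln x}" using u up elim by (auto simp: ln_ge_iff)
        then show "u \<in> exp ` {y..ln x}" using up by (intro image_eqI[of _ _ "ln u"]) auto
      qed
    qed (use elim in \<open>auto simp: ln_ge_iff\<close>)
    have ey: "exp y \<ge> 0" by simp
    have "(\<lambda>v. \<bar>exp v\<bar> * \<bar>A (exp v)\<bar>) absolutely_integrable_on {y..ln x} \<and>
        integral {y..ln x} (\<lambda>v. \<bar>exp v\<bar> * \<bar>A (exp v)\<bar>) = integral {exp y..x} (\<lambda>u. \<bar>A u\<bar>)"
      using absolutely_integrable_norm[OF absolutely_integrable[OF ey, of x]]
      by (subst has_absolute_integral_change_of_variables_1')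
        (auto simp: im o_def inj_on_def intro!: derivative_eq_intros)
    then have cov: "(\<lambda>v. exp v * \<bar>A (exp v)\<bar>) integrable_on {y..ln x}"
      "integral {y..ln x} (\<lambda>v. exp v * \<bar>A (exp v)\<bar>) = integral {exp y..x} (\<lambda>u. \<bar>A u\<bar>)"
      by (simp_all add: absolutely_integrable_on_def)
    have iy: "(\<lambda>v. \<bar>A (exp v)\<bar>) integrable_on {y..ln x}"
      by (rule integrable_subinterval_real[OF integrable_abs_exp[of "ln x"]]) (use y in auto)
    have "x powr (\<beta>' + (1 - \<eta>)) = exp y * x powr \<beta>'" using elim by (simp add: powr_def y_def mult_exp_exp distrib_right add.commute)
    also have "\<dots> \<le> exp y * integral {y..ln x} (\<lambda>v. \<bar>A (exp v)\<bar>)" using elim(1) by (simp add: y_def)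
    also have "\<dots> = integral {y..ln x} (\<lambda>v. exp y * \<bar>A (exp v)\<bar>)" by simp
    also have "\<dots> \<le> integral {y..ln x} (\<lambda>v. exp v * \<bar>A (exp v)\<bar>)"
      by (intro integral_le integrable_on_mult_right cov(1) iy mult_right_mono) auto
    also have "\<dots> \<le> integral {0..x} (\<lambda>u. \<bar>A u\<bar>)"
      unfolding cov(2) by (intro integral_subset_le integrable_abs) (auto intro: order_trans[OF ey])
    finally have *: "x powr (\<beta>' + (1 - \<eta>)) \<le> integral {0..x} (\<lambda>u. \<bar>A u\<bar>)" .
    have "x powr \<beta> \<le> x powr (\<beta>' - \<eta>)" using elim \<eta> by (intro powr_mono) auto
    also have "\<dots> = 1 / x * x powr (\<beta>' + (1 - \<eta>))"
    proof -
      have "x powr (\<beta>' + (1 - \<eta>)) = x powr 1 * x powr (\<beta>' - \<eta>)" by (subst powr_add[symmetric]) (simp add: algebra_simps)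
      then show ?thesis using elim by simp
    qed
    also have "\<dots> \<le> 1 / x * integral {0..x} (\<lambda>u. \<bar>A u\<bar>)" using * elim by (intro mult_left_mono) auto
    finally show ?case .
  qed
next
  fix \<theta> assume "\<theta> > Theta"
  then obtain E where E: "E > 0" "\<And>x u. x \<ge> 1 \<Longrightarrow> 0 \<le> u \<Longrightarrow> u \<le> x \<Longrightarrow> \<bar>A u\<bar> \<le> E * x powr \<theta>"
    by (rule powr_bound) (assumption | rule that)+
  have "eventually (\<lambda>x. 1 / x * integral {0..x} (\<lambda>u. \<bar>A u\<bar>) \<le> E * x powr \<theta>) at_top"
    using eventually_ge_at_top[of 1]
  proof eventually_elim
    case (elim x)
    have "integral {0..x} (\<lambda>u. \<bar>A u\<bar>) \<le> integral {0..x} (\<lambda>u. E * x powr \<theta>)"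
      using elim E by (intro integral_le integrable_abs) auto
    also have "\<dots> = x * (E * x powr \<theta>)" using elim by simp
    finally show ?case using elim by (simp add: field_simps)
  qed
  then show "\<exists>E>0. eventually (\<lambda>x. 1 / x * integral {0..x} (\<lambda>u. \<bar>A u\<bar>) \<le> E * x powr \<theta>) at_top" using E by blast
qed

text \<open>The last segment has length at most ln x in v, so its integral is at most ln x times the
  supremum, and ln x is absorbed by x^d. The set T is left general to serve both
  [x^(1 - \<delta>), x] and [0, x].\<close>

lemma sup_growth:
  assumes \<eta>: "0 < \<eta>" "\<eta> < 1" and T: "\<And>x. x \<ge> 1 \<Longrightarrow> {x powr (1 - \<eta>)..x} \<subseteq> T x" "\<And>x. x \<ge> 1 \<Longrightarrow> T x \<subseteq> {0..x}"
  shows "((\<lambda>x. ln (SUP u\<in>T x. \<bar>A u\<bar>) / ln x) \<longlongrightarrow> Theta) at_top"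
proof (rule tendsto_ln_ratio)
  have "Theta < 2" using Theta_le_1 by simp
  then obtain E where E: "\<And>x u. x \<ge> 1 \<Longrightarrow> 0 \<le> u \<Longrightarrow> u \<le> x \<Longrightarrow> \<bar>A u\<bar> \<le> E * x powr 2"
    by (rule powr_bound) blast
  have bdd: "bdd_above ((\<lambda>u. \<bar>A u\<bar>) ` T x)" if "x \<ge> 1" for x
  proof (rule bdd_aboveI2)
    fix u assume "u \<in> T x"
    then have "u \<in> {0..x}" using T(2)[OF that] by blast
    then show "\<bar>A u\<bar> \<le> E * x powr 2" using E[OF that, of u] by simp
  qed
  fix \<beta> assume \<beta>: "\<beta> < Theta"
  then obtain \<beta>' where \<beta>': "\<beta> < \<beta>'" "\<beta>' < Theta" using dense by blast
  define d where "d = \<beta>' - \<beta>"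
  have d: "d > 0" using \<beta>' by (simp add: d_def)
  have "eventually (\<lambda>x::real. ln x \<le> x powr d) at_top" using d by real_asymp
  then show "eventually (\<lambda>x. x powr \<beta> \<le> (SUP u\<in>T x. \<bar>A u\<bar>)) at_top"
    using tail_at_ln[OF \<eta> \<beta>'(2)] eventually_gt_at_top[of 1]
  proof eventually_elim
    case (elim x)
    define y where "y = (1 - \<eta>) * ln x"
    define S where "S = (SUP u\<in>T x. \<bar>A u\<bar>)"
    have lx: "ln x > 0" using elim by simp
    have y: "0 \<le> y" "y \<le> ln x" using lx \<eta> by (auto simp: y_def mult_left_le_one_le)
    have iy: "(\<lambda>v. \<bar>A (exp v)\<bar>) integrable_on {y..ln x}"
      by (rule integrable_subinterval_real[OF integrable_abs_exp[of "ln x"]]) (use y in auto)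
    have le: "\<bar>A (exp v)\<bar> \<le> S" if "v \<in> {y..ln x}" for v
      unfolding S_def
    proof (rule cSUP_upper)
      have "x powr (1 - \<eta>) \<le> exp v" using that elim by (simp add: powr_def y_def)
      moreover have "exp v \<le> x" using that elim by (simp add: ln_ge_iff)
      ultimately have "exp v \<in> {x powr (1 - \<eta>)..x}" by simp
      then show "exp v \<in> T x" using T(1)[of x] elim by auto
      show "bdd_above ((\<lambda>u. \<bar>A u\<bar>) ` T x)" using bdd elim by simp
    qed
    have S0: "S \<ge> 0" using le[of y] y by auto
    have "x powr d * x powr \<beta> = x powr \<beta>'" by (simp add: powr_add[symmetric] d_def)
    also have "\<dots> \<le> integral {y..ln x} (\<lambda>v. \<bar>A (exp v)\<bar>)" using elim(2) by (simp add: y_def)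
    also have "\<dots> \<le> integral {y..ln x} (\<lambda>v. S)" using le iy by (intro integral_le) auto
    also have "\<dots> = (ln x - y) * S" using y by simp
    also have "\<dots> \<le> x powr d * S" using elim(1) y S0 by (intro mult_right_mono) auto
    finally show ?case using elim by (simp add: S_def)
  qed
next
  fix \<theta> assume "\<theta> > Theta"
  then obtain E where E: "E > 0" "\<And>x u. x \<ge> 1 \<Longrightarrow> 0 \<le> u \<Longrightarrow> u \<le> x \<Longrightarrow> \<bar>A u\<bar> \<le> E * x powr \<theta>"
    by (rule powr_bound) (assumption | rule that)+
  have "eventually (\<lambda>x. (SUP u\<in>T x. \<bar>A u\<bar>) \<le> E * x powr \<theta>) at_top"
    using eventually_ge_at_top[of 1]
  proof eventually_elim
    case (elim x)
    show ?case
    proof (rule cSUP_least)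
      have "x powr (1 - \<eta>) \<le> x powr 1" using elim \<eta> by (intro powr_mono) auto
      then have "x \<in> {x powr (1 - \<eta>)..x}" using elim by simp
      then show "T x \<noteq> {}" using T(1)[OF elim] by blast
      fix u assume "u \<in> T x"
      then have "u \<in> {0..x}" using T(2)[OF elim] by blast
      then show "\<bar>A u\<bar> \<le> E * x powr \<theta>" using E(2)[OF elim, of u] by simp
    qed
  qed
  then show "\<exists>E>0. eventually (\<lambda>x. (SUP u\<in>T x. \<bar>A u\<bar>) \<le> E * x powr \<theta>) at_top" using E by blast
qed

end

interpretation mertens: growth_function mertens
proof
  show "mertens \<in> borel_measurable borel"
    unfolding mertens_def[abs_def] by (rule measurable_floor_sum) simp
  show "\<bar>mertens u\<bar> \<le> 1" if "0 \<le> u" "u \<le> 1" for u using abs_mertens_le[of u] that by simp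
  show "\<exists>E>0. \<forall>v\<ge>0. \<bar>mertens (exp v)\<bar> \<le> E * exp (\<theta> * v)" if "\<theta> > Theta" for \<theta>
    using M_log_upper_bound[OF that] by (simp add: M_log_def)
  show "\<exists>c>0. \<exists>C. \<forall>L\<ge>0. c * exp (Re \<rho> * L) \<le> integral {0..L} (\<lambda>v. \<bar>mertens (exp v)\<bar>) + C * (1 + L)\<^sup>2"
    if "Z \<rho> = 0" "Re \<rho> > 0" for \<rho>
    using M_log_lower_bound[OF that] unfolding M_log_def by metis
qed

interpretation Delta: growth_function Delta
proof
  show "Delta \<in> borel_measurable borel"
    unfolding Delta_def[abs_def] psi_def by (intro borel_measurable_diff measurable_floor_sum) simp_all
  show "\<bar>Delta u\<bar> \<le> 1" if u: "0 \<le> u" "u \<le> 1" for u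
  proof (cases "u = 1")
    case True
    then show ?thesis using psi_le[of 1] psi_nonneg[of 1] by (simp add: Delta_def)
  next
    case False
    then have "\<lfloor>u\<rfloor> = 0" using u by (simp add: floor_eq_iff)
    then show ?thesis using u by (simp add: Delta_def psi_def)
  qed
  show "\<exists>E>0. \<forall>v\<ge>0. \<bar>Delta (exp v)\<bar> \<le> E * exp (\<theta> * v)" if "\<theta> > Theta" for \<theta>
    using Delta_log_upper_bound[OF that] by (simp add: Delta_log_def)
  show "\<exists>c>0. \<exists>C. \<forall>L\<ge>0. c * exp (Re \<rho> * L) \<le> integral {0..L} (\<lambda>v. \<bar>Delta (exp v)\<bar>) + C * (1 + L)\<^sup>2"
    if "Z \<rho> = 0" "Re \<rho> > 0" for \<rho>
    using Delta_log_lower_bound[OF that] unfolding Delta_log_def by metis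
qed

theorem corollary2p2:
  fixes \<delta> :: real
  assumes "\<delta> > 0"
  shows "((\<lambda>x. ln (D_M x) / ln (S_M \<delta> x)) \<longlongrightarrow> 1) at_top \<and>
         ((\<lambda>x. ln (S_M \<delta> x) / ln (D_psi x)) \<longlongrightarrow> 1) at_top \<and>
         ((\<lambda>x. ln (D_psi x) / ln (S_psi x)) \<longlongrightarrow> 1) at_top"
proof -
  have DM: "((\<lambda>x. ln (D_M x) / ln x) \<longlongrightarrow> Theta) at_top"
    unfolding D_M_def by (rule mertens.mean_value_growth)
  have Dpsi: "((\<lambda>x. ln (D_psi x) / ln x) \<longlongrightarrow> Theta) at_top"
    unfolding D_psi_def by (rule Delta.mean_value_growth)
  have SM: "((\<lambda>x. ln (S_M \<delta> x) / ln x) \<longlongrightarrow> Theta) at_top"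
    unfolding S_M_def
  proof (rule mertens.sup_growth)
    \<comment> \<open>\<delta> may be 1 or more, while the segment argument needs a parameter below
      1; a smaller parameter gives a subinterval of the given one.\<close>
    show "0 < min \<delta> (1 / 2)" "min \<delta> (1 / 2) < 1" using assms by auto
    fix x :: real assume x: "x \<ge> 1"
    have "x powr (1 - \<delta>) \<le> x powr (1 - min \<delta> (1 / 2))" using x by (intro powr_mono) auto
    then show "{x powr (1 - min \<delta> (1 / 2))..x} \<subseteq> {x powr (1 - \<delta>)..x}" by auto
    show "{x powr (1 - \<delta>)..x} \<subseteq> {0..x}" by (auto intro: order_trans[OF powr_ge_zero])
  qed
  have Spsi: "((\<lambda>x. ln (S_psi x) / ln x) \<longlongrightarrow> Theta) at_top"
    unfolding S_psi_def
    by (rule Delta.sup_growth[of "1 / 2"]) (auto intro: order_trans[OF powr_ge_zero])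
  have "Theta \<noteq> 0" using Theta_pos by simp
  then show ?thesis using DM SM Dpsi Spsi by (blast intro: tendsto_ratio_of_ln_ratio)
qed

end
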